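(* Let $H$ be a (not necessarily semibounded) self-adjoint operator with bounded inverse in a Hilbert space $\mathcal{H}$, let $\mathcal{U}$ be a (not necessarily finite dimensional) closed subspace of $\mathcal{H}$ such that $\operatorname{Dom}(H)$ is invariant for the orthogonal projection $P_{\mathcal{U}}$ onto $\mathcal{U}$, and let $M = P_{\mathcal{U}} H|_{\mathcal{U}}$ with $\operatorname{Dom}(M) = \operatorname{Dom}(H) \cap \mathcal{U}$, as an operator in the Hilbert space $\mathcal{U}$. Suppose that $\eta := \lVert P_{\mathcal{U}} - P \rVert < 1$ with $P = H P_{\mathcal{U}} H^{-1}$. Then: (a) The operator $M$ is self-adjoint and has a bounded inverse. (b) With $d := \inf(\sigma_{\mathrm{ess}}(H) \cap (0,\infty)) \in (0,\infty]$ we have $$\inf\bigl( \sigma_{\mathrm{ess}}(M) \cap (0,\infty) \bigr) \geq (1-\eta) d.$$ (c) Denote by $(\mu_k)_{k \in J}$ with $J \subset \mathbb{N}$ the (finite or infinite) collection of eigenvalues of $M$ in the interval $(0,(1-\eta)d)$, in increasing order and counting multiplicities. Then there is a family of indices $j_k \in \mathbb{N}$, $k \in J$, strictly increasing in $k$, such that for each $k \in J$ we have $$\frac{\lvert \lambda_{j_k} - \mu_k \rvert}{\lambda_{j_k}} \leq \eta,$$ where $\lambda_j$ denotes the $j$-th positive eigenvalue of $H$ below $d$.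
   Context: Invariance of $\operatorname{Dom}(H)$ for $P_{\mathcal{U}}$ means $P_{\mathcal{U}} \operatorname{Dom}(H) \subset \operatorname{Dom}(H)$. The operator $P = H P_{\mathcal{U}} H^{-1}$ is an everywhere defined bounded operator on $\mathcal{H}$; it is the (in general non-orthogonal) projection onto $\mathcal{V} = \operatorname{Ran} H|_{\mathcal{U}} = \{Hu : u \in \operatorname{Dom}(H) \cap \mathcal{U}\}$ along $\mathcal{W}^\perp$, where $\mathcal{W} = \overline{\operatorname{Ran} H^{-1}|_{\mathcal{U}}}$. $\sigma_{\mathrm{ess}}$ denotes the essential spectrum, and $\inf \emptyset = \infty$. $\lambda_j \in (0,\infty)$ denotes the $j$-th positive eigenvalue of $H$ below $d = \inf(\sigma_{\mathrm{ess}}(H) \cap (0,\infty))$, in increasing order and counting multiplicities, provided that this eigenvalue exists; part (c) includes the assertion that the eigenvalues $\lambda_{j_k}$, $k \in J$, exist. *)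

theory Defs
  imports "HOL-Analysis.Analysis"
begin

section \<open>Complex Hilbert spaces\<close>

text \<open>
  A complex inner product is added on top of the class \<^class>\<open>real_inner\<close>, whose real inner product
  is required to be its real part, so that the norm and the topology are those induced by the complex
  inner product.  It is conjugate linear in the first argument.  Positive definiteness is inherited
  from \<^class>\<open>real_inner\<close>.
\<close>

class complex_inner = real_inner +
  fixes scaleC :: "complex \<Rightarrow> 'a \<Rightarrow> 'a"  (infixr \<open>*\<^sub>C\<close> 75)
    and cinner :: "'a \<Rightarrow> 'a \<Rightarrow> complex"
  assumes scaleC_add_right: "a *\<^sub>C (x + y) = a *\<^sub>C x + a *\<^sub>C y"
    and scaleC_add_left: "(a + b) *\<^sub>C x = a *\<^sub>C x + b *\<^sub>C x"
    and scaleC_scaleC: "a *\<^sub>C (b *\<^sub>C x) = (a * b) *\<^sub>C x"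
    and scaleR_scaleC: "r *\<^sub>R x = complex_of_real r *\<^sub>C x"
    and cinner_commute: "cinner x y = cnj (cinner y x)"
    and cinner_add_left: "cinner (x + y) z = cinner x z + cinner y z"
    and cinner_scaleC_left: "cinner (a *\<^sub>C x) y = cnj a * cinner x y"
    and inner_eq_Re_cinner: "inner x y = Re (cinner x y)"

class chilbert_space = complex_inner + complete_space

instantiation complex :: chilbert_space
begin

definition scaleC_complex_def: "a *\<^sub>C (x :: complex) = a * x"

definition cinner_complex_def: "cinner (x :: complex) y = cnj x * y"

instance
  by standard
    (auto simp: scaleC_complex_def cinner_complex_def inner_complex_def algebra_simps scaleR_conv_of_real)

end

lemma scaleC_one: "1 *\<^sub>C (x :: 'a :: complex_inner) = x"
  by (metis of_real_1 scaleR_one scaleR_scaleC)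

global_interpretation complex_vector: vector_space "scaleC :: complex \<Rightarrow> 'a \<Rightarrow> 'a :: complex_inner"
  defines csubspace = complex_vector.subspace
    and cspan = complex_vector.span
    and cdim = complex_vector.dim
  by unfold_locales (simp_all add: scaleC_add_right scaleC_add_left scaleC_scaleC scaleC_one)

definition closed_csubspace :: "'a :: complex_inner set \<Rightarrow> bool" where
  "closed_csubspace K \<longleftrightarrow> csubspace K \<and> closed K"

definition cfinite_dim :: "'a :: complex_inner set \<Rightarrow> bool" where
  "cfinite_dim E \<longleftrightarrow> (\<exists>B. finite B \<and> E \<subseteq> cspan B)"

text \<open>The orthogonal projection onto a closed subspace.\<close>

definition orth_proj :: "'a :: chilbert_space set \<Rightarrow> 'a \<Rightarrow> 'a" where
  "orth_proj U x = (THE p. p \<in> U \<and> (\<forall>u\<in>U. cinner u (x - p) = 0))"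


section \<open>Unbounded operators in a closed subspace\<close>

text \<open>
  An operator in the Hilbert space \<open>K\<close>, a closed subspace of the ambient space (possibly all of it),
  is given by its domain \<open>D \<subseteq> K\<close> and a function \<open>T\<close>; the values of \<open>T\<close> outside \<open>D\<close> are irrelevant.
  All notions below (density, adjoint, inverse, spectrum) are relative to \<open>K\<close>.
\<close>

definition linear_op :: "'a :: chilbert_space set \<Rightarrow> 'a set \<Rightarrow> ('a \<Rightarrow> 'a) \<Rightarrow> bool" where
  "linear_op K D T \<longleftrightarrow> csubspace D \<and> D \<subseteq> K \<and> T ` D \<subseteq> K \<and>
     (\<forall>x\<in>D. \<forall>y\<in>D. T (x + y) = T x + T y) \<and> (\<forall>a. \<forall>x\<in>D. T (a *\<^sub>C x) = a *\<^sub>C T x)"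

definition densely_defined :: "'a :: chilbert_space set \<Rightarrow> 'a set \<Rightarrow> bool" where
  "densely_defined K D \<longleftrightarrow> closure D = K"

definition adjoint_dom :: "'a :: chilbert_space set \<Rightarrow> 'a set \<Rightarrow> ('a \<Rightarrow> 'a) \<Rightarrow> 'a set" where
  "adjoint_dom K D T = {y \<in> K. \<exists>z\<in>K. \<forall>x\<in>D. cinner (T x) y = cinner x z}"

definition adjoint_op :: "'a :: chilbert_space set \<Rightarrow> 'a set \<Rightarrow> ('a \<Rightarrow> 'a) \<Rightarrow> 'a \<Rightarrow> 'a" where
  "adjoint_op K D T y = (THE z. z \<in> K \<and> (\<forall>x\<in>D. cinner (T x) y = cinner x z))"

definition selfadjoint :: "'a :: chilbert_space set \<Rightarrow> 'a set \<Rightarrow> ('a \<Rightarrow> 'a) \<Rightarrow> bool" where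
  "selfadjoint K D T \<longleftrightarrow> linear_op K D T \<and> densely_defined K D \<and>
     adjoint_dom K D T = D \<and> (\<forall>y\<in>D. adjoint_op K D T y = T y)"

text \<open>The inverse is required to be defined on all of \<open>K\<close>.\<close>

definition has_bounded_inverse :: "'a :: chilbert_space set \<Rightarrow> 'a set \<Rightarrow> ('a \<Rightarrow> 'a) \<Rightarrow> bool" where
  "has_bounded_inverse K D T \<longleftrightarrow> bij_betw T D K \<and>
     (\<exists>C. \<forall>y\<in>K. norm (inv_into D T y) \<le> C * norm y)"

definition spectrum :: "'a :: chilbert_space set \<Rightarrow> 'a set \<Rightarrow> ('a \<Rightarrow> 'a) \<Rightarrow> complex set" where
  "spectrum K D T = {z. \<not> has_bounded_inverse K D (\<lambda>x. T x - z *\<^sub>C x)}"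

definition eigenspace :: "'a :: chilbert_space set \<Rightarrow> ('a \<Rightarrow> 'a) \<Rightarrow> complex \<Rightarrow> 'a set" where
  "eigenspace D T z = {x \<in> D. T x = z *\<^sub>C x}"

definition discrete_spectrum :: "'a :: chilbert_space set \<Rightarrow> 'a set \<Rightarrow> ('a \<Rightarrow> 'a) \<Rightarrow> complex set" where
  "discrete_spectrum K D T = {z. z isolated_in spectrum K D T \<and>
     eigenspace D T z \<noteq> {0} \<and> cfinite_dim (eigenspace D T z)}"

text \<open>
  The usual definition for self-adjoint operators, the only ones it is used for: for these the
  different notions of essential spectrum (Fredholm, Weyl, complement of the isolated eigenvalues of
  finite multiplicity) coincide.
\<close>

definition essential_spectrum :: "'a :: chilbert_space set \<Rightarrow> 'a set \<Rightarrow> ('a \<Rightarrow> 'a) \<Rightarrow> complex set" where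
  "essential_spectrum K D T = spectrum K D T - discrete_spectrum K D T"

text \<open>The infimum of the positive part of the essential spectrum; \<open>\<infinity>\<close> if that part is empty.\<close>

definition inf_pos_ess :: "'a :: chilbert_space set \<Rightarrow> 'a set \<Rightarrow> ('a \<Rightarrow> 'a) \<Rightarrow> ereal" where
  "inf_pos_ess K D T = Inf (ereal ` {r. 0 < r \<and> complex_of_real r \<in> essential_spectrum K D T})"

text \<open>
  The family \<open>(\<mu> k)\<close>, \<open>k \<in> J\<close>, lists the eigenvalues of the operator in the real interval \<open>I\<close>
  in increasing order and counting multiplicities: every \<open>t \<in> I\<close> occurs exactly as often as the
  dimension of its eigenspace says (in particular not at all if \<open>t\<close> is not an eigenvalue).  The
  finiteness conditions are needed because \<^const>\<open>cdim\<close> and \<^const>\<open>card\<close> are \<open>0\<close> in the infinite case.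
\<close>

definition eigenvalue_family ::
  "'a :: chilbert_space set \<Rightarrow> ('a \<Rightarrow> 'a) \<Rightarrow> real set \<Rightarrow> nat set \<Rightarrow> (nat \<Rightarrow> real) \<Rightarrow> bool" where
  "eigenvalue_family D T I J \<mu> \<longleftrightarrow> \<mu> ` J \<subseteq> I \<and> mono_on J \<mu> \<and>
     (\<forall>t\<in>I. let E = eigenspace D T (complex_of_real t) in
        cfinite_dim E \<and> finite {k \<in> J. \<mu> k = t} \<and> card {k \<in> J. \<mu> k = t} = cdim E)"

text \<open>With such an index set, \<open>\<mu> j\<close> is the \<open>j\<close>-th eigenvalue in \<open>I\<close>, counting from \<open>1\<close>.\<close>

definition initial_segment :: "nat set \<Rightarrow> bool" where
  "initial_segment L \<longleftrightarrow> 0 \<notin> L \<and> (\<forall>k\<in>L. {1..k} \<subseteq> L)"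

end

theory Submission
  imports Defs
begin

text \<open>Write \<open>Q\<close> for the orthogonal projection onto \<open>U\<close> and \<open>H' = Q H Q + (1 - Q) H (1 - Q)\<close> for the
block-diagonal part of \<open>H\<close>, so that \<open>M\<close> is the restriction of \<open>H'\<close> to its reducing subspace \<open>U\<close>.
The difference \<open>H - H'\<close> is off-diagonal and differs from the commutator \<open>Q H - H Q = (Q - P) H\<close>
only by the sign of one of its two orthogonal blocks.  Hence \<open>|H x - H' x| \<le> \<eta> |H x|\<close>, that is,
\<open>H' = (1 - R) H\<close> with \<open>\<parallel>R\<parallel> \<le> \<eta> < 1\<close>.  So \<open>H'\<close> is symmetric, onto and bounded below, hence
self-adjoint with bounded inverse, and \<open>M\<close> inherits this.  That \<open>Q - P\<close> is a bounded operator, so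
that its \<^const>\<open>onorm\<close> bounds it, follows from the uniform boundedness principle.

The eigenvalues are compared by a min-max argument for the bounded inverses.  A positive eigenvalue
\<open>t\<close> of \<open>T\<close> is an eigenvalue \<open>1 / t\<close> of \<open>A = T\<inverse>\<close>, and the positive spectrum of \<open>T\<close> closest to \<open>0\<close> is
the top of the spectrum of \<open>A\<close>, even if the spectrum of \<open>T\<close> is unbounded on both sides.  Two facts link
the spectrum of \<open>T\<close> in \<open>(0, 1 / s)\<close> to the quadratic form of \<open>A\<close>:

 \<^item> If \<open>\<langle>A y, y\<rangle> \<le> s |y|\<^sup>2\<close> on \<open>F\<^sup>\<bottom>\<close> with \<open>F\<close> finite-dimensional, then \<open>T\<close> has in \<open>(0, 1 / s)\<close> only
   discrete eigenvalues, at most \<open>dim F\<close> of them with multiplicity (\<open>discrete_if_form_bound\<close>, \<open>cdim_Eig_le\<close>).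

 \<^item> If the spectrum of \<open>T\<close> in \<open>(0, \<tau>]\<close> is discrete, then \<open>\<langle>A y, y\<rangle> \<le> s |y|\<^sup>2\<close> for some \<open>s < 1 / \<tau>\<close> on
   the orthogonal complement of the eigenvectors for these eigenvalues
   (\<open>form_bound_orthocomp_Eig_closed\<close>); for \<open>(0, \<tau>)\<close> the bound is \<open>1 / \<tau>\<close> (\<open>form_bound_orthocomp_Eig_open\<close>).

The second fact and the transfers below rest on one observation (\<open>form_bound_if_bounded_below\<close>): the
supremum of the form of a bounded symmetric operator is an approximate eigenvalue.  It takes the place
of the spectral theorem.

The heart of the proof are the two transfers of a form bound between \<open>H\<close> and \<open>H'\<close>.  If \<open>F\<close>
is spanned by eigenvectors of \<open>H\<close> and the form of \<open>H\<inverse>\<close> is at most \<open>s\<close> on \<open>F\<^sup>\<bottom>\<close>, then that of \<open>H'\<inverse>\<close>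
is at most \<open>s / (1 - \<eta>)\<close> there (\<open>perturbed_form_bound\<close>).  If \<open>F\<close> is spanned by eigenvectors of
\<open>H'\<close> and the form of \<open>H'\<inverse>\<close> is at most \<open>s\<close> on \<open>F\<^sup>\<bottom>\<close>, then that of \<open>H\<inverse>\<close> is at most \<open>(1 + \<eta>) s\<close>
there (\<open>original_form_bound\<close>).  In both cases one operator leaves \<open>F\<^sup>\<bottom>\<close> invariant, and the inverse of
the other, compressed to \<open>F\<^sup>\<bottom>\<close>, is shown to have no approximate eigenvalue above the claimed bound.

With \<open>N\<close> counting the eigenvalues in an interval, this gives
\<open>N\<^bsub>H'\<^esub> (0, t] \<le> N\<^bsub>H\<^esub> (0, t / (1 - \<eta>)]\<close> and \<open>N\<^bsub>H\<^esub> (0, t / (1 + \<eta>)) \<le> N\<^bsub>H'\<^esub> (0, t)\<close>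
for \<open>t < (1 - \<eta>) d\<close>.  So the \<open>j\<close>-th eigenvalue \<open>\<mu>\<close> of \<open>H'\<close> satisfies
\<open>(1 - \<eta>) \<lambda>\<^sub>j \<le> \<mu> \<le> (1 + \<eta>) \<lambda>\<^sub>j\<close>.  Eigenvectors of \<open>M\<close> are eigenvectors of \<open>H'\<close>, and the index
of an eigenvalue of \<open>M\<close> among those of \<open>H'\<close> is the index \<open>j\<^sub>k\<close> of the theorem (\<open>match_indices\<close>).\<close>

section \<open>Complex inner products\<close>

lemma cinner_add_right: "cinner x (y + z) = cinner x y + cinner x (z :: 'a :: complex_inner)"
  by (metis cinner_add_left cinner_commute complex_cnj_add)

lemma cinner_scaleC_right: "cinner x (a *\<^sub>C y) = a * cinner x (y :: 'a :: complex_inner)"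
  by (metis cinner_commute cinner_scaleC_left complex_cnj_cnj complex_cnj_mult)

lemma cinner_zero_left [simp]: "cinner 0 (y :: 'a :: complex_inner) = 0"
  using cinner_add_left[of 0 0 y] by simp

lemma cinner_zero_right [simp]: "cinner (y :: 'a :: complex_inner) 0 = 0"
  using cinner_add_right[of y 0 0] by simp

lemma cinner_minus_left: "cinner (- x) y = - cinner x (y :: 'a :: complex_inner)"
  using cinner_add_left[of x "- x" y] by (simp add: eq_neg_iff_add_eq_0 add.commute)

lemma cinner_minus_right: "cinner x (- y) = - cinner x (y :: 'a :: complex_inner)"
  using cinner_add_right[of x y "- y"] by (simp add: eq_neg_iff_add_eq_0 add.commute)

lemma cinner_diff_left: "cinner (x - y) z = cinner x z - cinner y (z :: 'a :: complex_inner)"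
  using cinner_add_left[of x "- y" z] by (simp add: cinner_minus_left)

lemma cinner_diff_right: "cinner z (x - y) = cinner z x - cinner z (y :: 'a :: complex_inner)"
  using cinner_add_right[of z x "- y"] by (simp add: cinner_minus_right)

lemmas cinner_simps = cinner_add_left cinner_add_right cinner_diff_left cinner_diff_right
  cinner_scaleC_left cinner_scaleC_right cinner_minus_left cinner_minus_right

lemma cinner_sum_right: "cinner (y :: 'a :: complex_inner) (sum f A) = (\<Sum>i\<in>A. cinner y (f i))"
  by (induction A rule: infinite_finite_induct) (simp_all add: cinner_add_right)

lemma cinner_self: "cinner x x = complex_of_real ((norm (x :: 'a :: complex_inner))\<^sup>2)"
proof -
  have "Im (cinner x x) = 0"
    using cinner_commute[of x x] by (metis Reals_cnj_iff complex_is_Real_iff)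
  then show ?thesis
    by (simp add: complex_eq_iff inner_eq_Re_cinner[symmetric] power2_norm_eq_inner)
qed

lemma cinner_self_eq_0: "cinner x x = 0 \<longleftrightarrow> (x :: 'a :: complex_inner) = 0"
  by (simp add: cinner_self)

lemma norm_scaleC: "norm (a *\<^sub>C (x :: 'a :: complex_inner)) = cmod a * norm x"
proof -
  have "complex_of_real ((norm (a *\<^sub>C x))\<^sup>2) = complex_of_real ((cmod a * norm x)\<^sup>2)"
    by (simp only: cinner_self[symmetric] cinner_simps)
       (simp add: cinner_self complex_norm_square[symmetric] power_mult_distrib mult.assoc[symmetric]
         mult.commute[of "cnj a"])
  then show ?thesis
    by (metis mult_nonneg_nonneg norm_ge_zero of_real_eq_iff power2_eq_imp_eq)
qed

lemma norm_cinner_le: "cmod (cinner x y) \<le> norm x * norm (y :: 'a :: complex_inner)"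
proof (cases "cinner x y = 0")
  case False
  let ?c = "cinner x y"
  have "(cmod ?c)\<^sup>2 = inner (?c *\<^sub>C x) y"
    by (simp add: inner_eq_Re_cinner cinner_scaleC_left mult.commute complex_mult_cnj cmod_power2)
  also have "\<dots> \<le> cmod ?c * norm x * norm y"
    using norm_cauchy_schwarz[of "?c *\<^sub>C x" y] by (simp add: norm_scaleC)
  finally show ?thesis using False by (simp add: power2_eq_square mult.assoc)
qed simp

lemma bounded_linear_cinner_right: "bounded_linear (cinner (x :: 'a :: complex_inner))"
proof (rule bounded_linear_intro[where K = "norm x"])
  show "norm (cinner x y) \<le> norm y * norm x" for y
    using norm_cinner_le[of x y] by (simp only: mult.commute)
  show "cinner x (r *\<^sub>R y) = r *\<^sub>R cinner x y" for r y
    by (simp only: scaleR_scaleC cinner_scaleC_right scaleC_complex_def)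
qed (rule cinner_add_right)

lemma bounded_linear_scaleC_right: "bounded_linear (\<lambda>x :: 'a :: complex_inner. a *\<^sub>C x)"
proof (rule bounded_linear_intro[where K = "cmod a"])
  show "norm (a *\<^sub>C x) \<le> norm x * cmod a" for x :: 'a
    by (simp only: norm_scaleC mult.commute order_refl)
  show "a *\<^sub>C (r *\<^sub>R x) = r *\<^sub>R (a *\<^sub>C x)" for r and x :: 'a
    by (simp only: scaleR_scaleC scaleC_scaleC mult.commute)
qed (rule scaleC_add_right)

lemma tendsto_cinner:
  fixes f g :: "'b \<Rightarrow> 'a :: complex_inner"
  assumes "(f \<longlongrightarrow> a) F"
  shows "((\<lambda>n. cinner c (f n)) \<longlongrightarrow> cinner c a) F" "((\<lambda>n. cinner (f n) c) \<longlongrightarrow> cinner a c) F"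
proof -
  show 1: "((\<lambda>n. cinner c (f n)) \<longlongrightarrow> cinner c a) F"
    by (rule bounded_linear.tendsto[OF bounded_linear_cinner_right assms])
  show "((\<lambda>n. cinner (f n) c) \<longlongrightarrow> cinner a c) F"
    using tendsto_cnj[OF 1] by (simp add: cinner_commute[symmetric])
qed

lemma csubspaceD:
  assumes "csubspace (S :: 'a :: complex_inner set)"
  shows "0 \<in> S" "x \<in> S \<Longrightarrow> y \<in> S \<Longrightarrow> x + y \<in> S" "x \<in> S \<Longrightarrow> y \<in> S \<Longrightarrow> x - y \<in> S"
    "x \<in> S \<Longrightarrow> a *\<^sub>C x \<in> S" "x \<in> S \<Longrightarrow> r *\<^sub>R x \<in> S" "x \<in> S \<Longrightarrow> - x \<in> S"
  unfolding scaleR_scaleC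
  using complex_vector.subspace_0[OF assms]
    complex_vector.subspace_add[OF assms]
    complex_vector.subspace_diff[OF assms]
    complex_vector.subspace_scale[OF assms]
    complex_vector.subspace_neg[OF assms]
  by blast+

lemma csubspaceI:
  assumes "0 \<in> S" "\<And>x y. x \<in> S \<Longrightarrow> y \<in> S \<Longrightarrow> x + y \<in> S" "\<And>a x. x \<in> S \<Longrightarrow> a *\<^sub>C x \<in> S"
  shows "csubspace (S :: 'a :: complex_inner set)"
  using assms by (simp add: complex_vector.subspace_def)

lemma csubspace_image:
  assumes D: "csubspace (D :: 'a :: complex_inner set)"
    and add: "\<And>x y. x \<in> D \<Longrightarrow> y \<in> D \<Longrightarrow> f (x + y) = f x + f y"
    and scale: "\<And>a x. x \<in> D \<Longrightarrow> f (a *\<^sub>C x) = a *\<^sub>C (f x :: 'a)"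
  shows "csubspace (f ` D)"
proof (rule csubspaceI)
  have "f 0 = 0" using scale[OF csubspaceD(1)[OF D], of 0] by simp
  then show "0 \<in> f ` D" using csubspaceD(1)[OF D] by (metis image_eqI)
  show "x + y \<in> f ` D" if xy: "x \<in> f ` D" "y \<in> f ` D" for x y
  proof -
    obtain u v where uv: "u \<in> D" "v \<in> D" "x = f u" "y = f v" using xy by blast
    then show ?thesis using csubspaceD(2)[OF D uv(1,2)] add by (metis image_eqI)
  qed
  show "a *\<^sub>C x \<in> f ` D" if x: "x \<in> f ` D" for a x
  proof -
    obtain u where u: "u \<in> D" "x = f u" using x by blast
    then show ?thesis using csubspaceD(4)[OF D u(1)] scale by (metis image_eqI)
  qed
qed

lemma csubspace_closure:
  assumes S: "csubspace (S :: 'a :: complex_inner set)"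
  shows "csubspace (closure S)"
proof (rule csubspaceI)
  show "0 \<in> closure S" using csubspaceD(1)[OF S] closure_subset by blast
  show "x + y \<in> closure S" if xy: "x \<in> closure S" "y \<in> closure S" for x y
  proof -
    obtain f g where fg: "\<forall>n. f n \<in> S" "f \<longlonglongrightarrow> x" "\<forall>n. g n \<in> S" "g \<longlonglongrightarrow> y"
      using xy unfolding closure_sequential by blast
    then show ?thesis unfolding closure_sequential
      using tendsto_add[OF fg(2,4)] csubspaceD(2)[OF S] by (intro exI[of _ "\<lambda>n. f n + g n"]) simp
  qed
  show "a *\<^sub>C x \<in> closure S" if x: "x \<in> closure S" for a x
  proof -
    obtain f where f: "\<forall>n. f n \<in> S" "f \<longlonglongrightarrow> x" using x unfolding closure_sequential by blast
    then show ?thesis unfolding closure_sequential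
      using bounded_linear.tendsto[OF bounded_linear_scaleC_right f(2)] csubspaceD(4)[OF S]
      by (intro exI[of _ "\<lambda>n. a *\<^sub>C f n"]) simp
  qed
qed

text \<open>The imaginary part of \<open>cinner f x\<close> is the real inner product of \<open>\<i> f\<close> with \<open>x\<close>, so real and complex
orthogonality to a complex subspace agree.\<close>

lemma cinner_eq_0_if_inner_eq_0:
  assumes "csubspace F" and "\<And>f. f \<in> F \<Longrightarrow> inner f x = 0" and "f \<in> F"
  shows "cinner f (x :: 'a :: complex_inner) = 0"
proof -
  have "Re (cinner f x) = 0" using assms by (simp add: inner_eq_Re_cinner[symmetric])
  moreover have "inner (\<i> *\<^sub>C f) x = 0" using assms(2) csubspaceD(4)[OF assms(1,3)] by simp
  then have "Im (cinner f x) = 0" by (simp add: inner_eq_Re_cinner cinner_scaleC_left)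
  ultimately show ?thesis by (simp add: complex_eq_iff)
qed

definition orthocomp :: "'a :: complex_inner set \<Rightarrow> 'a set" where
  "orthocomp F = {x. \<forall>f\<in>F. cinner f x = 0}"

lemma orthocompI: "(\<And>f. f \<in> F \<Longrightarrow> cinner f x = 0) \<Longrightarrow> x \<in> orthocomp F"
  by (simp add: orthocomp_def)

lemma orthocompD: "x \<in> orthocomp F \<Longrightarrow> f \<in> F \<Longrightarrow> cinner f x = 0" 
  "x \<in> orthocomp F \<Longrightarrow> f \<in> F \<Longrightarrow> cinner x f = 0"
  "x \<in> orthocomp F \<Longrightarrow> f \<in> F \<Longrightarrow> inner f x = 0" 
  "x \<in> orthocomp F \<Longrightarrow> f \<in> F \<Longrightarrow> inner x f = 0"
proof -
  assume *: "x \<in> orthocomp F" "f \<in> F"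
  then show a: "cinner f x = 0" by (simp add: orthocomp_def)
  then show b: "cinner x f = 0" by (metis cinner_commute complex_cnj_zero)
  show "inner f x = 0" "inner x f = 0" using a b by (simp_all add: inner_eq_Re_cinner)
qed

lemma closed_csubspace_orthocomp: "closed_csubspace (orthocomp F)"
proof -
  have "csubspace (orthocomp F)"
    by (rule csubspaceI) (auto simp: orthocomp_def cinner_simps)
  moreover have "closed (orthocomp F)"
    unfolding closed_sequential_limits orthocomp_def
    by (auto intro: LIMSEQ_unique[OF tendsto_cinner(1)])
  ultimately show ?thesis by (simp add: closed_csubspace_def)
qed

lemma csubspace_orthocomp: "csubspace (orthocomp F)"
  using closed_csubspace_orthocomp unfolding closed_csubspace_def by blast

lemma csubspace_cspan: "csubspace (cspan B)"
  by (rule complex_vector.subspace_span)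

lemma cspan_subset: "B \<subseteq> S \<Longrightarrow> csubspace S \<Longrightarrow> cspan B \<subseteq> S"
  by (rule complex_vector.span_minimal)

lemma cspan_superset: "B \<subseteq> cspan B"
  by (rule complex_vector.span_superset)

lemma orthocomp_cspan: "orthocomp (cspan B) = orthocomp B"
proof
  show "orthocomp (cspan B) \<subseteq> orthocomp B"
    using cspan_superset[of B] by (auto simp: orthocomp_def)
  show "orthocomp B \<subseteq> orthocomp (cspan B)"
  proof
    fix x assume x: "x \<in> orthocomp B"
    have "cspan B \<subseteq> orthocomp {x}"
    proof (rule cspan_subset)
      show "B \<subseteq> orthocomp {x}" using orthocompD(2)[OF x] by (auto intro!: orthocompI)
    qed (use closed_csubspace_orthocomp in \<open>auto simp: closed_csubspace_def\<close>)
    then show "x \<in> orthocomp (cspan B)"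
      by (intro orthocompI) (blast dest: orthocompD(2))
  qed
qed

section \<open>Orthogonal projections\<close>

lemma norm_diff_sq: "(norm (x - y))\<^sup>2 = (norm x)\<^sup>2 - 2 * inner x y + (norm (y :: 'a :: real_inner))\<^sup>2"
  by (simp add: power2_norm_eq_inner inner_diff_left inner_diff_right inner_commute)

lemma norm_add_sq: "(norm (x + y))\<^sup>2 = (norm x)\<^sup>2 + 2 * inner x y + (norm (y :: 'a :: real_inner))\<^sup>2"
  by (simp add: power2_norm_eq_inner inner_add_left inner_add_right inner_commute)

text \<open>The projection theorem: by the parallelogram law a sequence in \<open>U\<close> that minimises the distance to \<open>x\<close>
is Cauchy.  At its limit the distance is stationary in every direction of \<open>U\<close>.\<close>

lemma projection_exists:
  fixes U :: "'a :: chilbert_space set"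
  assumes "closed_csubspace U"
  shows "\<exists>p\<in>U. x - p \<in> orthocomp U"
proof -
  have sub: "csubspace U" and cl: "closed U" using assms by (auto simp: closed_csubspace_def)
  define S where "S = (\<lambda>u. (norm (x - u))\<^sup>2) ` U"
  define m where "m = Inf S"
  have ne: "S \<noteq> {}" using csubspaceD(1)[OF sub] by (auto simp: S_def)
  have bdd: "bdd_below S" by (auto simp: S_def intro!: bdd_belowI[of _ 0])
  have low: "m \<le> (norm (x - u))\<^sup>2" if "u \<in> U" for u
    unfolding m_def by (rule cInf_lower[OF _ bdd]) (use that in \<open>auto simp: S_def\<close>)
  have "\<exists>u\<in>U. (norm (x - u))\<^sup>2 < m + 1 / Suc n" for n :: nat
  proof -
    have "Inf S < m + 1 / Suc n" unfolding m_def by simp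
    then show ?thesis using cInf_lessD[OF ne] unfolding S_def by blast
  qed
  then obtain u where u: "\<And>n. u n \<in> U" "\<And>n :: nat. (norm (x - u n))\<^sup>2 < m + 1 / Suc n" by metis
  have par: "(norm (u i - u j))\<^sup>2 \<le> 2 / Suc i + 2 / Suc j" for i j
  proof -
    have mid: "(1/2) *\<^sub>R (u i + u j) \<in> U" by (intro csubspaceD(2,5)[OF sub] u(1))
    have e: "2 *\<^sub>R (x - (1/2) *\<^sub>R (u i + u j)) = (x - u i) + (x - u j)"
      by (simp add: scaleR_right_diff_distrib scaleR_2)
    have "(norm (u i - u j))\<^sup>2 + (norm (2 *\<^sub>R (x - (1/2) *\<^sub>R (u i + u j))))\<^sup>2
        = 2 * (norm (x - u i))\<^sup>2 + 2 * (norm (x - u j))\<^sup>2"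
    proof -
      have e2: "u i - u j = (x - u j) - (x - u i)" by simp
      show ?thesis unfolding e unfolding e2 norm_diff_sq[of "x - u j"] norm_add_sq
        by (simp add: inner_commute)
    qed
    moreover have "(norm (2 *\<^sub>R (x - (1/2) *\<^sub>R (u i + u j))))\<^sup>2 \<ge> 4 * m"
      using low[OF mid] by (simp add: power_mult_distrib)
    ultimately show ?thesis using u(2)[of i] u(2)[of j] by simp
  qed
  have "Cauchy u"
  proof (rule metric_CauchyI)
    fix e :: real assume "e > 0"
    then obtain N :: nat where N: "4 / e\<^sup>2 < N" using reals_Archimedean2 by blast
    have "dist (u i) (u j) < e" if ij: "i \<ge> N" "j \<ge> N" for i j
    proof -
      have "4 < e\<^sup>2 * N" using N \<open>e > 0\<close> by (simp add: pos_divide_less_eq mult.commute)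
      also have "\<dots> \<le> e\<^sup>2 * Suc N" by (intro mult_left_mono) auto
      finally have "4 < e\<^sup>2 * Suc N" .
      then have *: "4 / real (Suc N) < e\<^sup>2" by (subst pos_divide_less_eq) auto
      have "2 / real (Suc i) \<le> 2 / Suc N" "2 / real (Suc j) \<le> 2 / Suc N"
        using ij by (auto intro!: divide_left_mono)
      then have "(norm (u i - u j))\<^sup>2 < e\<^sup>2" using par[of i j] * by simp
      then show ?thesis using \<open>e > 0\<close> by (simp add: dist_norm power2_less_imp_less)
    qed
    then show "\<exists>N. \<forall>m\<ge>N. \<forall>n\<ge>N. dist (u m) (u n) < e" by blast
  qed
  then obtain p where p: "u \<longlonglongrightarrow> p" using Cauchy_convergent convergent_def by blast
  have pU: "p \<in> U" using closed_sequentially[OF cl _ p] u(1) by blast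
  have "(norm (x - p))\<^sup>2 \<le> m"
  proof (rule LIMSEQ_le)
    show "(\<lambda>n. (norm (x - u n))\<^sup>2) \<longlonglongrightarrow> (norm (x - p))\<^sup>2" by (intro tendsto_intros p)
    show "(\<lambda>n. m + 1 / Suc n) \<longlonglongrightarrow> m"
      using tendsto_add[OF tendsto_const[of m] LIMSEQ_inverse_real_of_nat] by (simp add: inverse_eq_divide)
    show "\<exists>N. \<forall>n\<ge>N. (norm (x - u n))\<^sup>2 \<le> m + 1 / real (Suc n)" using u(2) less_imp_le by blast
  qed
  then have min: "(norm (x - p))\<^sup>2 \<le> (norm (x - v))\<^sup>2" if "v \<in> U" for v
    by (rule order_trans[OF _ low[OF that]])
  have "inner f (x - p) = 0" if f: "f \<in> U" for f
  proof (cases "f = 0")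
    case False
    define c where "c = inner f (x - p)"
    define t where "t = c / (norm f)\<^sup>2"
    have "p + t *\<^sub>R f \<in> U" by (intro csubspaceD(2,5)[OF sub] pU f)
    from min[OF this] have "(norm (x - p))\<^sup>2 \<le> (norm ((x - p) - t *\<^sub>R f))\<^sup>2"
      by (simp add: algebra_simps)
    also have "\<dots> = (norm (x - p))\<^sup>2 - 2 * t * c + t\<^sup>2 * (norm f)\<^sup>2"
      unfolding norm_diff_sq by (simp add: c_def inner_commute power_mult_distrib)
    also have "\<dots> = (norm (x - p))\<^sup>2 - c\<^sup>2 / (norm f)\<^sup>2"
      using False by (simp add: t_def power2_eq_square field_simps)
    finally have "c\<^sup>2 / (norm f)\<^sup>2 \<le> 0" by simp
    then have "c\<^sup>2 \<le> 0" using False by (simp add: divide_le_0_iff)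
    then show ?thesis by (simp add: c_def)
  qed simp
  then have "x - p \<in> orthocomp U"
    by (intro orthocompI cinner_eq_0_if_inner_eq_0[OF sub])
  with pU show ?thesis by blast
qed

lemma orth_proj_props:
  fixes U :: "'a :: chilbert_space set"
  assumes "closed_csubspace U"
  shows orth_proj_in: "orth_proj U x \<in> U"
    and orth_proj_orth: "x - orth_proj U x \<in> orthocomp U"
    and orth_proj_unique: "\<And>p. p \<in> U \<Longrightarrow> x - p \<in> orthocomp U \<Longrightarrow> orth_proj U x = p"
proof -
  have sub: "csubspace U" using assms by (auto simp: closed_csubspace_def)
  have uniq: "p = q" if "p \<in> U" "x - p \<in> orthocomp U" "q \<in> U" "x - q \<in> orthocomp U" for p q
  proof -
    have pq: "p - q \<in> U" using that by (intro csubspaceD(3)[OF sub])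
    have "cinner (p - q) (p - q) = cinner (p - q) (x - q) - cinner (p - q) (x - p)"
      by (simp add: cinner_diff_right)
    also have "\<dots> = 0" using that pq by (simp add: orthocompD(1))
    finally show ?thesis by (simp add: cinner_self_eq_0)
  qed
  have "\<exists>!p. p \<in> U \<and> x - p \<in> orthocomp U" using projection_exists[OF assms, of x] uniq by blast
  from theI'[OF this] show 1: "orth_proj U x \<in> U" "x - orth_proj U x \<in> orthocomp U"
    by (auto simp: orth_proj_def orthocomp_def)
  show "orth_proj U x = p" if "p \<in> U" "x - p \<in> orthocomp U" for p
    using uniq 1 that by blast
qed

context
  fixes U :: "'a :: chilbert_space set"
  assumes U: "closed_csubspace U"
begin

private lemma sub: "csubspace U" using U by (auto simp: closed_csubspace_def)

lemma orth_proj_fixed: "x \<in> U \<Longrightarrow> orth_proj U x = x"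
  by (rule orth_proj_unique[OF U]) (auto simp: orthocomp_def)

lemma orth_proj_add: "orth_proj U (x + y) = orth_proj U x + orth_proj U y"
proof (rule orth_proj_unique[OF U])
  show "orth_proj U x + orth_proj U y \<in> U"
    by (intro csubspaceD(2)[OF sub] orth_proj_in[OF U])
  have "(x - orth_proj U x) + (y - orth_proj U y) \<in> orthocomp U"
    by (intro csubspaceD(2)[OF csubspace_orthocomp] orth_proj_orth[OF U])
  then show "x + y - (orth_proj U x + orth_proj U y) \<in> orthocomp U" by (simp add: algebra_simps)
qed

lemma orth_proj_scaleC: "orth_proj U (a *\<^sub>C x) = a *\<^sub>C orth_proj U x"
proof (rule orth_proj_unique[OF U])
  show "a *\<^sub>C orth_proj U x \<in> U"
    by (intro csubspaceD(4)[OF sub] orth_proj_in[OF U])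
  have "a *\<^sub>C (x - orth_proj U x) \<in> orthocomp U"
    by (intro csubspaceD(4)[OF csubspace_orthocomp] orth_proj_orth[OF U])
  then show "a *\<^sub>C x - a *\<^sub>C orth_proj U x \<in> orthocomp U"
    by (simp add: complex_vector.scale_right_diff_distrib)
qed

lemma orth_proj_scaleR: "orth_proj U (r *\<^sub>R x) = r *\<^sub>R orth_proj U x"
  by (simp add: scaleR_scaleC orth_proj_scaleC)

lemma orth_proj_diff: "orth_proj U (x - y) = orth_proj U x - orth_proj U y"
  using orth_proj_add[of x "(-1) *\<^sub>R y"] orth_proj_scaleR[of "-1" y] by simp

lemma orth_proj_decomp: 
  "inner (orth_proj U x) (y - orth_proj U y) = 0" "inner (x - orth_proj U x) (orth_proj U y) = 0"
  "cinner (orth_proj U x) (y - orth_proj U y) = 0" "cinner (x - orth_proj U x) (orth_proj U y) = 0"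
  using orthocompD[OF orth_proj_orth[OF U] orth_proj_in[OF U]] by auto

lemma orth_proj_cinner: "cinner (orth_proj U x) y = cinner x (orth_proj U y)"
  using orth_proj_decomp(3)[of x y] orth_proj_decomp(4)[of x y] by (simp add: cinner_simps)

lemma orth_proj_pythagoras: "(norm x)\<^sup>2 = (norm (orth_proj U x))\<^sup>2 + (norm (x - orth_proj U x))\<^sup>2"
  using norm_add_sq[of "orth_proj U x" "x - orth_proj U x"] orth_proj_decomp(1)[of x x] by simp

lemma norm_orth_proj_le: "norm (orth_proj U x) \<le> norm x"
  by (rule power2_le_imp_le) (simp_all add: orth_proj_pythagoras[of x])

lemma bounded_linear_orth_proj: "bounded_linear (orth_proj U)"
  by (rule bounded_linear_intro[where K = 1])
     (simp_all add: orth_proj_add orth_proj_scaleR norm_orth_proj_le)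

lemma orthocomp_orthocomp: "orthocomp (orthocomp U) = U"
proof
  show "U \<subseteq> orthocomp (orthocomp U)" by (auto intro!: orthocompI dest: orthocompD(2))
  show "orthocomp (orthocomp U) \<subseteq> U"
  proof
    fix x assume x: "x \<in> orthocomp (orthocomp U)"
    have "cinner (x - orth_proj U x) (x - orth_proj U x) = 0"
      using orthocompD(1)[OF x orth_proj_orth[OF U]] orth_proj_decomp(4)[of x x] 
      by (simp add: cinner_diff_right)
    then show "x \<in> U" using orth_proj_in[OF U, of x] by (simp add: cinner_self_eq_0)
  qed
qed

end

section \<open>Finite-dimensional subspaces\<close>

definition orthonormal :: "'a :: complex_inner set \<Rightarrow> bool" where
  "orthonormal B \<longleftrightarrow> (\<forall>b\<in>B. \<forall>c\<in>B. cinner b c = (if b = c then 1 else 0))"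

text \<open>The Fourier sum over a finite orthonormal set projects onto its span.  A limit of points of the span
is therefore equal to its own projection, which makes the span closed.\<close>

lemma closed_cspan_orthonormal:
  fixes B :: "'a :: chilbert_space set"
  assumes fin: "finite B" and on: "orthonormal B"
  defines "p \<equiv> \<lambda>x. \<Sum>b\<in>B. cinner b x *\<^sub>C b"
  shows "p x \<in> cspan B" "x - p x \<in> orthocomp (cspan B)" "closed (cspan B)"
proof -
  show 1: "p x \<in> cspan B" for x
    unfolding p_def by (intro complex_vector.span_sum complex_vector.span_scale complex_vector.span_base)
  show 2: "x - p x \<in> orthocomp (cspan B)" for x
    unfolding orthocomp_cspan
  proof (rule orthocompI)
    fix c assume c: "c \<in> B"
    have "cinner c (p x) = (\<Sum>b\<in>B. cinner b x * (if c = b then 1 else 0))"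
      unfolding p_def cinner_sum_right cinner_scaleC_right
      using on c by (intro sum.cong) (auto simp: orthonormal_def)
    also have "\<dots> = cinner c x" using fin c by (simp add: sum.delta if_distrib cong: if_cong)
    finally show "cinner c (x - p x) = 0" by (simp add: cinner_diff_right)
  qed
  show "closed (cspan B)"
    unfolding closed_sequential_limits
  proof (intro allI impI, elim conjE)
    fix f l assume f: "\<forall>n. f n \<in> cspan B" and l: "f \<longlonglongrightarrow> l"
    define v where "v = l - p l"
    have "cinner v (f n) = 0" for n using orthocompD(2)[OF 2] f unfolding v_def by blast
    then have "cinner v l = 0" using tendsto_cinner(1)[OF l, of v] by (simp add: LIMSEQ_const_iff)
    moreover have "cinner v (p l) = 0" unfolding v_def using orthocompD(2)[OF 2 1] by blast
    ultimately have "cinner v v = 0" by (simp add: v_def cinner_diff_right)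
    then have "l = p l" by (simp add: cinner_self_eq_0 v_def)
    then show "l \<in> cspan B" using 1[of l] by simp
  qed
qed

lemma cspan_insert_eq:
  assumes "csubspace S" "b \<in> S" "B \<subseteq> S" shows "cspan (insert b B) \<subseteq> S"
  using assms by (intro cspan_subset) auto

text \<open>Gram--Schmidt orthonormalisation.\<close>

lemma orthonormal_basis_exists:
  fixes B :: "'a :: chilbert_space set"
  assumes "finite B"
  shows "\<exists>C. finite C \<and> orthonormal C \<and> cspan C = cspan B"
  using assms
proof (induction B)
  case empty
  show ?case by (intro exI[of _ "{}"]) (simp add: orthonormal_def)
next
  case (insert b B)
  then obtain C where C: "finite C" "orthonormal C" "cspan C = cspan B" by blast
  define p where "p = (\<Sum>c\<in>C. cinner c b *\<^sub>C c)"
  define v where "v = b - p"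
  have p: "p \<in> cspan C" and v: "v \<in> orthocomp (cspan C)"
    unfolding v_def p_def using closed_cspan_orthonormal[OF C(1,2)] by blast+
  have bv: "b = p + v" by (simp add: v_def)
  show ?case
  proof (cases "v = 0")
    case True
    then have "b \<in> cspan B" using p C(3) bv by simp
    then have "cspan (insert b B) = cspan B" by (rule complex_vector.span_redundant)
    then show ?thesis using C by auto
  next
    case False
    define e where "e = complex_of_real (1 / norm v) *\<^sub>C v"
    have e1: "cinner e e = 1"
    proof -
      have "norm e = 1" using False unfolding e_def norm_scaleC norm_of_real by simp
      then show ?thesis by (simp add: cinner_self)
    qed
    have eC: "cinner c e = 0" "cinner e c = 0" if "c \<in> C" for c
      using orthocompD(1,2)[OF v] that complex_vector.span_base[of c C] by (simp_all add: e_def cinner_simps)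
    have ve: "v = complex_of_real (norm v) *\<^sub>C e"
      using False by (simp add: e_def scaleC_scaleC scaleC_one)
    have "orthonormal (insert e C)"
      unfolding orthonormal_def
    proof (intro ballI)
      fix x y assume "x \<in> insert e C" "y \<in> insert e C"
      moreover have "e \<notin> C" using e1 eC(1)[of e] by auto
      ultimately show "cinner x y = (if x = y then 1 else 0)"
        using e1 eC C(2) by (auto simp: orthonormal_def)
    qed
    moreover have "cspan (insert e C) = cspan (insert b B)"
    proof
      have BB: "cspan B \<subseteq> cspan (insert b B)" by (rule complex_vector.span_mono) auto
      have CC: "cspan C \<subseteq> cspan (insert e C)" by (rule complex_vector.span_mono) auto
      have "v \<in> cspan (insert b B)" unfolding v_def
        using BB p C(3) complex_vector.span_base[of b "insert b B"]
        by (intro complex_vector.span_diff) auto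
      then have "e \<in> cspan (insert b B)" unfolding e_def by (rule complex_vector.span_scale)
      moreover have "C \<subseteq> cspan (insert b B)" using BB C(3) cspan_superset[of C] by auto
      ultimately show "cspan (insert e C) \<subseteq> cspan (insert b B)"
        by (intro cspan_insert_eq csubspace_cspan)
      have "v \<in> cspan (insert e C)"
        by (subst ve) (intro complex_vector.span_scale complex_vector.span_base insertI1)
      then have "b \<in> cspan (insert e C)" unfolding bv using p CC by (intro complex_vector.span_add) auto
      moreover have "B \<subseteq> cspan (insert e C)" using CC C(3) cspan_superset[of B] by auto
      ultimately show "cspan (insert b B) \<subseteq> cspan (insert e C)"
        by (intro cspan_insert_eq csubspace_cspan)
    qed
    ultimately show ?thesis using C(1) by blast
  qed
qed

lemma closed_csubspace_cspan_finite:
  fixes B :: "'a :: chilbert_space set"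
  assumes "finite B"
  shows "closed_csubspace (cspan B)"
proof -
  obtain C where "finite C" "orthonormal C" "cspan C = cspan B"
    using orthonormal_basis_exists[OF assms] by blast
  then show ?thesis using closed_cspan_orthonormal(3) csubspace_cspan
    unfolding closed_csubspace_def by metis
qed

lemma cfinite_dim_subset: "cfinite_dim F \<Longrightarrow> E \<subseteq> F \<Longrightarrow> cfinite_dim E"
  unfolding cfinite_dim_def by blast

lemma cfinite_dim_basis:
  assumes "csubspace E" "cfinite_dim E"
  obtains B where "finite B" "B \<subseteq> E" "\<not> complex_vector.dependent B" "cspan B = E" "card B = cdim E"
proof -
  obtain B0 where B0: "finite B0" "E \<subseteq> cspan B0" using assms(2) by (auto simp: cfinite_dim_def)
  obtain B where B: "B \<subseteq> E" "\<not> complex_vector.dependent B" "E \<subseteq> cspan B" "card B = cdim E"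
    using complex_vector.basis_exists[of E] by blast
  have "finite B" 
    using complex_vector.independent_span_bound[OF B0(1) B(2)] B(1) B0(2) by blast
  moreover have "cspan B = E" using B(1,3) cspan_subset[OF B(1) assms(1)] by blast
  ultimately show ?thesis using that B by blast
qed

lemma closed_csubspace_cfinite_dim:
  assumes "csubspace (E :: 'a :: chilbert_space set)" "cfinite_dim E"
  shows "closed_csubspace E"
  by (rule cfinite_dim_basis[OF assms]) (metis closed_csubspace_cspan_finite)

lemma cdim_mono:
  assumes "E \<subseteq> F" "cfinite_dim F"
  shows "cdim E \<le> cdim F"
proof -
  obtain B0 where B0: "finite B0" "F \<subseteq> cspan B0" using assms(2) by (auto simp: cfinite_dim_def)
  obtain B where B: "B \<subseteq> F" "\<not> complex_vector.dependent B" "F \<subseteq> cspan B" "card B = cdim F"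
    using complex_vector.basis_exists[of F] by blast
  have "finite B" 
    using complex_vector.independent_span_bound[OF B0(1) B(2)] B(1) B0(2) by blast
  then show ?thesis using complex_vector.dim_le_card[of E B] B assms(1) by auto
qed

text \<open>The dimension count behind the min-max principle: the orthogonal projection onto \<open>F\<close> is injective on
\<open>X\<close>, because its kernel is \<open>F\<^sup>\<bottom>\<close>.\<close>

lemma cdim_le_if_disjoint_orthocomp:
  fixes X F :: "'a :: chilbert_space set"
  assumes X: "csubspace X" and F: "csubspace F" "cfinite_dim F"
    and disj: "\<And>x. x \<in> X \<Longrightarrow> x \<in> orthocomp F \<Longrightarrow> x = 0"
  shows "cfinite_dim X" "cdim X \<le> cdim F"
proof -
  interpret pr: vector_space_pair "scaleC :: complex \<Rightarrow> 'a \<Rightarrow> 'a" "scaleC :: complex \<Rightarrow> 'a \<Rightarrow> 'a"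
    by unfold_locales
  have clF: "closed_csubspace F" by (rule closed_csubspace_cfinite_dim[OF F])
  obtain C where C: "finite C" "C \<subseteq> F" "cspan C = F" "card C = cdim F"
    using cfinite_dim_basis[OF F] by metis
  obtain B where B: "B \<subseteq> X" "\<not> complex_vector.dependent B" "X \<subseteq> cspan B" "card B = cdim X"
    using complex_vector.basis_exists[of X] by blast
  have spB: "cspan B = X" using B(1,3) cspan_subset[OF B(1) X] by blast
  have lin: "Vector_Spaces.linear scaleC scaleC (orth_proj F)"
    unfolding Vector_Spaces.linear_iff
    by (simp add: orth_proj_add[OF clF] orth_proj_scaleC[OF clF] pr.vector_space_pair_axioms
       complex_vector.vector_space_axioms)
  have inj: "inj_on (orth_proj F) (cspan B)"
    unfolding spB
  proof (rule inj_onI)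
    fix x y assume xy: "x \<in> X" "y \<in> X" "orth_proj F x = orth_proj F y"
    then have "orth_proj F (x - y) = 0" by (simp add: orth_proj_diff[OF clF])
    then have "x - y \<in> orthocomp F" using orth_proj_orth[OF clF, of "x - y"] by simp
    then have "x - y = 0" using disj csubspaceD(3)[OF X xy(1,2)] by blast
    then show "x = y" by simp
  qed
  have "\<not> complex_vector.dependent (orth_proj F ` B)"
    by (rule pr.linear_independent_injective_image[OF lin B(2) inj[unfolded cspan_def]])
  moreover have "orth_proj F ` B \<subseteq> cspan C" using C(3) orth_proj_in[OF clF] by auto
  ultimately have fc: "finite (orth_proj F ` B)" "card (orth_proj F ` B) \<le> card C"
    using complex_vector.independent_span_bound[OF C(1)] by auto
  have injB: "inj_on (orth_proj F) B" by (rule inj_on_subset[OF inj cspan_superset])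
  then have "finite B" using fc(1) finite_imageD by blast
  then show "cfinite_dim X" using B(3) by (auto simp: cfinite_dim_def)
  show "cdim X \<le> cdim F" using fc(2) card_image[OF injB] B(4) C(4) by simp
qed

lemma cfinite_dim_image_orth_proj:
  fixes F K :: "'a :: chilbert_space set"
  assumes K: "closed_csubspace K" and F: "csubspace F" "cfinite_dim F"
  shows "csubspace (orth_proj K ` F)" "cfinite_dim (orth_proj K ` F)"
proof -
  obtain C where C: "finite C" "C \<subseteq> F" "cspan C = F" using cfinite_dim_basis[OF F] by metis
  interpret pr: vector_space_pair "scaleC :: complex \<Rightarrow> 'a \<Rightarrow> 'a" "scaleC :: complex \<Rightarrow> 'a \<Rightarrow> 'a"
    by unfold_locales
  have lin: "Vector_Spaces.linear scaleC scaleC (orth_proj K)"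
    unfolding Vector_Spaces.linear_iff
    by (simp add: orth_proj_add[OF K] orth_proj_scaleC[OF K] pr.vector_space_pair_axioms
       complex_vector.vector_space_axioms)
  have "orth_proj K ` F = cspan (orth_proj K ` C)"
    using pr.linear_span_image[OF lin, of C, folded cspan_def] C(3) by simp
  then show "csubspace (orth_proj K ` F)" "cfinite_dim (orth_proj K ` F)"
    using C(1) csubspace_cspan unfolding cfinite_dim_def by (auto intro!: exI[of _ "orth_proj K ` C"])
qed

text \<open>Compactness of finite-rank projections, by choosing subsequences along which the coordinates in an
orthonormal basis converge, one after the other.\<close>

lemma bounded_sequence_projection_convergent:
  fixes F :: "'a :: chilbert_space set" and u :: "nat \<Rightarrow> 'a"
  assumes F: "csubspace F" "cfinite_dim F" and u: "\<And>n. norm (u n) \<le> C"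
  shows "\<exists>r. strict_mono r \<and> convergent (\<lambda>n. orth_proj F (u (r n)))"
proof -
  obtain B0 where "finite B0" "cspan B0 = F" using cfinite_dim_basis[OF F] by metis
  then obtain B where B: "finite B" "orthonormal B" "cspan B = F"
    using orthonormal_basis_exists by metis
  have "\<exists>r :: nat \<Rightarrow> nat. strict_mono r \<and> (\<forall>b\<in>A. convergent (\<lambda>n. cinner b (u (r n))))"
    if "finite A" for A
    using that
  proof (induction A)
    case empty
    show ?case by (intro exI[of _ id]) (simp add: strict_mono_def)
  next
    case (insert b A)
    then obtain r where r: "strict_mono r" "\<forall>b\<in>A. convergent (\<lambda>n. cinner b (u (r n)))" by blast
    have "norm (cinner b (u (r n))) \<le> norm b * C" for n
      using norm_cinner_le[of b "u (r n)"] mult_left_mono[OF u, of "norm b" "r n"] by simp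
    then have "bounded (range (\<lambda>n. cinner b (u (r n))))" by (auto simp: bounded_iff)
    then obtain l s where s: "strict_mono s" "((\<lambda>n. cinner b (u (r n))) \<circ> s) \<longlonglongrightarrow> l"
      using bounded_imp_convergent_subsequence by blast
    show ?case
    proof (intro exI[of _ "r \<circ> s"] conjI ballI)
      show "strict_mono (r \<circ> s)" using r(1) s(1) by (rule strict_mono_o)
      fix c assume "c \<in> insert b A"
      then show "convergent (\<lambda>n. cinner c (u ((r \<circ> s) n)))"
      proof
        assume "c = b" then show ?thesis using s(2) by (auto simp: convergent_def o_def)
      next
        assume "c \<in> A"
        then have "convergent ((\<lambda>n. cinner c (u (r n))) \<circ> s)"
          using r(2) s(1) convergent_subseq_convergent by blast
        then show ?thesis by (simp add: o_def)
      qed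
    qed
  qed
  from this[OF B(1)] obtain r where r: "strict_mono r" "\<forall>b\<in>B. convergent (\<lambda>n. cinner b (u (r n)))"
    by blast
  have clF: "closed_csubspace F" by (rule closed_csubspace_cfinite_dim[OF F])
  have pr: "orth_proj F x = (\<Sum>b\<in>B. cinner b x *\<^sub>C b)" for x
    using closed_cspan_orthonormal(1,2)[OF B(1,2), of x] B(3) by (intro orth_proj_unique[OF clF]) auto
  have "convergent (\<lambda>n. cinner b (u (r n)) *\<^sub>C b)" if bB: "b \<in> B" for b
  proof -
    obtain l where l: "(\<lambda>n. cinner b (u (r n))) \<longlonglongrightarrow> l" using r(2) bB by (auto simp: convergent_def)
    have "bounded_linear (\<lambda>a. a *\<^sub>C b)"
      by (rule bounded_linear_intro[where K = "norm b"])
         (simp_all add: scaleC_add_left scaleR_scaleC scaleC_scaleC norm_scaleC scaleC_complex_def)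
    from bounded_linear.tendsto[OF this l] show ?thesis by (auto simp: convergent_def)
  qed
  then have "\<exists>l. \<forall>b\<in>B. (\<lambda>n. cinner b (u (r n)) *\<^sub>C b) \<longlonglongrightarrow> l b"
    unfolding convergent_def by metis
  then obtain l where "\<And>b. b \<in> B \<Longrightarrow> (\<lambda>n. cinner b (u (r n)) *\<^sub>C b) \<longlonglongrightarrow> l b" by blast
  then have "(\<lambda>n. orth_proj F (u (r n))) \<longlonglongrightarrow> (\<Sum>b\<in>B. l b)"
    unfolding pr by (rule tendsto_sum)
  with r(1) show ?thesis by (auto simp: convergent_def)
qed

lemma independent_Un:
  assumes A: "\<not> complex_vector.dependent A" and B: "\<not> complex_vector.dependent (B :: 'a :: complex_inner set)"
    and disj: "\<And>x. x \<in> cspan A \<Longrightarrow> x \<in> cspan B \<Longrightarrow> x = 0"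
  shows "\<not> complex_vector.dependent (A \<union> B)"
proof
  have *: False if A: "\<not> complex_vector.dependent A" 
    and disj: "\<And>x. x \<in> cspan A \<Longrightarrow> x \<in> cspan B \<Longrightarrow> x = 0"
    and a: "a \<in> A" "a \<in> cspan (A \<union> B - {a})" for a and A B :: "'a set"
  proof -
    have "a \<in> cspan ((A - {a}) \<union> B)"
      using a(2) complex_vector.span_mono[of "A \<union> B - {a}" "(A - {a}) \<union> B"] by blast
    then obtain u v where uv: "u \<in> cspan (A - {a})" "v \<in> cspan B" "a = u + v"
      unfolding complex_vector.span_Un by auto
    have uA: "u \<in> cspan A" using uv(1) complex_vector.span_mono[of "A - {a}" A] by blast
    have "v = a - u" using uv(3) by simp
    then have "v \<in> cspan A" using uA complex_vector.span_base[OF a(1)] complex_vector.span_diff by blast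
    then have "v = 0" using disj uv(2) by blast
    then have "a \<in> cspan (A - {a})" using uv by simp
    then show False using A a(1) unfolding complex_vector.dependent_def by blast
  qed
  assume "complex_vector.dependent (A \<union> B)"
  then obtain a where "a \<in> A \<union> B" "a \<in> cspan (A \<union> B - {a})"
    unfolding complex_vector.dependent_def by blast
  then consider "a \<in> A" "a \<in> cspan (A \<union> B - {a})" | "a \<in> B" "a \<in> cspan (B \<union> A - {a})"
    by (auto simp: Un_commute)
  then show False
  proof cases
    case 1 show False by (rule *[OF A disj 1])
  next
    case 2 show False by (rule *[OF B disj 2])
  qed
qed

section \<open>The quadratic form of a symmetric operator\<close>

text \<open>If \<open>\<alpha>\<close> is the supremum of the form of \<open>B\<close> on the unit sphere, then \<open>T = \<alpha> - B\<close> has a nonnegative form,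
whence \<open>|T u|\<^sup>2 \<le> D \<langle>T u, u\<rangle>\<close> for a constant \<open>D\<close>, and the right-hand side comes arbitrarily close
to \<open>0\<close> on unit vectors.  So \<open>B - \<alpha>\<close> is not bounded below, which excludes \<open>\<alpha> \<ge> s\<close>.\<close>

lemma form_bound_if_bounded_below:
  fixes G :: "'a :: real_inner set" and B :: "'a \<Rightarrow> 'a"
  assumes G: "0 \<in> G" "\<And>x y. x \<in> G \<Longrightarrow> y \<in> G \<Longrightarrow> x + y \<in> G" "\<And>r x. x \<in> G \<Longrightarrow> r *\<^sub>R x \<in> G"
    and B: "\<And>x. x \<in> G \<Longrightarrow> B x \<in> G" "\<And>x y. x \<in> G \<Longrightarrow> y \<in> G \<Longrightarrow> B (x + y) = B x + B y"
      "\<And>r x. x \<in> G \<Longrightarrow> B (r *\<^sub>R x) = r *\<^sub>R B x" "\<And>x. x \<in> G \<Longrightarrow> norm (B x) \<le> C * norm x"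
    and sym: "\<And>x y. x \<in> G \<Longrightarrow> y \<in> G \<Longrightarrow> inner (B x) y = inner x (B y)"
    and bb: "\<And>\<alpha>. \<alpha> \<ge> s \<Longrightarrow> \<exists>c>0. \<forall>u\<in>G. c * norm u \<le> norm (B u - \<alpha> *\<^sub>R u)"
  shows "\<exists>s'<s. \<forall>x\<in>G. inner (B x) x \<le> s' * (norm x)\<^sup>2"
proof (cases "\<exists>x\<in>G. x \<noteq> 0")
  case False
  then show ?thesis by (intro exI[of _ "s - 1"]) auto
next
  case True
  then obtain x0 where x0: "x0 \<in> G" "x0 \<noteq> 0" by blast
  define S where "S = (\<lambda>u. inner (B u) u) ` {u \<in> G. norm u = 1}"
  have ne: "S \<noteq> {}" using x0 G(3)[OF x0(1), of "1 / norm x0"] by (force simp: S_def)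
  have "inner (B u) u \<le> C" if "u \<in> G" "norm u = 1" for u
    using norm_cauchy_schwarz[of "B u" u] B(4)[OF that(1)] that(2) by simp
  then have bdd: "bdd_above S" by (auto simp: S_def intro!: bdd_aboveI[of _ C])
  define \<alpha> where "\<alpha> = Sup S"
  have up: "inner (B x) x \<le> \<alpha> * (norm x)\<^sup>2" if x: "x \<in> G" for x
  proof (cases "x = 0")
    case False
    define u where "u = (1 / norm x) *\<^sub>R x"
    have u: "u \<in> G" "norm u = 1" "x = norm x *\<^sub>R u" using False x G(3) by (auto simp: u_def)
    have "inner (B x) x = (norm x)\<^sup>2 * inner (B u) u"
      by (subst (1 2) u(3)) (simp add: B(3)[OF u(1)] power2_eq_square)
    also have "inner (B u) u \<le> \<alpha>"
      unfolding \<alpha>_def by (rule cSup_upper[OF _ bdd]) (use u in \<open>auto simp: S_def\<close>)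
    finally show ?thesis by (metis mult.commute mult_left_mono zero_le_power2)
  next
    case True
    have "B (0 *\<^sub>R 0) = 0 *\<^sub>R B 0" by (rule B(3)[OF G(1)])
    then show ?thesis using True by simp
  qed
  have "\<alpha> < s"
  proof (rule ccontr)
    assume "\<not> \<alpha> < s"
    then obtain c where c: "c > 0" "\<And>u. u \<in> G \<Longrightarrow> c * norm u \<le> norm (B u - \<alpha> *\<^sub>R u)"
      using bb[of \<alpha>] by auto
    define D where "D = \<bar>\<alpha>\<bar> + \<bar>C\<bar> + 1"
    have D: "D > 0" by (simp add: D_def)
    define T where "T = (\<lambda>u. \<alpha> *\<^sub>R u - B u)"
    have TG: "T u \<in> G" if "u \<in> G" for u
      using G(2)[OF G(3)[OF that, of \<alpha>] G(3)[OF B(1)[OF that], of "-1"]] by (simp add: T_def)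
    have Tpos: "inner (T u) u \<ge> 0" if "u \<in> G" for u
      using up[OF that] by (simp add: T_def inner_diff_left power2_norm_eq_inner)
    have Tsym: "inner (T u) v = inner u (T v)" if "u \<in> G" "v \<in> G" for u v
      using sym[OF that] by (simp add: T_def inner_diff_left inner_diff_right)
    have Tb: "norm (T u) \<le> D * norm u" if "u \<in> G" for u
    proof -
      have "norm (T u) \<le> norm (\<alpha> *\<^sub>R u) + norm (B u)" unfolding T_def by (rule norm_triangle_ineq4)
      also have "\<dots> \<le> \<bar>\<alpha>\<bar> * norm u + \<bar>C\<bar> * norm u"
        using order_trans[OF B(4)[OF that] mult_right_mono[OF abs_ge_self norm_ge_zero]] by simp
      also have "\<dots> \<le> D * norm u" by (simp add: D_def algebra_simps)
      finally show ?thesis .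
    qed
    have Tsub: "T (u - t *\<^sub>R v) = T u - t *\<^sub>R T v" if "u \<in> G" "v \<in> G" for u v t
    proof -
      have "B (u + (- t) *\<^sub>R v) = B u + (- t) *\<^sub>R B v"
        unfolding B(2)[OF that(1) G(3)[OF that(2)]] B(3)[OF that(2)] ..
      then show ?thesis by (simp add: T_def algebra_simps)
    qed
    \<comment> \<open>nonnegativity of the form at \<open>u - T u / D\<close> gives \<open>|T u|\<^sup>2 \<le> D \<langle>T u, u\<rangle>\<close>\<close>
    have key: "(norm (T u))\<^sup>2 \<le> D * inner (T u) u" if u: "u \<in> G" for u
    proof -
      define t where "t = 1 / D"
      have Tu: "T u \<in> G" by (rule TG[OF u])
      have "u - t *\<^sub>R T u \<in> G" using G(2)[OF u G(3)[OF Tu, of "- t"]] by simp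
      from Tpos[OF this] have "0 \<le> inner (T u) u - 2 * t * (norm (T u))\<^sup>2 + t\<^sup>2 * inner (T (T u)) (T u)"
      proof -
        assume "0 \<le> inner (T (u - t *\<^sub>R T u)) (u - t *\<^sub>R T u)"
        also have "\<dots> = inner (T u) u - t * inner (T u) (T u) - t * inner (T (T u)) u
            + t * t * inner (T (T u)) (T u)"
          unfolding Tsub[OF u Tu] by (simp add: inner_diff_left inner_diff_right algebra_simps)
        finally show ?thesis unfolding Tsym[OF Tu u] power2_norm_eq_inner
          by (simp add: power2_eq_square)
      qed
      moreover have "inner (T (T u)) (T u) \<le> D * (norm (T u))\<^sup>2"
        using norm_cauchy_schwarz[of "T (T u)" "T u"] mult_right_mono[OF Tb[OF Tu], of "norm (T u)"]
        by (simp add: power2_eq_square mult.assoc)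
      then have "t\<^sup>2 * inner (T (T u)) (T u) \<le> t\<^sup>2 * (D * (norm (T u))\<^sup>2)"
        by (intro mult_left_mono) auto
      moreover have "t\<^sup>2 * (D * (norm (T u))\<^sup>2) = t * (norm (T u))\<^sup>2"
        using D by (simp add: t_def power2_eq_square)
      ultimately have "t * (norm (T u))\<^sup>2 \<le> inner (T u) u" by simp
      then show ?thesis using D by (simp add: t_def field_simps)
    qed
    have "\<alpha> - c\<^sup>2 / (2 * D) < Sup S" using c(1) D by (simp add: \<alpha>_def)
    then obtain u where u: "u \<in> G" "norm u = 1" "\<alpha> - c\<^sup>2 / (2 * D) < inner (B u) u"
      using less_cSupD[OF ne] unfolding S_def by blast
    have "inner (T u) u < c\<^sup>2 / (2 * D)" using u by (simp add: T_def inner_diff_left power2_norm_eq_inner[symmetric])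
    then have "D * inner (T u) u < c\<^sup>2 / 2" using D by (simp add: field_simps)
    then have "(norm (T u))\<^sup>2 < c\<^sup>2" using key[OF u(1)] zero_less_power[OF c(1), of 2] by linarith
    moreover have "c \<le> norm (T u)" using c(2)[OF u(1)] u(2) by (simp add: T_def norm_minus_commute)
    ultimately show False using c(1) by (smt (verit) power_mono)
  qed
  with up show ?thesis by blast
qed

text \<open>The same with a strict inequality in the hypothesis, by letting the threshold decrease to \<open>s\<close>.\<close>

lemma form_bound_if_bounded_below_weak:
  fixes G :: "'a :: real_inner set" and B :: "'a \<Rightarrow> 'a"
  assumes "0 \<in> G" "\<And>x y. x \<in> G \<Longrightarrow> y \<in> G \<Longrightarrow> x + y \<in> G" "\<And>r x. x \<in> G \<Longrightarrow> r *\<^sub>R x \<in> G"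
    and "\<And>x. x \<in> G \<Longrightarrow> B x \<in> G" "\<And>x y. x \<in> G \<Longrightarrow> y \<in> G \<Longrightarrow> B (x + y) = B x + B y"
      "\<And>r x. x \<in> G \<Longrightarrow> B (r *\<^sub>R x) = r *\<^sub>R B x" "\<And>x. x \<in> G \<Longrightarrow> norm (B x) \<le> C * norm x"
    and "\<And>x y. x \<in> G \<Longrightarrow> y \<in> G \<Longrightarrow> inner (B x) y = inner x (B y)"
    and bb: "\<And>\<alpha>. \<alpha> > s \<Longrightarrow> \<exists>c>0. \<forall>u\<in>G. c * norm u \<le> norm (B u - \<alpha> *\<^sub>R u)"
    and x: "x \<in> G"
  shows "inner (B x) x \<le> s * (norm x)\<^sup>2"
proof (rule field_le_epsilon)
  fix e :: real assume e: "e > 0"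
  define s1 where "s1 = s + e / ((norm x)\<^sup>2 + 1)"
  have nx: "(norm x)\<^sup>2 + 1 > 0" by (smt (verit) zero_le_power2)
  have "s1 > s" using e nx by (simp add: s1_def)
  then have "\<exists>s'<s1. \<forall>x\<in>G. inner (B x) x \<le> s' * (norm x)\<^sup>2"
    by (intro form_bound_if_bounded_below[where C = C] bb assms) auto
  then obtain s' where "s' < s1" "inner (B x) x \<le> s' * (norm x)\<^sup>2" using x by blast
  then have "inner (B x) x \<le> s1 * (norm x)\<^sup>2" by (smt (verit) mult_right_mono zero_le_power2)
  also have "\<dots> = s * (norm x)\<^sup>2 + e * ((norm x)\<^sup>2 / ((norm x)\<^sup>2 + 1))"
    by (simp add: s1_def algebra_simps)
  also have "\<dots> \<le> s * (norm x)\<^sup>2 + e * 1"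
    using e nx by (intro add_left_mono mult_left_mono) auto
  finally show "inner (B x) x \<le> s * (norm x)\<^sup>2 + e" by simp
qed

text \<open>If the spectrum of \<open>A\<close> in \<open>(-r, r)\<close> is at most \<open>{0}\<close>, then \<open>|A y| \<ge> r |y|\<close> on the range of \<open>A\<close>.  The
square \<open>B = A\<^sup>2\<close> has the spectral gap \<open>(0, r\<^sup>2)\<close>, so with \<open>\<rho> = r\<^sup>2 / 2\<close> the form of \<open>(B - \<rho>)\<^sup>2\<close> is at least
\<open>\<rho>\<^sup>2\<close>; expanding \<open>|B x - \<rho> x|\<^sup>2 \<ge> \<rho>\<^sup>2 |x|\<^sup>2\<close> yields the claim.  Passing to the square avoids the
functional calculus that a direct treatment of the gaps \<open>(-r, 0)\<close> and \<open>(0, r)\<close> would call for.\<close>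

lemma isolated_zero_bounded_below:
  fixes G :: "'a :: real_inner set" and A :: "'a \<Rightarrow> 'a"
  assumes G: "0 \<in> G" "\<And>x y. x \<in> G \<Longrightarrow> y \<in> G \<Longrightarrow> x + y \<in> G" "\<And>r x. x \<in> G \<Longrightarrow> r *\<^sub>R x \<in> G"
    and A: "\<And>x. x \<in> G \<Longrightarrow> A x \<in> G" "\<And>x y. x \<in> G \<Longrightarrow> y \<in> G \<Longrightarrow> A (x + y) = A x + A y"
      "\<And>r x. x \<in> G \<Longrightarrow> A (r *\<^sub>R x) = r *\<^sub>R A x" "\<And>x. x \<in> G \<Longrightarrow> norm (A x) \<le> C * norm x"
    and sym: "\<And>x y. x \<in> G \<Longrightarrow> y \<in> G \<Longrightarrow> inner (A x) y = inner x (A y)"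
    and r: "r > 0"
    and bb: "\<And>w. w \<noteq> 0 \<Longrightarrow> \<bar>w\<bar> < r \<Longrightarrow> \<exists>c>0. \<forall>u\<in>G. c * norm u \<le> norm (A u - w *\<^sub>R u)"
    and x: "x \<in> G"
  shows "r * norm (A x) \<le> norm (A (A x))"
proof -
  have Gd: "x - y \<in> G" if "x \<in> G" "y \<in> G" for x y
    using G(2)[OF that(1) G(3)[OF that(2), of "-1"]] by simp
  have Ad: "A (x - y) = A x - A y" if "x \<in> G" "y \<in> G" for x y
    using A(2)[OF that(1) G(3)[OF that(2), of "-1"]] A(3)[OF that(2), of "-1"] by simp
  define S where "S = (\<lambda>v u. A (A u) - v *\<^sub>R u)"
  define \<rho> where "\<rho> = r\<^sup>2 / 2"
  have SG: "S v u \<in> G" if "u \<in> G" for u v unfolding S_def using that by (intro Gd G A(1))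
  have Sadd: "S v (x + y) = S v x + S v y" if "x \<in> G" "y \<in> G" for v x y
    unfolding S_def using that by (simp add: A G algebra_simps)
  have Sscale: "S v (t *\<^sub>R x) = t *\<^sub>R S v x" if "x \<in> G" for v t x
    unfolding S_def using that by (simp add: A G algebra_simps)
  have Ssym: "inner (S v x) y = inner x (S v y)" if "x \<in> G" "y \<in> G" for v x y
    unfolding S_def using that by (simp add: inner_diff_left inner_diff_right sym A(1))
  define C' where "C' = \<bar>C\<bar>"
  have AC: "norm (A u) \<le> C' * norm u" if "u \<in> G" for u
    using order_trans[OF A(4)[OF that] mult_right_mono[OF abs_ge_self norm_ge_zero]] by (simp add: C'_def)
  have C': "C' \<ge> 0" by (simp add: C'_def)
  have Sb: "norm (S \<rho> u) \<le> (C' * C' + \<rho>) * norm u" if u: "u \<in> G" for u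
  proof -
    have "norm (A (A u)) \<le> C' * (C' * norm u)"
      using order_trans[OF AC[OF A(1)[OF u]] mult_left_mono[OF AC[OF u] C']] .
    moreover have "norm (S \<rho> u) \<le> norm (A (A u)) + norm (\<rho> *\<^sub>R u)"
      unfolding S_def by (rule norm_triangle_ineq4)
    ultimately show ?thesis by (simp add: \<rho>_def algebra_simps)
  qed
  \<comment> \<open>\<open>A\<^sup>2 - v = (A - \<surd>v)(A + \<surd>v)\<close> is bounded below in the gap \<open>0 < v < r\<^sup>2\<close>\<close>
  have Sbb: "\<exists>c>0. \<forall>u\<in>G. c * norm u \<le> norm (S v u)" if v: "0 < v" "v < r\<^sup>2" for v
  proof -
    define w where "w = sqrt v"
    have w: "w > 0" "w < r" "w * w = v" using v r by (auto simp: w_def real_less_lsqrt)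
    obtain c1 where c1: "c1 > 0" "\<And>u. u \<in> G \<Longrightarrow> c1 * norm u \<le> norm (A u - w *\<^sub>R u)"
      using bb[of w] w by auto
    obtain c2 where c2: "c2 > 0" "\<And>u. u \<in> G \<Longrightarrow> c2 * norm u \<le> norm (A u + w *\<^sub>R u)"
      using bb[of "-w"] w by auto
    have "c1 * c2 * norm u \<le> norm (S v u)" if u: "u \<in> G" for u
    proof -
      have g: "A u + w *\<^sub>R u \<in> G" using u by (intro G A(1))
      have "S v u = A (A u + w *\<^sub>R u) - w *\<^sub>R (A u + w *\<^sub>R u)"
        using u by (simp add: S_def A G w(3)[symmetric] algebra_simps)
      then have "c1 * norm (A u + w *\<^sub>R u) \<le> norm (S v u)" using c1(2)[OF g] by simp
      moreover have "c1 * (c2 * norm u) \<le> c1 * norm (A u + w *\<^sub>R u)"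
        using c1(1) c2(2)[OF u] by (intro mult_left_mono) auto
      ultimately show ?thesis by (simp add: mult.assoc)
    qed
    then show ?thesis using c1(1) c2(1) by (intro exI[of _ "c1 * c2"]) auto
  qed
  have \<rho>: "\<rho> > 0" using r by (simp add: \<rho>_def)
  have "inner (- S \<rho> (S \<rho> x)) x \<le> (- (\<rho>\<^sup>2)) * (norm x)\<^sup>2"
  proof (rule form_bound_if_bounded_below_weak[where G = G and C = "(C' * C' + \<rho>) * (C' * C' + \<rho>)"])
    fix \<alpha> assume \<alpha>: "\<alpha> > - (\<rho>\<^sup>2)"
    show "\<exists>c>0. \<forall>u\<in>G. c * norm u \<le> norm (- S \<rho> (S \<rho> u) - \<alpha> *\<^sub>R u)"
    proof (cases "\<alpha> > 0")
      case True
      have "\<alpha> * norm u \<le> norm (- S \<rho> (S \<rho> u) - \<alpha> *\<^sub>R u)" if u: "u \<in> G" for u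
      proof (cases "u = 0")
        case False
        have "\<alpha> * (norm u)\<^sup>2 \<le> inner (S \<rho> (S \<rho> u) + \<alpha> *\<^sub>R u) u"
          using Ssym[OF SG[OF u] u, of \<rho>] by (simp add: inner_add_left power2_norm_eq_inner)
        also have "\<dots> \<le> norm (S \<rho> (S \<rho> u) + \<alpha> *\<^sub>R u) * norm u" by (rule norm_cauchy_schwarz)
        also have "norm (S \<rho> (S \<rho> u) + \<alpha> *\<^sub>R u) = norm (- S \<rho> (S \<rho> u) - \<alpha> *\<^sub>R u)"
          by (metis minus_add_distrib norm_minus_cancel uminus_add_conv_diff add.commute diff_conv_add_uminus)
        finally show ?thesis using False by (simp add: power2_eq_square mult.assoc[symmetric])
      qed simp
      then show ?thesis using True by blast
    next
      case False
      define q where "q = sqrt (- \<alpha>)"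
      have q: "q \<ge> 0" "q < \<rho>" "q * q = - \<alpha>" using False \<alpha> \<rho> by (auto simp: q_def real_less_lsqrt)
      obtain c1 where c1: "c1 > 0" "\<And>u. u \<in> G \<Longrightarrow> c1 * norm u \<le> norm (S (\<rho> + q) u)"
        using Sbb[of "\<rho> + q"] q \<rho> by (auto simp: \<rho>_def)
      obtain c2 where c2: "c2 > 0" "\<And>u. u \<in> G \<Longrightarrow> c2 * norm u \<le> norm (S (\<rho> - q) u)"
        using Sbb[of "\<rho> - q"] q \<rho> by (auto simp: \<rho>_def)
      have "c1 * c2 * norm u \<le> norm (- S \<rho> (S \<rho> u) - \<alpha> *\<^sub>R u)" if u: "u \<in> G" for u
      proof -
        have Sq: "S (\<rho> + q) v = S \<rho> v - q *\<^sub>R v" "S (\<rho> - q) v = S \<rho> v + q *\<^sub>R v" for v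
          by (simp_all add: S_def algebra_simps)
        have Su: "S \<rho> u \<in> G" "q *\<^sub>R u \<in> G" using SG G u by blast+
        have "S (\<rho> + q) (S (\<rho> - q) u) = S \<rho> (S \<rho> u) - (q * q) *\<^sub>R u"
          unfolding Sq Sadd[OF Su] Sscale[OF u] by (simp add: algebra_simps)
        also have "\<dots> = - (- S \<rho> (S \<rho> u) - \<alpha> *\<^sub>R u)" using q(3) by simp
        finally have "norm (- S \<rho> (S \<rho> u) - \<alpha> *\<^sub>R u) = norm (S (\<rho> + q) (S (\<rho> - q) u))"
          by (simp only: norm_minus_cancel)
        moreover have "c1 * norm (S (\<rho> - q) u) \<le> norm (S (\<rho> + q) (S (\<rho> - q) u))"
          by (rule c1(2)[OF SG[OF u]])
        moreover have "c1 * (c2 * norm u) \<le> c1 * norm (S (\<rho> - q) u)"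
          using c1(1) c2(2)[OF u] by (intro mult_left_mono) auto
        ultimately show ?thesis by (simp add: mult.assoc)
      qed
      then show ?thesis using c1(1) c2(1) by (intro exI[of _ "c1 * c2"]) auto
    qed
  next
    fix u assume u: "u \<in> G"
    have "norm (S \<rho> (S \<rho> u)) \<le> (C' * C' + \<rho>) * ((C' * C' + \<rho>) * norm u)"
      using order_trans[OF Sb[OF SG[OF u]] mult_left_mono[OF Sb[OF u]]] \<rho> C' by simp
    then show "norm (- S \<rho> (S \<rho> u)) \<le> (C' * C' + \<rho>) * (C' * C' + \<rho>) * norm u"
      by (simp add: mult.assoc)
  next
    fix u assume u: "u \<in> G"
    show "- S \<rho> (S \<rho> u) \<in> G" using G(3)[OF SG[OF SG[OF u]], of "-1"] by simp
    show "- S \<rho> (S \<rho> (t *\<^sub>R u)) = t *\<^sub>R - S \<rho> (S \<rho> u)" for t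
      by (simp add: Sscale SG u)
    fix y assume y: "y \<in> G"
    show "- S \<rho> (S \<rho> (u + y)) = - S \<rho> (S \<rho> u) + - S \<rho> (S \<rho> y)"
      using u y by (simp add: Sadd SG)
    show "inner (- S \<rho> (S \<rho> u)) y = inner u (- S \<rho> (S \<rho> y))"
      using u y by (simp add: Ssym SG)
  qed (use G x in auto)
  then have "\<rho>\<^sup>2 * (norm x)\<^sup>2 \<le> (norm (S \<rho> x))\<^sup>2"
    using Ssym[OF SG[OF x] x, of \<rho>] by (simp add: power2_norm_eq_inner)
  also have "\<dots> = (norm (A (A x)))\<^sup>2 - 2 * \<rho> * (norm (A x))\<^sup>2 + \<rho>\<^sup>2 * (norm x)\<^sup>2"
    unfolding S_def norm_diff_sq using sym[OF A(1)[OF x] x]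
    by (simp add: power_mult_distrib power2_norm_eq_inner)
  finally have "(r * norm (A x))\<^sup>2 \<le> (norm (A (A x)))\<^sup>2"
    by (simp add: \<rho>_def power_mult_distrib)
  then show ?thesis by (rule power2_le_imp_le) simp
qed

lemma eq_0_if_orthogonal_to_dense:
  assumes "closure D = K" "z \<in> K" "\<And>x. x \<in> D \<Longrightarrow> cinner x z = 0"
  shows "z = (0 :: 'a :: complex_inner)"
proof -
  obtain f where f: "\<And>n. f n \<in> D" "f \<longlonglongrightarrow> z"
    using assms(1,2) unfolding closure_sequential[symmetric] by (metis closure_sequential)
  have "(\<lambda>n. cinner (f n) z) \<longlonglongrightarrow> cinner z z" by (rule tendsto_cinner(2)[OF f(2)])
  then have "cinner z z = 0" using assms(3) f(1) by (simp add: LIMSEQ_const_iff)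
  then show ?thesis by (simp add: cinner_self_eq_0)
qed

section \<open>Self-adjoint operators with bounded inverse\<close>

locale invertible_selfadjoint =
  fixes K D :: "'a :: chilbert_space set" and T :: "'a \<Rightarrow> 'a"
  assumes closed_K: "closed_csubspace K"
    and selfadjoint: "selfadjoint K D T"
    and bounded_inverse: "has_bounded_inverse K D T"
begin

abbreviation eig :: "real \<Rightarrow> 'a set" where
  "eig t \<equiv> eigenspace D T (complex_of_real t)"

definition A :: "'a \<Rightarrow> 'a" where "A = inv_into D T"

lemma csubspace_K: "csubspace K" and csubspace_D: "csubspace D"
  and D_subset: "x \<in> D \<Longrightarrow> x \<in> K" and T_in: "x \<in> D \<Longrightarrow> T x \<in> K"
  and T_add: "x \<in> D \<Longrightarrow> y \<in> D \<Longrightarrow> T (x + y) = T x + T y"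
  and T_scaleC: "x \<in> D \<Longrightarrow> T (a *\<^sub>C x) = a *\<^sub>C T x"
  and dense: "closure D = K"
  using closed_K selfadjoint
  by (auto simp: closed_csubspace_def selfadjoint_def linear_op_def densely_defined_def)

lemma T_scaleR: "x \<in> D \<Longrightarrow> T (r *\<^sub>R x) = r *\<^sub>R T x"
  by (simp add: scaleR_scaleC T_scaleC)

lemma T_diff: "x \<in> D \<Longrightarrow> y \<in> D \<Longrightarrow> T (x - y) = T x - T y"
  using T_add[of x "(-1) *\<^sub>R y"] T_scaleR[of y "-1"] csubspaceD(5)[OF csubspace_D, of y "-1"] by simp

lemma T_sum: "finite S \<Longrightarrow> (\<And>i. i \<in> S \<Longrightarrow> f i \<in> D) \<Longrightarrow> T (sum f S) = (\<Sum>i\<in>S. T (f i))"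
proof (induction S rule: finite_induct)
  case empty
  show ?case using T_scaleR[OF csubspaceD(1)[OF csubspace_D], of 0] by simp
next
  case (insert i S)
  have "sum f S \<in> D" using insert.prems by (intro complex_vector.subspace_sum[OF csubspace_D]) auto
  then show ?case using insert T_add by simp
qed

text \<open>The working form of self-adjointness: every \<open>y\<close> that has an adjoint value already lies in the domain.\<close>

lemma adjoint_witness:
  assumes "y \<in> K" "z \<in> K" "\<And>x. x \<in> D \<Longrightarrow> cinner (T x) y = cinner x z"
  shows "y \<in> D" "T y = z"
proof -
  have "y \<in> adjoint_dom K D T" using assms by (auto simp: adjoint_dom_def)
  then show yD: "y \<in> D" using selfadjoint by (simp add: selfadjoint_def)
  have "(THE z. z \<in> K \<and> (\<forall>x\<in>D. cinner (T x) y = cinner x z)) = z"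
  proof (rule the_equality)
    fix z' assume z': "z' \<in> K \<and> (\<forall>x\<in>D. cinner (T x) y = cinner x z')"
    have "z' - z = 0"
      by (rule eq_0_if_orthogonal_to_dense[OF dense csubspaceD(3)[OF csubspace_K]])
         (use z' assms in \<open>auto simp: cinner_diff_right\<close>)
    then show "z' = z" by simp
  qed (use assms in auto)
  then show "T y = z" using selfadjoint yD by (auto simp: selfadjoint_def adjoint_op_def)
qed

lemma T_sym: "x \<in> D \<Longrightarrow> y \<in> D \<Longrightarrow> cinner (T x) y = cinner x (T y)"
proof -
  assume x: "x \<in> D" and y: "y \<in> D"
  have "y \<in> adjoint_dom K D T" using selfadjoint y by (simp add: selfadjoint_def)
  then obtain z where z: "y \<in> K" "z \<in> K" "\<And>x. x \<in> D \<Longrightarrow> cinner (T x) y = cinner x z"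
    by (auto simp: adjoint_dom_def)
  then show ?thesis using adjoint_witness(2)[OF z] x by simp
qed

lemma T_bij: "bij_betw T D K" using bounded_inverse by (simp add: has_bounded_inverse_def)

lemma A_in_D: "y \<in> K \<Longrightarrow> A y \<in> D" and T_A: "y \<in> K \<Longrightarrow> T (A y) = y" and A_T: "x \<in> D \<Longrightarrow> A (T x) = x"
  using T_bij unfolding A_def
  by (auto simp: bij_betw_def inv_into_into f_inv_into_f)

lemma A_in_K: "y \<in> K \<Longrightarrow> A y \<in> K" using A_in_D D_subset by blast

lemma A_add: "x \<in> K \<Longrightarrow> y \<in> K \<Longrightarrow> A (x + y) = A x + A y"
  using A_T[of "A x + A y"] T_add[of "A x" "A y"] csubspaceD(2)[OF csubspace_D] by (simp add: A_in_D T_A)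

lemma A_scaleC: "x \<in> K \<Longrightarrow> A (a *\<^sub>C x) = a *\<^sub>C A x"
  using A_T[of "a *\<^sub>C A x"] T_scaleC[of "A x"] csubspaceD(4)[OF csubspace_D] by (simp add: A_in_D T_A)

lemma A_scaleR: "x \<in> K \<Longrightarrow> A (r *\<^sub>R x) = r *\<^sub>R A x"
  by (simp add: scaleR_scaleC A_scaleC)

lemma A_diff: "x \<in> K \<Longrightarrow> y \<in> K \<Longrightarrow> A (x - y) = A x - A y"
  using A_add[of x "(-1) *\<^sub>R y"] A_scaleR[of y "-1"] csubspaceD(5)[OF csubspace_K, of y "-1"] by simp

lemma A_sym: "x \<in> K \<Longrightarrow> y \<in> K \<Longrightarrow> cinner (A x) y = cinner x (A y)"
  using T_sym[of "A x" "A y"] by (simp add: A_in_D T_A)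

lemma A_sym_inner: "x \<in> K \<Longrightarrow> y \<in> K \<Longrightarrow> inner (A x) y = inner x (A y)"
  by (simp add: inner_eq_Re_cinner A_sym)

lemma A_bounded: obtains C where "C > 0" "\<And>y. y \<in> K \<Longrightarrow> norm (A y) \<le> C * norm y"
proof -
  obtain C where C: "\<And>y. y \<in> K \<Longrightarrow> norm (A y) \<le> C * norm y"
    using bounded_inverse by (auto simp: has_bounded_inverse_def A_def)
  have "norm (A y) \<le> (\<bar>C\<bar> + 1) * norm y" if "y \<in> K" for y
    by (rule order_trans[OF C[OF that] mult_right_mono]) auto
  then show ?thesis by (intro that[of "\<bar>C\<bar> + 1"]) auto
qed

text \<open>To bound the form of \<open>A\<close> on \<open>G\<close> it suffices that the compression of \<open>A\<close> to \<open>G\<close> has no approximate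
eigenvalue above the bound: the compression has the same form on \<open>G\<close> and maps \<open>G\<close> to itself.\<close>

lemma compression_form_bound:
  assumes G: "closed_csubspace G" "G \<subseteq> K"
    and bb: "\<And>\<alpha>. \<alpha> > s \<Longrightarrow> \<exists>c>0. \<forall>u\<in>G. c * norm u \<le> norm (orth_proj G (A u) - \<alpha> *\<^sub>R u)"
    and y: "y \<in> G"
  shows "inner (A y) y \<le> s * (norm y)\<^sup>2"
proof -
  obtain C where C: "C > 0" "\<And>y. y \<in> K \<Longrightarrow> norm (A y) \<le> C * norm y" using A_bounded by blast
  have subG: "csubspace G" using G(1) by (simp add: closed_csubspace_def)
  have K: "u \<in> K" if "u \<in> G" for u using that G(2) by blast
  have inner_proj: "inner (orth_proj G (A u)) v = inner (A u) v" if "v \<in> G" for u v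
    using orth_proj_cinner[OF G(1), of "A u" v] orth_proj_fixed[OF G(1) that]
    by (simp add: inner_eq_Re_cinner)
  have "inner (orth_proj G (A y)) y \<le> s * (norm y)\<^sup>2"
  proof (rule form_bound_if_bounded_below_weak[where G = G and C = C, OF _ _ _ _ _ _ _ _ bb y])
    fix u v assume u: "u \<in> G" and v: "v \<in> G"
    show "inner (orth_proj G (A u)) v = inner u (orth_proj G (A v))"
      using inner_proj[OF v, of u] inner_proj[OF u, of v] A_sym_inner[OF K[OF u] K[OF v]]
      by (simp add: inner_commute)
  next
    fix u assume u: "u \<in> G"
    show "norm (orth_proj G (A u)) \<le> C * norm u"
      using order_trans[OF norm_orth_proj_le[OF G(1)] C(2)[OF K[OF u]]] .
  qed (simp_all add: csubspaceD[OF subG] orth_proj_in[OF G(1)] A_add A_scaleR K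
        orth_proj_add[OF G(1)] orth_proj_scaleR[OF G(1)])
  then show ?thesis by (simp add: inner_proj[OF y])
qed

text \<open>For a self-adjoint operator the resolvent set consists of the \<open>z\<close> for which \<open>T - z\<close> is bounded below.
Then \<open>T - z\<close> is injective with closed range, and a vector orthogonal to the range would be an
eigenvector for \<open>cnj z\<close>: this is impossible for nonreal \<open>z\<close> by symmetry, and for real \<open>z\<close> because
\<open>T - z\<close> is injective.\<close>

lemma resolvent_iff:
  "z \<notin> spectrum K D T \<longleftrightarrow> (\<exists>c>0. \<forall>x\<in>D. c * norm x \<le> norm (T x - z *\<^sub>C x))"
proof
  assume "z \<notin> spectrum K D T"
  then obtain C where bij: "bij_betw (\<lambda>x. T x - z *\<^sub>C x) D K"
    and C: "\<And>y. y \<in> K \<Longrightarrow> norm (inv_into D (\<lambda>x. T x - z *\<^sub>C x) y) \<le> C * norm y"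
    by (auto simp: spectrum_def has_bounded_inverse_def)
  have "inverse (\<bar>C\<bar> + 1) * norm x \<le> norm (T x - z *\<^sub>C x)" if x: "x \<in> D" for x
  proof -
    have k: "T x - z *\<^sub>C x \<in> K" using bij x by (auto simp: bij_betw_def)
    have "inv_into D (\<lambda>x. T x - z *\<^sub>C x) (T x - z *\<^sub>C x) = x"
      using bij x by (auto simp: bij_betw_def intro: inv_into_f_f)
    then have "norm x \<le> C * norm (T x - z *\<^sub>C x)" using C[OF k] by simp
    also have "\<dots> \<le> (\<bar>C\<bar> + 1) * norm (T x - z *\<^sub>C x)" by (intro mult_right_mono) auto
    finally show ?thesis by (simp add: field_simps)
  qed
  then show "\<exists>c>0. \<forall>x\<in>D. c * norm x \<le> norm (T x - z *\<^sub>C x)"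
    by (intro exI[of _ "inverse (\<bar>C\<bar> + 1)"]) (auto intro: add_nonneg_pos)
next
  assume "\<exists>c>0. \<forall>x\<in>D. c * norm x \<le> norm (T x - z *\<^sub>C x)"
  then obtain c where c: "c > 0" "\<And>x. x \<in> D \<Longrightarrow> c * norm x \<le> norm (T x - z *\<^sub>C x)" by blast
  define S where "S = (\<lambda>x. T x - z *\<^sub>C x)"
  have S_diff: "S (x - y) = S x - S y" if "x \<in> D" "y \<in> D" for x y
    using that by (simp add: S_def T_diff complex_vector.scale_right_diff_distrib)
  have S_in: "S x \<in> K" if "x \<in> D" for x
    unfolding S_def using that by (intro csubspaceD(3,4)[OF csubspace_K] T_in D_subset)
  have inj: "inj_on S D"
  proof (rule inj_onI)
    fix x y assume xy: "x \<in> D" "y \<in> D" "S x = S y"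
    then have "c * norm (x - y) \<le> 0"
      using c(2)[OF csubspaceD(3)[OF csubspace_D xy(1,2)]] S_diff[OF xy(1,2)] by (simp add: S_def)
    then show "x = y" using c(1) by (simp add: mult_le_0_iff)
  qed
  have subR: "csubspace (S ` D)"
    by (rule csubspace_image[OF csubspace_D])
       (simp_all add: S_def T_add T_scaleC complex_vector.scale_right_distrib scaleC_scaleC mult.commute
         complex_vector.scale_right_diff_distrib)
  have closedR: "closed (S ` D)"
    unfolding closed_sequential_limits
  proof (intro allI impI, elim conjE)
    fix f y assume f: "\<forall>n. f n \<in> S ` D" and y: "f \<longlonglongrightarrow> y"
    then obtain x where x: "\<And>n. x n \<in> D" "\<And>n. f n = S (x n)" unfolding image_iff Bex_def by metis
    have "Cauchy x"
    proof (rule metric_CauchyI)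
      fix e :: real assume e: "e > 0"
      have "Cauchy f" using y by (rule LIMSEQ_imp_Cauchy)
      then obtain N where N: "\<And>m n. m \<ge> N \<Longrightarrow> n \<ge> N \<Longrightarrow> dist (f m) (f n) < c * e"
        using metric_CauchyD[of f "c * e"] c(1) e by auto
      have "dist (x m) (x n) < e" if "m \<ge> N" "n \<ge> N" for m n
      proof -
        have "c * norm (x m - x n) \<le> norm (f m - f n)"
          using c(2)[OF csubspaceD(3)[OF csubspace_D x(1) x(1)], of m n]
          unfolding x(2) S_diff[OF x(1) x(1), symmetric] by (simp add: S_def)
        also have "\<dots> < c * e" using N[OF that] by (simp add: dist_norm)
        finally show ?thesis using c(1) by (simp add: dist_norm)
      qed
      then show "\<exists>N. \<forall>m\<ge>N. \<forall>n\<ge>N. dist (x m) (x n) < e" by blast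
    qed
    then obtain l where l: "x \<longlonglongrightarrow> l" using Cauchy_convergent convergent_def by blast
    have cK: "closed K" using closed_K by (simp add: closed_csubspace_def)
    have lK: "l \<in> K" using closed_sequentially[OF cK _ l] x(1) D_subset by blast
    have yK: "y \<in> K" using closed_sequentially[OF cK _ y] x S_in by metis
    have wK: "y + z *\<^sub>C l \<in> K" using lK yK by (intro csubspaceD[OF csubspace_K])
    have lim: "(\<lambda>n. T (x n)) \<longlonglongrightarrow> y + z *\<^sub>C l"
    proof -
      have "T (x n) = f n + z *\<^sub>C x n" for n by (simp add: x(2) S_def)
      then show ?thesis
        using tendsto_add[OF y bounded_linear.tendsto[OF bounded_linear_scaleC_right l, of z]] by simp
    qed
    have "cinner (T w) l = cinner w (y + z *\<^sub>C l)" if w: "w \<in> D" for w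
      using LIMSEQ_unique[OF tendsto_cinner(1)[OF l, of "T w"]] tendsto_cinner(1)[OF lim, of w]
      by (simp add: T_sym[OF w x(1)])
    from adjoint_witness[OF lK wK this] have "l \<in> D" "S l = y" by (auto simp: S_def)
    then show "y \<in> S ` D" by blast
  qed
  have clR: "closed_csubspace (S ` D)" using subR closedR by (simp add: closed_csubspace_def)
  have surj: "S ` D = K"
  proof
    show "S ` D \<subseteq> K" using S_in by blast
    show "K \<subseteq> S ` D"
    proof
      fix y assume y: "y \<in> K"
      define q where "q = y - orth_proj (S ` D) y"
      have qo: "q \<in> orthocomp (S ` D)" unfolding q_def by (rule orth_proj_orth[OF clR])
      have p: "orth_proj (S ` D) y \<in> S ` D" by (rule orth_proj_in[OF clR])
      then have qK: "q \<in> K" unfolding q_def using y S_in by (intro csubspaceD(3)[OF csubspace_K]) auto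
      have "cinner (T w) q = cinner w (cnj z *\<^sub>C q)" if w: "w \<in> D" for w
      proof -
        have "cinner (S w) q = 0" using orthocompD(1)[OF qo] w by blast
        then show ?thesis by (simp add: S_def cinner_simps)
      qed
      from adjoint_witness[OF qK csubspaceD(4)[OF csubspace_K qK] this]
      have qD: "q \<in> D" and Tq: "T q = cnj z *\<^sub>C q" by auto
      have "q = 0"
      proof (cases "Im z = 0")
        case True
        then have "cnj z = z" by (simp add: complex_eq_iff)
        then have "c * norm q \<le> 0" using c(2)[OF qD] Tq by simp
        then show ?thesis using c(1) by (simp add: mult_le_0_iff)
      next
        case False
        then have "z \<noteq> cnj z" by (auto simp: complex_eq_iff)
        moreover have "z * cinner q q = cnj z * cinner q q"
          using T_sym[OF qD qD] by (simp add: Tq cinner_simps)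
        ultimately show ?thesis by (simp add: cinner_self_eq_0)
      qed
      then show "y \<in> S ` D" using p by (simp add: q_def)
    qed
  qed
  have bij: "bij_betw S D K" using inj surj by (simp add: bij_betw_def)
  have "norm (inv_into D S y) \<le> (1 / c) * norm y" if y: "y \<in> K" for y
  proof -
    have "inv_into D S y \<in> D" "S (inv_into D S y) = y"
      using y surj by (auto intro: inv_into_into f_inv_into_f)
    then have "c * norm (inv_into D S y) \<le> norm y" using c(2) unfolding S_def by metis
    then show ?thesis using c(1) by (simp add: field_simps)
  qed
  then show "z \<notin> spectrum K D T"
    using bij unfolding spectrum_def has_bounded_inverse_def S_def by blast
qed

lemma nonreal_notin_spectrum:
  assumes "Im z \<noteq> 0" shows "z \<notin> spectrum K D T"
  unfolding resolvent_iff
proof (intro exI[of _ "\<bar>Im z\<bar>"] conjI ballI)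
  fix x assume x: "x \<in> D"
  show "\<bar>Im z\<bar> * norm x \<le> norm (T x - z *\<^sub>C x)"
  proof (cases "x = 0")
    case False
    have "cinner x (T x) = cnj (cinner x (T x))" using T_sym[OF x x] cinner_commute[of x "T x"] by simp
    then have "Im (cinner x (T x)) = 0" by (simp add: complex_eq_iff)
    then have "\<bar>Im z\<bar> * (norm x)\<^sup>2 = \<bar>Im (cinner x (T x - z *\<^sub>C x))\<bar>"
      by (simp add: cinner_simps cinner_self abs_mult)
    also have "\<dots> \<le> norm x * norm (T x - z *\<^sub>C x)"
      using order_trans[OF abs_Im_le_cmod norm_cinner_le] by blast
    finally show ?thesis using False by (simp add: power2_eq_square mult.commute mult.left_commute)
  qed simp
qed (use assms in auto)

lemma closed_spectrum: "closed (spectrum K D T)"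
proof -
  have "open (- spectrum K D T)"
    unfolding open_dist
  proof (intro ballI)
    fix z assume "z \<in> - spectrum K D T"
    then obtain c where c: "c > 0" "\<And>x. x \<in> D \<Longrightarrow> c * norm x \<le> norm (T x - z *\<^sub>C x)"
      using resolvent_iff by auto
    show "\<exists>e>0. \<forall>w. dist w z < e \<longrightarrow> w \<in> - spectrum K D T"
    proof (intro exI[of _ "c / 2"] conjI allI impI)
      fix w assume w: "dist w z < c / 2"
      have "c / 2 * norm x \<le> norm (T x - w *\<^sub>C x)" if x: "x \<in> D" for x
      proof -
        have "T x - z *\<^sub>C x = (T x - w *\<^sub>C x) + (w - z) *\<^sub>C x"
          by (simp add: complex_vector.scale_left_diff_distrib)
        then have "norm (T x - z *\<^sub>C x) \<le> norm (T x - w *\<^sub>C x) + cmod (w - z) * norm x"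
          using norm_triangle_ineq by (metis norm_scaleC)
        moreover have "cmod (w - z) * norm x \<le> c / 2 * norm x"
          using w by (intro mult_right_mono) (auto simp: dist_norm)
        ultimately show ?thesis using c(2)[OF x] by simp
      qed
      then have "w \<notin> spectrum K D T" unfolding resolvent_iff using c(1) by (intro exI[of _ "c / 2"]) auto
      then show "w \<in> - spectrum K D T" by simp
    qed (use c in auto)
  qed
  then show ?thesis by (simp add: closed_def)
qed

text \<open>The resolvent criterion for \<open>T\<close> at \<open>t\<close> and for its inverse at \<open>1 / t\<close> are equivalent, by
\<open>T - t = - t (A - 1 / t) T\<close>.\<close>

lemma resolvent_inverse_iff:
  assumes t: "t \<noteq> (0 :: real)"
  shows "complex_of_real t \<notin> spectrum K D T \<longleftrightarrow>
    (\<exists>c>0. \<forall>y\<in>K. c * norm y \<le> norm (A y - (1 / t) *\<^sub>R y))"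
proof -
  have eq: "T x - complex_of_real t *\<^sub>C x = (- t) *\<^sub>R (A (T x) - (1 / t) *\<^sub>R T x)" if "x \<in> D" for x
    using that t by (simp add: A_T scaleR_scaleC[symmetric] algebra_simps)
  obtain C where C: "C > 0" "\<And>y. y \<in> K \<Longrightarrow> norm (A y) \<le> C * norm y" using A_bounded by blast
  show ?thesis unfolding resolvent_iff
  proof
    assume "\<exists>c>0. \<forall>x\<in>D. c * norm x \<le> norm (T x - complex_of_real t *\<^sub>C x)"
    then obtain c where c: "c > 0" "\<And>x. x \<in> D \<Longrightarrow> c * norm x \<le> norm (T x - complex_of_real t *\<^sub>C x)" by blast
    define k where "k = 1 / (\<bar>t\<bar> * (1 + \<bar>t\<bar> / c))"
    have k: "k > 0" using c(1) t by (auto simp: k_def intro!: divide_pos_pos mult_pos_pos add_pos_nonneg)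
    have "k * norm y \<le> norm (A y - (1 / t) *\<^sub>R y)" if y: "y \<in> K" for y
    proof -
      define x where "x = A y"
      have x: "x \<in> D" "T x = y" using y by (auto simp: x_def A_in_D T_A)
      define N where "N = norm (T x - complex_of_real t *\<^sub>C x)"
      have N: "N = \<bar>t\<bar> * norm (A y - (1 / t) *\<^sub>R y)" using eq[OF x(1)] x(2) unfolding N_def by simp
      have "norm y \<le> N + norm (complex_of_real t *\<^sub>C x)"
        using norm_triangle_ineq[of "T x - complex_of_real t *\<^sub>C x" "complex_of_real t *\<^sub>C x"]
        by (simp add: x(2) N_def)
      also have "norm (complex_of_real t *\<^sub>C x) = \<bar>t\<bar> * norm x" by (simp add: norm_scaleC)
      also have "\<dots> \<le> \<bar>t\<bar> * (N / c)"
        using c(2)[OF x(1)] c(1) by (intro mult_left_mono) (auto simp: N_def field_simps)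
      finally have "norm y \<le> (1 + \<bar>t\<bar> / c) * N" by (simp add: algebra_simps)
      also have "\<dots> = (\<bar>t\<bar> * (1 + \<bar>t\<bar> / c)) * norm (A y - (1 / t) *\<^sub>R y)" by (simp add: N)
      finally have "norm y \<le> norm (A y - (1 / t) *\<^sub>R y) / k" by (simp add: k_def mult.commute)
      then show ?thesis using k by (simp add: field_simps)
    qed
    then show "\<exists>c>0. \<forall>y\<in>K. c * norm y \<le> norm (A y - (1 / t) *\<^sub>R y)" using k by blast
  next
    assume "\<exists>c>0. \<forall>y\<in>K. c * norm y \<le> norm (A y - (1 / t) *\<^sub>R y)"
    then obtain c where c: "c > 0" "\<And>y. y \<in> K \<Longrightarrow> c * norm y \<le> norm (A y - (1 / t) *\<^sub>R y)" by blast
    have "\<bar>t\<bar> * c / C * norm x \<le> norm (T x - complex_of_real t *\<^sub>C x)" if x: "x \<in> D" for x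
    proof -
      have "norm x \<le> C * norm (T x)" using C(2)[OF T_in[OF x]] by (simp add: A_T x)
      then have "\<bar>t\<bar> * c / C * norm x \<le> \<bar>t\<bar> * c / C * (C * norm (T x))"
        using C(1) c(1) by (intro mult_left_mono) auto
      also have "\<dots> = \<bar>t\<bar> * (c * norm (T x))" using C(1) by simp
      also have "\<dots> \<le> \<bar>t\<bar> * norm (A (T x) - (1 / t) *\<^sub>R T x)"
        by (intro mult_left_mono c(2) T_in x) auto
      also have "\<dots> = norm (T x - complex_of_real t *\<^sub>C x)" unfolding eq[OF x] by simp
      finally show ?thesis .
    qed
    then show "\<exists>c>0. \<forall>x\<in>D. c * norm x \<le> norm (T x - complex_of_real t *\<^sub>C x)"
      using C(1) c(1) t by (intro exI[of _ "\<bar>t\<bar> * c / C"]) auto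
  qed
qed

lemma eigenspace_iff_inverse:
  assumes "t \<noteq> (0 :: real)"
  shows "x \<in> eig t \<longleftrightarrow> x \<in> K \<and> A x = (1 / t) *\<^sub>R x"
proof
  assume "x \<in> eig t"
  then have x: "x \<in> D" "T x = t *\<^sub>R x" by (auto simp: eigenspace_def scaleR_scaleC)
  then have "x = t *\<^sub>R A x" using A_T[of x] A_scaleR[of x t] D_subset by simp
  then have "(1 / t) *\<^sub>R x = (1 / t) *\<^sub>R t *\<^sub>R A x" by simp
  then show "x \<in> K \<and> A x = (1 / t) *\<^sub>R x" using x D_subset assms by simp
next
  assume x: "x \<in> K \<and> A x = (1 / t) *\<^sub>R x"
  then have "x = t *\<^sub>R A x" using assms by simp
  then have xD: "x \<in> D" using A_in_D[of x] x csubspaceD(5)[OF csubspace_D, of "A x" t] by simp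
  have "x = (1 / t) *\<^sub>R T x" using T_A[of x] T_scaleR[OF xD, of "1 / t"] x by simp
  then have "t *\<^sub>R x = t *\<^sub>R (1 / t) *\<^sub>R T x" by simp
  then have "T x = t *\<^sub>R x" using assms by simp
  with xD show "x \<in> eig t" by (simp add: eigenspace_def scaleR_scaleC)
qed

lemma csubspace_eigenspace: "csubspace (eigenspace D T z)"
proof (rule csubspaceI)
  show "0 \<in> eigenspace D T z"
    using csubspaceD(1)[OF csubspace_D] T_scaleR[of 0 0] by (simp add: eigenspace_def)
  show "x + y \<in> eigenspace D T z" if "x \<in> eigenspace D T z" "y \<in> eigenspace D T z" for x y
    using that csubspaceD(2)[OF csubspace_D] 
    by (auto simp: eigenspace_def T_add complex_vector.scale_right_distrib)
  show "a *\<^sub>C x \<in> eigenspace D T z" if "x \<in> eigenspace D T z" for a x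
    using that csubspaceD(4)[OF csubspace_D] 
    by (auto simp: eigenspace_def T_scaleC scaleC_scaleC mult.commute)
qed

lemma eigenspace_orthogonal:
  assumes "x \<in> eig s" "y \<in> eig t" "s \<noteq> t"
  shows "cinner x y = 0"
proof -
  have "complex_of_real s * cinner x y = complex_of_real t * cinner x y"
    using T_sym[of x y] assms(1,2) by (simp add: eigenspace_def cinner_simps)
  then show ?thesis using assms(3) by simp
qed

lemma eigenvalue_in_spectrum:
  assumes "eigenspace D T z \<noteq> {0}" shows "z \<in> spectrum K D T"
proof -
  obtain x where x: "x \<in> D" "T x = z *\<^sub>C x" "x \<noteq> 0"
    using assms csubspaceD(1)[OF csubspace_eigenspace, of z] by (auto simp: eigenspace_def)
  show ?thesis
  proof (rule ccontr)
    assume "z \<notin> spectrum K D T"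
    then obtain c where "c > 0" "c * norm x \<le> norm (T x - z *\<^sub>C x)" using resolvent_iff x(1) by blast
    then show False using x by (simp add: mult_le_0_iff)
  qed
qed

lemma spectrum_gap: obtains \<epsilon> where "\<epsilon> > 0" "\<And>t :: real. \<bar>t\<bar> < \<epsilon> \<Longrightarrow> complex_of_real t \<notin> spectrum K D T"
proof -
  have "0 \<notin> spectrum K D T" using bounded_inverse by (simp add: spectrum_def)
  then have "0 \<in> - spectrum K D T" by simp
  moreover have "open (- spectrum K D T)" using closed_spectrum by (simp add: closed_def)
  ultimately obtain e where e: "e > 0" "\<And>w. dist w 0 < e \<Longrightarrow> w \<in> - spectrum K D T"
    unfolding open_dist by blast
  show ?thesis by (rule that[OF e(1)]) (use e(2) in force)
qed

text \<open>An isolated point \<open>t\<close> of the spectrum stops being spectrum once its eigenspace is split off.  The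
shifted inverse \<open>L = A - 1 / t\<close> has an isolated zero in its spectrum and is therefore bounded below on
the closure \<open>R\<close> of its range, and \<open>R\<close> is the orthogonal complement of the kernel of \<open>L\<close>.\<close>

lemma isolated_bounded_below:
  assumes t: "t > (0 :: real)"
    and iso: "e > 0" "\<And>z. z \<in> spectrum K D T \<Longrightarrow> dist z (complex_of_real t) < e \<Longrightarrow> z = complex_of_real t"
  shows "\<exists>c>0. \<forall>y\<in>K. y \<in> orthocomp (eig t) \<longrightarrow>
    c * norm y \<le> norm (A y - (1 / t) *\<^sub>R y)"
proof -
  \<comment> \<open>for \<open>|w| < r\<close> the point \<open>1 / (1 / t + w)\<close> is positive and has distance less than \<open>e\<close> from \<open>t\<close>\<close>
  define r where "r = min (1 / (2 * t)) (e / (2 * t\<^sup>2))"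
  have r: "r > 0" using t iso(1) by (simp add: r_def)
  define L where "L = (\<lambda>y. A y - (1 / t) *\<^sub>R y)"
  have L_in: "L y \<in> K" if "y \<in> K" for y
    unfolding L_def using that by (intro csubspaceD(3,5)[OF csubspace_K] A_in_K)
  have L_add: "L (x + y) = L x + L y" if "x \<in> K" "y \<in> K" for x y
    using that by (simp add: L_def A_add algebra_simps)
  have L_scaleC: "L (a *\<^sub>C x) = a *\<^sub>C L x" if "x \<in> K" for a x
    using that by (simp add: L_def A_scaleC scaleR_scaleC scaleC_scaleC 
        complex_vector.scale_right_diff_distrib mult.commute)
  have L_scaleR: "L (s *\<^sub>R x) = s *\<^sub>R L x" if "x \<in> K" for s x
    using that by (simp add: scaleR_scaleC L_scaleC)
  have L_sym: "cinner (L x) y = cinner x (L y)" if "x \<in> K" "y \<in> K" for x y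
    using that by (simp add: L_def cinner_simps A_sym scaleR_scaleC)
  obtain C where C: "C > 0" "\<And>y. y \<in> K \<Longrightarrow> norm (A y) \<le> C * norm y" using A_bounded by blast
  have L_b: "norm (L y) \<le> (C + 1 / t) * norm y" if y: "y \<in> K" for y
    unfolding L_def using norm_triangle_ineq4[of "A y" "(1 / t) *\<^sub>R y"] C(2)[OF y] t
    by (simp add: algebra_simps)
  have step: "r * norm (L x) \<le> norm (L (L x))" if x: "x \<in> K" for x
  proof (rule isolated_zero_bounded_below[where G = K and C = "C + 1 / t"])
    fix w :: real assume w: "w \<noteq> 0" "\<bar>w\<bar> < r"
    have w1: "\<bar>w\<bar> < 1 / (2 * t)" "\<bar>w\<bar> < e / (2 * t\<^sup>2)" using w(2) by (auto simp: r_def)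
    have b: "1 / t + w > 1 / (2 * t)" 
    proof -
      have "1 / t = 1 / (2 * t) + 1 / (2 * t)" by simp
      then show ?thesis using w1(1) by linarith
    qed
    define t' where "t' = 1 / (1 / t + w)"
    have bp: "1 / t + w > 0" using b t by (smt (verit) divide_pos_pos)
    have "1 < (1 / t + w) * (2 * t)" using b t by (simp add: pos_divide_less_eq del: mult_2_right)
    then have t': "t' > 0" "t' < 2 * t"
      using bp by (auto simp: t'_def pos_divide_less_eq mult.commute)
    have ne: "t' \<noteq> t"
    proof
      assume "t' = t"
      moreover have "1 / t' = 1 / t + w" by (simp add: t'_def)
      ultimately have "1 / t + w = 1 / t" by simp
      then show False using w(1) by simp
    qed
    have "t' * (1 / t + w) = 1" using bp by (simp add: t'_def)
    then have "t - t' = w * t * t'" using t by (simp add: field_simps)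
    then have "\<bar>t' - t\<bar> = \<bar>w\<bar> * t * t'" using t t' by (metis abs_minus_commute abs_mult abs_of_pos)
    also have "\<dots> \<le> \<bar>w\<bar> * t * (2 * t)" using t t' by (intro mult_left_mono) auto
    also have "\<dots> < e" using w1(2) t by (simp add: field_simps power2_eq_square)
    finally have "dist (complex_of_real t') (complex_of_real t) < e"
      by (simp add: dist_norm flip: of_real_diff)
    then have "complex_of_real t' \<notin> spectrum K D T" using iso(2)[of "complex_of_real t'"] ne by auto
    then have "\<exists>c>0. \<forall>y\<in>K. c * norm y \<le> norm (A y - (1 / t') *\<^sub>R y)"
      using resolvent_inverse_iff[of t'] t' by simp
    moreover have "A y - (1 / t') *\<^sub>R y = L y - w *\<^sub>R y" for y
      by (simp add: t'_def L_def algebra_simps)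
    ultimately show "\<exists>c>0. \<forall>y\<in>K. c * norm y \<le> norm (L y - w *\<^sub>R y)" by simp
  next
    fix x y assume "x \<in> K" "y \<in> K"
    then show "inner (L x) y = inner x (L y)" "L (x + y) = L x + L y" "x + y \<in> K"
      by (simp_all add: inner_eq_Re_cinner L_sym L_add csubspaceD(2)[OF csubspace_K])
  qed (simp_all add: csubspaceD[OF csubspace_K] L_in L_scaleR L_b r x)
  define R where "R = closure (L ` K)"
  have "csubspace R"
    unfolding R_def by (rule csubspace_closure[OF csubspace_image[OF csubspace_K L_add L_scaleC]])
  then have clR: "closed_csubspace R" by (simp add: closed_csubspace_def R_def)
  have cK: "closed K" using closed_K by (simp add: closed_csubspace_def)
  have RK: "R \<subseteq> K" unfolding R_def using L_in cK by (intro closure_minimal) auto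
  have Rb: "r * norm x \<le> norm (L x)" if x: "x \<in> R" for x
  proof -
    have xK: "x \<in> K" using x RK by blast
    obtain f where f: "\<And>n. f n \<in> L ` K" "f \<longlonglongrightarrow> x" using x unfolding R_def closure_sequential by blast
    have fK: "f n \<in> K" for n using f(1)[of n] L_in by auto
    have "(\<lambda>n. L (f n)) \<longlonglongrightarrow> L x"
    proof (rule Lim_null_comparison[THEN LIM_zero_cancel])
      show "\<forall>\<^sub>F n in sequentially. norm (L (f n) - L x) \<le> (C + 1 / t) * norm (f n - x)"
      proof (intro always_eventually allI)
        fix n
        have "L (f n) - L x = L (f n - x)"
          using L_add[OF csubspaceD(3)[OF csubspace_K fK xK] xK, of n] by simp
        then show "norm (L (f n) - L x) \<le> (C + 1 / t) * norm (f n - x)"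
          using L_b[OF csubspaceD(3)[OF csubspace_K fK xK], of n] by simp
      qed
      show "(\<lambda>n. (C + 1 / t) * norm (f n - x)) \<longlonglongrightarrow> 0"
        using tendsto_mult_left[OF tendsto_norm[OF LIM_zero[OF f(2)]], of "C + 1 / t"] by simp
    qed
    then have l: "(\<lambda>n. norm (L (f n))) \<longlonglongrightarrow> norm (L x)" by (rule tendsto_norm)
    show ?thesis
    proof (rule LIMSEQ_le[OF tendsto_mult_left[OF tendsto_norm[OF f(2)]] l])
      show "\<exists>N. \<forall>n\<ge>N. r * norm (f n) \<le> norm (L (f n))" using f(1) step by (metis imageE)
    qed
  qed
  have "r * norm y \<le> norm (A y - (1 / t) *\<^sub>R y)"
    if y: "y \<in> K" "y \<in> orthocomp (eig t)" for y
  proof -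
    define q where "q = y - orth_proj R y"
    have qo: "q \<in> orthocomp R" unfolding q_def by (rule orth_proj_orth[OF clR])
    have p: "orth_proj R y \<in> R" by (rule orth_proj_in[OF clR])
    have qK: "q \<in> K" unfolding q_def using y p RK by (intro csubspaceD(3)[OF csubspace_K]) auto
    have "L (L q) \<in> R" unfolding R_def
      by (rule closure_subset[THEN subsetD]) (rule imageI[OF L_in[OF qK]])
    then have "cinner (L q) (L q) = 0"
      using orthocompD(1)[OF qo] L_sym[OF L_in[OF qK] qK] by simp
    then have "L q = 0" by (simp add: cinner_self_eq_0)
    then have "q \<in> eig t"
      using qK t by (subst eigenspace_iff_inverse) (auto simp: L_def)
    then have "cinner q y = 0" using orthocompD(1)[OF y(2)] by blast
    moreover have "cinner q (orth_proj R y) = 0" using orthocompD(2)[OF qo p] .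
    ultimately have "cinner q q = 0" by (simp add: q_def cinner_diff_right)
    then have "y \<in> R" using p by (simp add: cinner_self_eq_0 q_def)
    then show ?thesis using Rb by (simp add: L_def)
  qed
  then show ?thesis using r by blast
qed

section \<open>Spans of eigenvectors\<close>

text \<open>If the spectrum of \<open>T\<close> in \<open>I\<close> is discrete and finite, this is the range of the spectral projection for \<open>I\<close>.\<close>

definition Eig :: "real set \<Rightarrow> 'a set" where
  "Eig I = cspan (\<Union>t\<in>I. eig t)"

lemma csubspace_Eig: "csubspace (Eig I)"
  unfolding Eig_def by (rule csubspace_cspan)

lemma Eig_base: "t \<in> I \<Longrightarrow> x \<in> eig t \<Longrightarrow> x \<in> Eig I"
  unfolding Eig_def by (rule complex_vector.span_base) (rule UN_I)

lemma eigenspace_subset_Eig: "t \<in> I \<Longrightarrow> eig t \<subseteq> Eig I"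
  using Eig_base by (rule subsetI)

lemma Eig_mono: "I \<subseteq> J \<Longrightarrow> Eig I \<subseteq> Eig J"
  unfolding Eig_def by (intro complex_vector.span_mono) auto

lemma Eig_decomposition:
  assumes "x \<in> Eig I"
  shows "\<exists>S f. finite S \<and> S \<subseteq> I \<and> (\<forall>t\<in>S. f t \<in> eig t) \<and> x = sum f S"
  using assms unfolding Eig_def
proof (induction rule: complex_vector.span_induct_alt)
  case base
  show ?case by (intro exI[of _ "{}"]) auto
next
  case (step c x y)
  then obtain S f t where S: "finite S" "S \<subseteq> I" "\<forall>t\<in>S. f t \<in> eig t"
    "y = sum f S" and t: "t \<in> I" "x \<in> eig t" by blast
  define f' where "f' = (\<lambda>s. if s = t then (if t \<in> S then f t else 0) + c *\<^sub>C x else f s)"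
  have "sum f' (insert t S) = f' t + sum f' (S - {t})" using S(1) by (simp add: sum.insert_remove)
  also have "sum f' (S - {t}) = sum f (S - {t})" by (rule sum.cong) (auto simp: f'_def)
  also have "f' t + sum f (S - {t}) = c *\<^sub>C x + sum f S"
    using S(1) by (cases "t \<in> S") (simp_all add: f'_def sum.remove[of S t f])
  finally have 1: "c *\<^sub>C x + y = sum f' (insert t S)" using S(4) by simp
  have 2: "f' s \<in> eig s" if "s \<in> insert t S" for s
    using that S(3) t csubspaceD(1)[OF csubspace_eigenspace, of s]
    by (auto simp: f'_def intro!: csubspaceD(2,4)[OF csubspace_eigenspace] csubspaceD(1)[OF csubspace_eigenspace])
  show ?case by (intro exI[of _ "insert t S"] exI[of _ f'] conjI) (use 1 2 S t in auto)
qed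

lemma Eig_in_D: "x \<in> Eig I \<Longrightarrow> x \<in> D"
  using cspan_subset[OF _ csubspace_D, of "\<Union>t\<in>I. eig t"]
  by (auto simp: Eig_def eigenspace_def)

lemma T_Eig: "x \<in> Eig I \<Longrightarrow> T x \<in> Eig I"
proof -
  assume "x \<in> Eig I"
  then obtain S f where S: "finite S" "S \<subseteq> I" "\<And>t. t \<in> S \<Longrightarrow> f t \<in> eig t" 
    "x = sum f S" by (auto dest!: Eig_decomposition)
  have "T x = (\<Sum>t\<in>S. T (f t))"
    unfolding S(4) by (rule T_sum[OF S(1)]) (use S(3) in \<open>auto simp: eigenspace_def\<close>)
  also have "\<dots> = (\<Sum>t\<in>S. complex_of_real t *\<^sub>C f t)"
    by (rule sum.cong) (use S(3) in \<open>auto simp: eigenspace_def\<close>)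
  also have "\<dots> \<in> Eig I"
    by (intro complex_vector.subspace_sum[OF csubspace_Eig] csubspaceD(4)[OF csubspace_Eig])
       (rule Eig_base[OF subsetD[OF S(2)] S(3)])
  finally show ?thesis .
qed

lemma A_sum: "finite S \<Longrightarrow> (\<And>i. i \<in> S \<Longrightarrow> f i \<in> K) \<Longrightarrow> A (sum f S) = (\<Sum>i\<in>S. A (f i))"
proof (induction S rule: finite_induct)
  case empty
  show ?case using A_scaleR[OF csubspaceD(1)[OF csubspace_K], of 0] by simp
next
  case (insert i S)
  have "sum f S \<in> K" using insert.prems by (intro complex_vector.subspace_sum[OF csubspace_K]) auto
  then show ?case using insert A_add by simp
qed

text \<open>The point \<open>0\<close> is excluded because the inverse acts as \<open>1 / t\<close> on the eigenspace for \<open>t\<close>.\<close>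

lemma Eig_decomposition_A:
  assumes "x \<in> Eig I" "0 \<notin> I"
  obtains S f where "finite S" "S \<subseteq> I" "\<And>t. t \<in> S \<Longrightarrow> f t \<in> eig t"
    "x = sum f S" "A x = (\<Sum>t\<in>S. (1 / t) *\<^sub>R f t)"
proof -
  obtain S f where S: "finite S" "S \<subseteq> I" "\<And>t. t \<in> S \<Longrightarrow> f t \<in> eig t" 
    "x = sum f S" using assms(1) by (auto dest!: Eig_decomposition)
  have *: "f t \<in> K \<and> A (f t) = (1 / t) *\<^sub>R f t" if "t \<in> S" for t
  proof -
    have "t \<noteq> 0" using that S(2) assms(2) by blast
    then show ?thesis using eigenspace_iff_inverse[of t "f t"] S(3)[OF that] by blast
  qed
  have "A x = (\<Sum>t\<in>S. A (f t))" unfolding S(4) by (rule A_sum[OF S(1)]) (use * in auto)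
  also have "\<dots> = (\<Sum>t\<in>S. (1 / t) *\<^sub>R f t)" by (rule sum.cong) (use * in auto)
  finally show ?thesis using that S by blast
qed

lemma A_Eig: "x \<in> Eig I \<Longrightarrow> 0 \<notin> I \<Longrightarrow> A x \<in> Eig I"
proof -
  assume "x \<in> Eig I" "0 \<notin> I"
  then obtain S f where S: "finite S" "S \<subseteq> I" "\<And>t. t \<in> S \<Longrightarrow> f t \<in> eig t"
    "A x = (\<Sum>t\<in>S. (1 / t) *\<^sub>R f t)" by (rule Eig_decomposition_A) blast
  show ?thesis unfolding S(4)
    by (intro complex_vector.subspace_sum[OF csubspace_Eig] csubspaceD(5)[OF csubspace_Eig])
       (rule Eig_base[OF subsetD[OF S(2)] S(3)])
qed

lemma inner_sum_eigenvectors: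
  assumes "finite S" "\<And>t. t \<in> S \<Longrightarrow> f t \<in> eig t"
  shows "inner (\<Sum>t\<in>S. c t *\<^sub>R f t) (sum f S) = (\<Sum>t\<in>S. c t * (norm (f t))\<^sup>2)"
proof -
  have "inner (c t *\<^sub>R f t) (sum f S) = c t * (norm (f t))\<^sup>2" if t: "t \<in> S" for t
  proof -
    have "inner (f t) (f s) = 0" if "s \<in> S - {t}" for s
      using eigenspace_orthogonal[OF assms(2)[OF t] assms(2)[of s]] that 
      by (auto simp: inner_eq_Re_cinner)
    then have "inner (f t) (sum f S) = inner (f t) (f t)"
      unfolding sum.remove[OF assms(1) t] inner_add_right inner_sum_right by simp
    then show ?thesis by (simp add: power2_norm_eq_inner)
  qed
  then show ?thesis unfolding inner_sum_left by (rule sum.cong[OF refl])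
qed

text \<open>Eigenvectors for different \<open>t\<close> are orthogonal, so the form of \<open>A\<close> is a sum of the terms
\<open>|f t|\<^sup>2 / t\<close>, each of which exceeds \<open>|f t|\<^sup>2 / \<tau>\<close> unless it vanishes.\<close>

lemma Eig_form:
  assumes x: "x \<in> Eig I" "x \<noteq> 0" and I: "\<And>t. t \<in> I \<Longrightarrow> 0 < t \<and> t < \<tau>"
  shows "inner (A x) x > (1 / \<tau>) * (norm x)\<^sup>2"
proof -
  have "0 \<notin> I" using I by blast
  with x(1) obtain S f where S: "finite S" "S \<subseteq> I" 
    "\<And>t. t \<in> S \<Longrightarrow> f t \<in> eig t"
    "x = sum f S" "A x = (\<Sum>t\<in>S. (1 / t) *\<^sub>R f t)" using Eig_decomposition_A by blast
  have n: "(norm x)\<^sup>2 = (\<Sum>t\<in>S. 1 * (norm (f t))\<^sup>2)"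
    using inner_sum_eigenvectors[OF S(1,3), of "\<lambda>_. 1"] by (simp add: S(4) power2_norm_eq_inner)
  have a: "inner (A x) x = (\<Sum>t\<in>S. (1 / t) * (norm (f t))\<^sup>2)"
    using inner_sum_eigenvectors[OF S(1,3), of "\<lambda>t. 1 / t"] S(4,5) by simp
  have lt: "1 / \<tau> < 1 / t" if "t \<in> S" for t
    using I[of t] that S(2) by (intro divide_strict_left_mono) auto
  obtain t0 where t0: "t0 \<in> S" "f t0 \<noteq> 0" using x(2) S(4) by (meson sum.neutral)
  have "(\<Sum>t\<in>S. (1 / \<tau>) * (norm (f t))\<^sup>2) < (\<Sum>t\<in>S. (1 / t) * (norm (f t))\<^sup>2)"
  proof (rule sum_strict_mono_ex1[OF S(1)])
    show "\<forall>t\<in>S. (1 / \<tau>) * (norm (f t))\<^sup>2 \<le> (1 / t) * (norm (f t))\<^sup>2"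
      using lt by (intro ballI mult_right_mono) (auto intro: less_imp_le)
    show "\<exists>t\<in>S. (1 / \<tau>) * (norm (f t))\<^sup>2 < (1 / t) * (norm (f t))\<^sup>2"
      using lt[OF t0(1)] t0 by (intro bexI[of _ t0] mult_strict_right_mono) auto
  qed
  then show ?thesis unfolding n a by (simp only: sum_distrib_left mult_1)
qed

lemma cdim_Eig:
  assumes "finite S" "\<And>t. t \<in> S \<Longrightarrow> cfinite_dim (eig t)"
  shows "cfinite_dim (Eig S) \<and> cdim (Eig S) = (\<Sum>t\<in>S. cdim (eig t))"
  using assms
proof (induction S rule: finite_induct)
  case empty
  have "complex_vector.dim ({} :: 'a set) = 0"
    using complex_vector.dim_eq_card_independent[OF complex_vector.independent_empty] by simp
  then have "cdim (cspan {} :: 'a set) = 0" by (simp only: complex_vector.dim_span)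
  then show ?case by (auto simp: Eig_def cfinite_dim_def intro!: exI[of _ "{}"])
next
  case (insert t S)
  let ?E = "eig t"
  obtain B where B: "finite B" "B \<subseteq> ?E" "\<not> complex_vector.dependent B" "cspan B = ?E" "card B = cdim ?E"
    using cfinite_dim_basis[OF csubspace_eigenspace insert.prems[of t]] by auto
  obtain C where C: "finite C" "C \<subseteq> Eig S" "\<not> complex_vector.dependent C" "cspan C = Eig S" "card C = cdim (Eig S)"
    using cfinite_dim_basis[OF csubspace_Eig, of S] insert by auto
  have "Eig S \<subseteq> orthocomp ?E"
    unfolding Eig_def
  proof (rule cspan_subset[OF _ csubspace_orthocomp], rule subsetI, rule orthocompI)
    fix x f assume x: "x \<in> (\<Union>s\<in>S. eig s)" and f: "f \<in> ?E"
    then obtain s where "s \<in> S" "x \<in> eig s" by blast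
    then show "cinner f x = 0" using eigenspace_orthogonal[OF f] insert.hyps(2) by metis
  qed
  then have disj: "x = 0" if "x \<in> cspan B" "x \<in> cspan C" for x
    using that orthocompD(1)[of x ?E x] unfolding B(4) C(4) by (auto simp: cinner_self_eq_0)
  have ind: "\<not> complex_vector.dependent (B \<union> C)"
    by (rule independent_Un[OF B(3) C(3) disj])
  have BC: "B \<inter> C = {}"
  proof -
    have "x = 0" if "x \<in> B" "x \<in> C" for x by (rule disj[OF complex_vector.span_base complex_vector.span_base]) (fact that)+
    then have "B \<inter> C \<subseteq> {0}" by blast
    moreover have "0 \<notin> B" using B(3) complex_vector.dependent_zero by blast
    ultimately show ?thesis by blast
  qed
  have span: "cspan (B \<union> C) = Eig (insert t S)"
  proof
    have "B \<union> C \<subseteq> Eig (insert t S)"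
      using B(2) C(2) eigenspace_subset_Eig[of t "insert t S"] Eig_mono[of S "insert t S"] by blast
    then show "cspan (B \<union> C) \<subseteq> Eig (insert t S)" by (intro cspan_subset csubspace_Eig)
    have "?E \<subseteq> cspan (B \<union> C)" using B(4) complex_vector.span_mono[of B "B \<union> C"] by auto
    moreover have "Eig S \<subseteq> cspan (B \<union> C)" using C(4) complex_vector.span_mono[of C "B \<union> C"] by auto
    ultimately show "Eig (insert t S) \<subseteq> cspan (B \<union> C)"
      unfolding Eig_def[of "insert t S"] using eigenspace_subset_Eig[of _ S]
      by (intro cspan_subset csubspace_cspan) blast
  qed
  have "cdim (Eig (insert t S)) = card (B \<union> C)"
    unfolding span[symmetric] by (rule complex_vector.dim_span_eq_card_independent[OF ind])
  also have "\<dots> = cdim ?E + cdim (Eig S)" using B C BC by (simp add: card_Un_disjoint)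
  finally have "cdim (Eig (insert t S)) = cdim ?E + cdim (Eig S)" .
  moreover have "cfinite_dim (Eig (insert t S))"
    unfolding cfinite_dim_def using span B(1) C(1) by (intro exI[of _ "B \<union> C"]) auto
  ultimately show ?case using insert by simp
qed

lemma Eig_nontrivial:
  assumes "S \<subseteq> I" "\<And>t. t \<in> I - S \<Longrightarrow> eig t = {0}"
  shows "Eig I = Eig S"
proof
  show "Eig I \<subseteq> Eig S"
    unfolding Eig_def[of I]
  proof (rule cspan_subset[OF _ csubspace_Eig], rule UN_least)
    fix t assume t: "t \<in> I"
    show "eig t \<subseteq> Eig S"
    proof (cases "t \<in> S")
      case True
      then show ?thesis by (rule eigenspace_subset_Eig)
    next
      case False
      then have "eig t = {0}" using t assms(2) by simp
      then show ?thesis using csubspaceD(1)[OF csubspace_Eig, of S] by simp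
    qed
  qed
qed (rule Eig_mono[OF assms(1)])

section \<open>From discrete spectrum to form bounds\<close>

lemma A_bounded_below_on_orthocomp:
  assumes t: "t \<in> I" "t > 0"
    and disc: "complex_of_real t \<in> spectrum K D T \<Longrightarrow> complex_of_real t \<in> discrete_spectrum K D T"
  shows "\<exists>c>0. \<forall>y\<in>K \<inter> orthocomp (Eig I). c * norm y \<le> norm (A y - (1 / t) *\<^sub>R y)"
proof (cases "complex_of_real t \<in> spectrum K D T")
  case False
  then show ?thesis using resolvent_inverse_iff[of t] t by auto
next
  case True
  then have "complex_of_real t isolated_in spectrum K D T"
    using disc by (simp add: discrete_spectrum_def)
  then obtain e where "e > 0" "\<And>z. z \<in> spectrum K D T \<Longrightarrow> dist z (complex_of_real t) < e \<Longrightarrow> z = complex_of_real t"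
    unfolding isolated_in_dist_Ex_iff by (metis dist_commute)
  from isolated_bounded_below[OF t(2) this] obtain c where c: "c > 0"
    "\<And>y. y \<in> K \<Longrightarrow> y \<in> orthocomp (eig t) \<Longrightarrow> 
      c * norm y \<le> norm (A y - (1 / t) *\<^sub>R y)" by blast
  have "orthocomp (Eig I) \<subseteq> orthocomp (eig t)"
    using eigenspace_subset_Eig[OF t(1)] by (auto simp: orthocomp_def)
  then show ?thesis using c by blast
qed

lemma A_orthocomp_Eig:
  assumes "0 \<notin> I" "y \<in> K \<inter> orthocomp (Eig I)" shows "A y \<in> K \<inter> orthocomp (Eig I)"
proof (intro IntI orthocompI)
  show "A y \<in> K" using assms A_in_K by blast
  fix f assume f: "f \<in> Eig I"
  have "cinner f (A y) = cinner (A f) y" using A_sym[of f y] f assms(2) Eig_in_D D_subset by simp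
  then show "cinner f (A y) = 0" 
    using orthocompD(1)[OF IntD2[OF assms(2)] A_Eig[OF f assms(1)]] by simp
qed

lemma A_orthocomp_Eig':
  "0 \<notin> I \<Longrightarrow> y \<in> K \<Longrightarrow> y \<in> orthocomp (Eig I) \<Longrightarrow> A y \<in> orthocomp (Eig I)"
  using A_orthocomp_Eig by blast

text \<open>On the complement of the eigenvectors \<open>A\<close> has no approximate eigenvalue \<open>\<alpha> \<ge> 1 / \<tau>\<close>, since \<open>1 / \<alpha>\<close> lies
in \<open>(0, \<tau>]\<close> and its eigenspace has been removed.  With \<open>\<tau>\<close> included, the bound is strictly better than
\<open>1 / \<tau>\<close>; this margin is what lets the counting function of \<open>H'\<close> be controlled up to and including \<open>t\<close>.\<close>

lemma form_bound_orthocomp_Eig_closed: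
  assumes \<tau>: "\<tau> > 0" and disc: "\<And>t. 0 < t \<Longrightarrow> t \<le> \<tau> \<Longrightarrow> complex_of_real t \<in> spectrum K D T
    \<Longrightarrow> complex_of_real t \<in> discrete_spectrum K D T"
  shows "\<exists>s<1 / \<tau>. \<forall>y\<in>K \<inter> orthocomp (Eig {0<..\<tau>}). inner (A y) y \<le> s * (norm y)\<^sup>2"
proof -
  obtain C where C: "C > 0" "\<And>y. y \<in> K \<Longrightarrow> norm (A y) \<le> C * norm y" using A_bounded by blast
  show ?thesis
  proof (rule form_bound_if_bounded_below[where C = C])
    fix \<alpha> assume \<alpha>: "\<alpha> \<ge> 1 / \<tau>"
    then have "\<alpha> > 0" using \<tau> by (smt (verit) divide_pos_pos)
    then have "1 / \<alpha> \<in> {0<..\<tau>}" using \<alpha> \<tau> by (simp add: field_simps)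
    then show "\<exists>c>0. \<forall>y\<in>K \<inter> orthocomp (Eig {0<..\<tau>}). c * norm y \<le> norm (A y - \<alpha> *\<^sub>R y)"
      using A_bounded_below_on_orthocomp[of "1 / \<alpha>" "{0<..\<tau>}"] disc[of "1 / \<alpha>"] by auto
  qed (use csubspaceD[OF csubspace_K] csubspaceD[OF csubspace_orthocomp] C in
      \<open>auto simp: A_add A_scaleR A_sym_inner A_in_K A_orthocomp_Eig'\<close>)
qed

lemma form_bound_orthocomp_Eig_open:
  assumes \<tau>: "\<tau> > 0" and disc: "\<And>t. 0 < t \<Longrightarrow> t < \<tau> \<Longrightarrow> complex_of_real t \<in> spectrum K D T
    \<Longrightarrow> complex_of_real t \<in> discrete_spectrum K D T"
    and y: "y \<in> K" "y \<in> orthocomp (Eig {0<..<\<tau>})"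
  shows "inner (A y) y \<le> 1 / \<tau> * (norm y)\<^sup>2"
proof -
  obtain C where C: "C > 0" "\<And>y. y \<in> K \<Longrightarrow> norm (A y) \<le> C * norm y" using A_bounded by blast
  show ?thesis
  proof (rule form_bound_if_bounded_below_weak[where C = C and G = "K \<inter> orthocomp (Eig {0<..<\<tau>})"])
    fix \<alpha> assume \<alpha>: "\<alpha> > 1 / \<tau>"
    then have "\<alpha> > 0" using \<tau> by (smt (verit) divide_pos_pos)
    then have "1 / \<alpha> \<in> {0<..<\<tau>}" using \<alpha> \<tau> by (simp add: field_simps)
    then show "\<exists>c>0. \<forall>y\<in>K \<inter> orthocomp (Eig {0<..<\<tau>}). c * norm y \<le> norm (A y - \<alpha> *\<^sub>R y)"
      using A_bounded_below_on_orthocomp[of "1 / \<alpha>" "{0<..<\<tau>}"] disc[of "1 / \<alpha>"] by auto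
  qed (use csubspaceD[OF csubspace_K] csubspaceD[OF csubspace_orthocomp] C y in
      \<open>auto simp: A_add A_scaleR A_sym_inner A_in_K A_orthocomp_Eig'\<close>)
qed

text \<open>The bounded inverse keeps the spectrum away from \<open>0\<close>, so an infinite set of spectral points would
accumulate at a point of \<open>(0, \<tau>]\<close>.  That point lies in the closed spectrum without being isolated.\<close>

lemma finite_spectrum_if_discrete:
  assumes disc: "\<And>t. 0 < t \<Longrightarrow> t \<le> \<tau> \<Longrightarrow> complex_of_real t \<in> spectrum K D T
    \<Longrightarrow> complex_of_real t \<in> discrete_spectrum K D T"
  shows "finite {t. 0 < t \<and> t \<le> \<tau> \<and> complex_of_real t \<in> spectrum K D T}" (is "finite ?S")
proof (rule ccontr)
  assume inf: "infinite ?S"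
  obtain \<epsilon> where \<epsilon>: "\<epsilon> > 0" "\<And>t :: real. \<bar>t\<bar> < \<epsilon> \<Longrightarrow> complex_of_real t \<notin> spectrum K D T"
    using spectrum_gap by blast
  have "?S \<subseteq> {\<epsilon>..\<tau>}"
  proof
    fix t assume t: "t \<in> ?S"
    then show "t \<in> {\<epsilon>..\<tau>}" using \<epsilon>(2)[of t] by fastforce
  qed
  then obtain t where t: "t \<in> {\<epsilon>..\<tau>}" "t islimpt ?S"
    using Heine_Borel_imp_Bolzano_Weierstrass[of "{\<epsilon>..\<tau>}" ?S] inf by auto
  have "closed (complex_of_real -` spectrum K D T)"
    by (intro closed_vimage closed_spectrum continuous_intros)
  moreover have "t islimpt (complex_of_real -` spectrum K D T)"
    by (rule islimpt_subset[OF t(2)]) auto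
  ultimately have "t \<in> complex_of_real -` spectrum K D T" unfolding closed_limpt by blast
  then have "complex_of_real t \<in> discrete_spectrum K D T" using disc t(1) \<epsilon>(1) by auto
  then have "complex_of_real t isolated_in spectrum K D T" by (simp add: discrete_spectrum_def)
  then obtain e where e: "e > 0" "\<And>z. z \<in> spectrum K D T \<Longrightarrow> dist (complex_of_real t) z < e \<Longrightarrow> z = complex_of_real t"
    unfolding isolated_in_dist_Ex_iff by metis
  obtain t' where t': "t' \<in> ?S" "t' \<noteq> t" "dist t' t < e" using t(2) e(1) unfolding islimpt_approachable by blast
  have "dist (complex_of_real t) (complex_of_real t') = dist t' t"
    by (simp add: dist_norm norm_minus_commute flip: of_real_diff)
  then show False using e(2)[of "complex_of_real t'"] t' by simp
qed

section \<open>From form bounds to discrete spectrum\<close>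

context
  fixes F :: "'a set" and s :: real
  assumes F: "csubspace F" "cfinite_dim F" "F \<subseteq> K" and s: "s > 0"
    and form: "\<And>y. y \<in> K \<Longrightarrow> y \<in> orthocomp F \<Longrightarrow> inner (A y) y \<le> s * (norm y)\<^sup>2"
begin

text \<open>Approximate eigenvectors \<open>u n\<close> for \<open>\<alpha> = 1 / t > s\<close> have a subsequence along which the components in \<open>F\<close>
converge.  On \<open>F\<^sup>\<bottom>\<close> the form of \<open>\<alpha> - A\<close> is at least \<open>\<alpha> - s\<close>, which controls the remaining components (the
estimate \<open>est\<close>).  So the subsequence is Cauchy and its limit is an eigenvector.\<close>

lemma eigenvalue_if_form_bound:
  assumes t: "0 < t" "t < 1 / s" and spec: "complex_of_real t \<in> spectrum K D T"
  shows "eig t \<noteq> {0}"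
proof -
  define \<alpha> where "\<alpha> = 1 / t"
  have \<alpha>: "\<alpha> > s" using t s by (simp add: \<alpha>_def field_simps)
  have \<alpha>0: "\<alpha> > 0" using \<alpha> s by linarith
  obtain C where C: "C > 0" "\<And>y. y \<in> K \<Longrightarrow> norm (A y) \<le> C * norm y" using A_bounded by blast
  have clF: "closed_csubspace F" by (rule closed_csubspace_cfinite_dim[OF F(1,2)])
  define L where "L = (\<lambda>y. A y - \<alpha> *\<^sub>R y)"
  have L_diff: "L (x - y) = L x - L y" if "x \<in> K" "y \<in> K" for x y
    using that by (simp add: L_def A_diff algebra_simps)
  have "\<exists>u. u \<in> K \<and> norm u = 1 \<and> norm (L u) < 1 / real (Suc n)" for n
  proof -
    have "\<not> (\<exists>c>0. \<forall>y\<in>K. c * norm y \<le> norm (A y - (1 / t) *\<^sub>R y))"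
      using spec resolvent_inverse_iff[of t] t by simp
    then have "\<not> (\<forall>y\<in>K. 1 / real (Suc n) * norm y \<le> norm (A y - (1 / t) *\<^sub>R y))"
      using zero_less_divide_1_iff[of "real (Suc n)"] of_nat_0_less_iff[of "Suc n"] by blast
    then obtain y where y: "y \<in> K" "norm (L y) < 1 / real (Suc n) * norm y"
      by (auto simp: L_def \<alpha>_def not_le)
    then have ny: "norm y > 0" by (smt (verit) mult_nonneg_nonneg norm_ge_zero zero_le_divide_1_iff of_nat_0_le_iff mult_eq_0_iff)
    define u where "u = (1 / norm y) *\<^sub>R y"
    have uK: "u \<in> K" unfolding u_def by (rule csubspaceD(5)[OF csubspace_K y(1)])
    have "L u = (1 / norm y) *\<^sub>R L y" using y(1) by (simp add: L_def u_def A_scaleR algebra_simps)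
    then have "norm (L u) = norm (L y) / norm y" by simp
    also have "\<dots> < 1 / real (Suc n)" using y(2) ny by (simp only: pos_divide_less_eq)
    finally show ?thesis using uK ny by (intro exI[of _ u]) (auto simp: u_def)
  qed
  then obtain u where u: "\<And>n. u n \<in> K" "\<And>n. norm (u n) = 1" "\<And>n. norm (L (u n)) < 1 / real (Suc n)"
    by metis
  obtain r where r: "strict_mono r" "convergent (\<lambda>n. orth_proj F (u (r n)))"
    using bounded_sequence_projection_convergent[OF F(1,2), of u 1] u(2) by auto
  define v where "v = (\<lambda>n. u (r n))"
  have vK: "v n \<in> K" for n using u(1) by (simp add: v_def)
  have "(\<lambda>n. L (u n)) \<longlonglongrightarrow> 0"
  proof (rule Lim_null_comparison)
    show "\<forall>\<^sub>F n in sequentially. norm (L (u n)) \<le> inverse (real (Suc n))"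
      using u(3) by (intro always_eventually allI) (simp add: inverse_eq_divide less_imp_le)
  qed (rule LIMSEQ_inverse_real_of_nat)
  from LIMSEQ_subseq_LIMSEQ[OF this r(1)] have Lv: "(\<lambda>n. L (v n)) \<longlonglongrightarrow> 0" by (simp add: v_def o_def)
  define M where "M = (1 + \<alpha> + C) / (\<alpha> - s) + 1"
  have M: "M > 0" using \<alpha> \<alpha>0 C(1) by (auto simp: M_def intro!: add_pos_pos divide_pos_pos)
  \<comment> \<open>\<open>L\<close> and the projection onto \<open>F\<close> together are bounded below\<close>
  have est: "norm y \<le> M * (norm (L y) + norm (orth_proj F y))" if y: "y \<in> K" for y
  proof -
    define f where "f = orth_proj F y"
    define g where "g = y - f"
    have fK: "f \<in> K" using orth_proj_in[OF clF, of y] F(3) by (auto simp: f_def)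
    have gK: "g \<in> K" unfolding g_def by (rule csubspaceD(3)[OF csubspace_K y fK])
    have "g \<in> orthocomp F" unfolding g_def f_def by (rule orth_proj_orth[OF clF])
    then have "(\<alpha> - s) * (norm g)\<^sup>2 \<le> inner (- L g) g"
      using form[OF gK] by (simp add: L_def inner_diff_left power2_norm_eq_inner algebra_simps)
    also have "\<dots> \<le> norm (L g) * norm g" using norm_cauchy_schwarz[of "- L g" g] by simp
    finally have 1: "(\<alpha> - s) * norm g \<le> norm (L g)"
      by (cases "g = 0") (auto simp: power2_eq_square)
    have "L g = L y - L f" unfolding g_def by (rule L_diff[OF y fK])
    then have "norm (L g) \<le> norm (L y) + norm (L f)" using norm_triangle_ineq4 by metis
    moreover have "norm (L f) \<le> (\<alpha> + C) * norm f"
      using norm_triangle_ineq4[of "A f" "\<alpha> *\<^sub>R f"] C(2)[OF fK] \<alpha>0 by (simp add: L_def algebra_simps)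
    ultimately have "(\<alpha> - s) * norm g \<le> norm (L y) + (\<alpha> + C) * norm f" using 1 by linarith
    also have "\<dots> \<le> (1 + \<alpha> + C) * (norm (L y) + norm f)"
      using \<alpha>0 C(1) by (simp add: algebra_simps)
    finally have "norm g \<le> (1 + \<alpha> + C) / (\<alpha> - s) * (norm (L y) + norm f)"
      using \<alpha> by (simp add: field_simps)
    moreover have "norm y \<le> norm g + norm f" unfolding g_def using norm_triangle_ineq[of "y - f" f] by simp
    moreover have "norm f \<le> norm (L y) + norm f" by simp
    ultimately have "norm y \<le> (1 + \<alpha> + C) / (\<alpha> - s) * (norm (L y) + norm f) + (norm (L y) + norm f)"
      by linarith
    then show ?thesis unfolding M_def f_def[symmetric] by (simp only: distrib_right mult_1)
  qed
  have "Cauchy v"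
  proof (rule metric_CauchyI)
    fix e :: real assume e: "e > 0"
    have e': "e / (2 * M) > 0" using e M by simp
    obtain N1 where N1: "\<And>m n. m \<ge> N1 \<Longrightarrow> n \<ge> N1 \<Longrightarrow> dist (L (v m)) (L (v n)) < e / (2 * M)"
      using metric_CauchyD[OF LIMSEQ_imp_Cauchy[OF Lv] e'] by blast
    have "Cauchy (\<lambda>n. orth_proj F (v n))" using r(2) convergent_Cauchy by (simp add: v_def)
    then obtain N2 where N2: "\<And>m n. m \<ge> N2 \<Longrightarrow> n \<ge> N2 \<Longrightarrow> dist (orth_proj F (v m)) (orth_proj F (v n)) < e / (2 * M)"
      using metric_CauchyD[OF _ e'] by blast
    have "dist (v m) (v n) < e" if "m \<ge> max N1 N2" "n \<ge> max N1 N2" for m n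
    proof -
      have "norm (v m - v n) \<le> M * (norm (L (v m) - L (v n)) + norm (orth_proj F (v m) - orth_proj F (v n)))"
        using est[OF csubspaceD(3)[OF csubspace_K vK vK], of m n]
        by (simp add: L_diff[OF vK vK] orth_proj_diff[OF clF])
      also have "\<dots> < M * (e / (2 * M) + e / (2 * M))"
        using N1[of m n] N2[of m n] that M by (intro mult_strict_left_mono add_strict_mono) (auto simp: dist_norm)
      also have "\<dots> = e" using M by (simp add: field_simps)
      finally show ?thesis by (simp add: dist_norm)
    qed
    then show "\<exists>N. \<forall>m\<ge>N. \<forall>n\<ge>N. dist (v m) (v n) < e" by blast
  qed
  then obtain l where l: "v \<longlonglongrightarrow> l" using Cauchy_convergent convergent_def by blast
  have cK: "closed K" using closed_K by (simp add: closed_csubspace_def)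
  have lK: "l \<in> K" using closed_sequentially[OF cK _ l] vK by blast
  have "norm l = 1" using tendsto_norm[OF l] u(2) by (simp add: v_def LIMSEQ_const_iff)
  have "(\<lambda>n. A (v n)) \<longlonglongrightarrow> A l"
  proof (rule Lim_null_comparison[THEN LIM_zero_cancel])
    show "\<forall>\<^sub>F n in sequentially. norm (A (v n) - A l) \<le> C * norm (v n - l)"
      using C(2)[OF csubspaceD(3)[OF csubspace_K vK lK]] by (intro always_eventually allI) (simp add: A_diff vK lK)
    show "(\<lambda>n. C * norm (v n - l)) \<longlonglongrightarrow> 0"
      using tendsto_mult_left[OF tendsto_norm[OF LIM_zero[OF l]], of C] by simp
  qed
  then have "(\<lambda>n. L (v n)) \<longlonglongrightarrow> A l - \<alpha> *\<^sub>R l"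
    unfolding L_def by (intro tendsto_intros l)
  then have "A l = (1 / t) *\<^sub>R l" using LIMSEQ_unique[OF Lv, of "A l - \<alpha> *\<^sub>R l"] by (simp add: \<alpha>_def)
  then have "l \<in> eig t" using lK t by (subst eigenspace_iff_inverse) auto
  moreover have "l \<noteq> 0" using \<open>norm l = 1\<close> by auto
  ultimately show ?thesis by blast
qed

text \<open>On \<open>Eig {0<..<1 / s}\<close> the form exceeds \<open>s\<close>, on \<open>F\<^sup>\<bottom>\<close> it does not, so the two meet in \<open>0\<close> only.\<close>

lemma cdim_Eig_le:
  "cfinite_dim (Eig {0<..<1 / s})" "cdim (Eig {0<..<1 / s}) \<le> cdim F"
proof -
  have "x = 0" if x: "x \<in> Eig {0<..<1 / s}" "x \<in> orthocomp F" for x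
  proof (rule ccontr)
    assume "x \<noteq> 0"
    then have "inner (A x) x > s * (norm x)\<^sup>2" using Eig_form[OF x(1), of "1 / s"] by simp
    then show False using form[OF D_subset[OF Eig_in_D[OF x(1)]] x(2)] by simp
  qed
  from cdim_le_if_disjoint_orthocomp[OF csubspace_Eig F(1,2) this]
  show "cfinite_dim (Eig {0<..<1 / s})" "cdim (Eig {0<..<1 / s}) \<le> cdim F" by blast+
qed

lemma cfinite_dim_eigenspace_if_form_bound:
  "0 < t \<Longrightarrow> t < 1 / s \<Longrightarrow> cfinite_dim (eig t)"
  by (rule cfinite_dim_subset[OF cdim_Eig_le(1) eigenspace_subset_Eig]) simp

lemma finite_eigenvalues_if_form_bound:
  "finite {t. 0 < t \<and> t < 1 / s \<and> eig t \<noteq> {0}}"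
proof (rule finite_if_finite_subsets_card_bdd[THEN conjunct1])
  fix S assume S: "S \<subseteq> {t. 0 < t \<and> t < 1 / s \<and> eig t \<noteq> {0}}" "finite S"
  have fd: "cfinite_dim (eig t)" if "t \<in> S" for t
    using cfinite_dim_eigenspace_if_form_bound that S(1) by blast
  have "1 \<le> cdim (eig t)" if t: "t \<in> S" for t
  proof (rule ccontr)
    assume 0: "\<not> 1 \<le> cdim (eig t)"
    obtain B where B: "finite B" "cspan B = eig t"
      "card B = cdim (eig t)"
      using cfinite_dim_basis[OF csubspace_eigenspace fd[OF t]] by metis
    have "card B = 0" using B(3) 0 by linarith
    then have "B = {}" using B(1) by simp
    then have "eig t = {0}" using B(2) by simp
    then show False using S(1) t by blast
  qed
  then have "card S \<le> (\<Sum>t\<in>S. cdim (eig t))"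
    using sum_mono[of S "\<lambda>_. 1 :: nat" "\<lambda>t. cdim (eig t)"] by simp
  also have "\<dots> = cdim (Eig S)" using cdim_Eig[OF S(2) fd] by simp
  also have "\<dots> \<le> cdim (Eig {0<..<1 / s})"
    by (rule cdim_mono[OF Eig_mono cdim_Eig_le(1)]) (use S(1) in auto)
  also have "\<dots> \<le> cdim F" by (rule cdim_Eig_le)
  finally show "card S \<le> cdim F" .
qed

lemma discrete_if_form_bound:
  assumes t: "0 < t" "t < 1 / s" and spec: "complex_of_real t \<in> spectrum K D T"
  shows "complex_of_real t \<in> discrete_spectrum K D T"
proof -
  define E where "E = {t. 0 < t \<and> t < 1 / s \<and> eig t \<noteq> {0}}"
  have "finite E" unfolding E_def by (rule finite_eigenvalues_if_form_bound)
  then have cl: "closed (complex_of_real ` (E - {t}))" by (simp add: finite_imp_closed)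
  define O' where "O' = {z. 0 < Re z \<and> Re z < 1 / s} - complex_of_real ` (E - {t})"
  have "open O'" unfolding O'_def
    by (intro open_Diff cl open_Collect_conj open_Collect_less continuous_intros)
  moreover have "O' \<inter> spectrum K D T = {complex_of_real t}"
  proof (intro equalityI subsetI)
    fix z assume z: "z \<in> O' \<inter> spectrum K D T"
    then have im: "Im z = 0" using nonreal_notin_spectrum by blast
    then have zr: "z = complex_of_real (Re z)" by (simp add: complex_eq_iff)
    have "0 < Re z" "Re z < 1 / s" using z by (auto simp: O'_def)
    moreover have "complex_of_real (Re z) \<in> spectrum K D T" using z zr by auto
    ultimately have "Re z \<in> E" unfolding E_def using eigenvalue_if_form_bound by blast
    then show "z \<in> {complex_of_real t}" using z zr by (auto simp: O'_def)
  next
    fix z assume "z \<in> {complex_of_real t}"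
    then show "z \<in> O' \<inter> spectrum K D T" using t spec by (auto simp: O'_def)
  qed
  ultimately have "complex_of_real t isolated_in spectrum K D T" using spec unfolding isolated_in_def by blast
  then show ?thesis unfolding discrete_spectrum_def
    using eigenvalue_if_form_bound[OF t spec] cfinite_dim_eigenspace_if_form_bound[OF t] by blast
qed

end

end

section \<open>Enumerating eigenvalues with multiplicity\<close>

text \<open>The \<open>j\<close>-th entry is the point \<open>t\<close> at which the counting function passes \<open>j\<close>, that is,
\<open>below t < j \<le> upto t\<close>.\<close>

lemma enumerate_with_multiplicity:
  fixes I :: "real set" and m :: "real \<Rightarrow> nat"
  assumes fin: "\<And>t. t \<in> I \<Longrightarrow> finite {s \<in> I. s \<le> t \<and> m s \<noteq> 0}"
  shows "\<exists>L lam. initial_segment L \<and> lam ` L \<subseteq> I \<and> mono_on L lam \<and>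
    (\<forall>t\<in>I. finite {k \<in> L. lam k = t} \<and> card {k \<in> L. lam k = t} = m t)"
proof -
  define E where "E = {t \<in> I. m t \<noteq> 0}"
  define below where "below = (\<lambda>t. \<Sum>s\<in>{s \<in> E. s < t}. m s)"
  define upto where "upto = (\<lambda>t. \<Sum>s\<in>{s \<in> E. s \<le> t}. m s)"
  have fin_le: "finite {s \<in> E. s \<le> t}" if "t \<in> E" for t
    by (rule finite_subset[OF _ fin[of t]]) (use that in \<open>auto simp: E_def\<close>)
  have fin_lt: "finite {s \<in> E. s < t}" if "t \<in> E" for t
    by (rule finite_subset[OF _ fin_le[OF that]]) auto
  have upto: "upto t = below t + m t" if t: "t \<in> E" for t
  proof -
    have "{s \<in> E. s \<le> t} = insert t {s \<in> E. s < t}" using t by auto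
    then show ?thesis using fin_lt[OF t] by (simp add: upto_def below_def)
  qed
  have upto_below: "upto s \<le> below t" if "s < t" "t \<in> E" for s t
    unfolding upto_def below_def by (rule sum_mono2[OF fin_lt[OF that(2)]]) (use that in auto)
  define L where "L = {j. 1 \<le> j \<and> (\<exists>t\<in>E. j \<le> upto t)}"
  have ex: "\<exists>t\<in>E. below t < j \<and> j \<le> upto t" if j: "j \<in> L" for j
  proof -
    obtain t0 where t0: "t0 \<in> E" "j \<le> upto t0" using j by (auto simp: L_def)
    define X where "X = {s \<in> E. s \<le> t0 \<and> j \<le> upto s}"
    have "X \<subseteq> {s \<in> E. s \<le> t0}" by (auto simp: X_def)
    then have X: "finite X" using fin_le[OF t0(1)] by (rule finite_subset)
    have X': "X \<noteq> {}" using t0 by (auto simp: X_def)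
    define t where "t = Min X"
    have tX: "t \<in> X" unfolding t_def using X X' by (rule Min_in)
    then have t: "t \<in> E" "t \<le> t0" "j \<le> upto t" by (auto simp: X_def)
    have "below t < j"
    proof (rule ccontr)
      assume "\<not> below t < j"
      then have jt: "j \<le> below t" by simp
      define Y where "Y = {s \<in> E. s < t}"
      have "below t \<noteq> 0" using jt j by (auto simp: L_def)
      then have Y: "finite Y" "Y \<noteq> {}" using fin_lt[OF t(1)] unfolding Y_def below_def by force+
      define s where "s = Max Y"
      have s: "s \<in> Y" unfolding s_def using Y by (rule Max_in)
      have "{u \<in> E. u \<le> s} = {u \<in> E. u < t}"
      proof (intro equalityI subsetI)
        fix u assume "u \<in> {u \<in> E. u \<le> s}" then show "u \<in> {u \<in> E. u < t}" using s by (auto simp: Y_def)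
      next
        fix u assume u: "u \<in> {u \<in> E. u < t}"
        then show "u \<in> {u \<in> E. u \<le> s}" using Max_ge[OF Y(1), of u] by (auto simp: s_def Y_def)
      qed
      then have "upto s = below t" by (simp add: upto_def below_def)
      then have "s \<in> X" using s jt t(2) by (auto simp: X_def Y_def)
      then have "t \<le> s" unfolding t_def using X by simp
      then show False using s by (simp add: Y_def)
    qed
    then show ?thesis using t by blast
  qed
  define lam where "lam = (\<lambda>j. SOME t. t \<in> E \<and> below t < j \<and> j \<le> upto t)"
  have lam: "lam j \<in> E" "below (lam j) < j" "j \<le> upto (lam j)" if "j \<in> L" for j
    using someI_ex[of "\<lambda>t. t \<in> E \<and> below t < j \<and> j \<le> upto t"] ex[OF that] unfolding lam_def by blast+
  have le: "lam i \<le> t" if "i \<in> L" "t \<in> E" "i \<le> upto t" for i t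
  proof (rule ccontr)
    assume "\<not> lam i \<le> t"
    then have "upto t \<le> below (lam i)" using upto_below lam(1)[OF that(1)] by simp
    then show False using lam(2)[OF that(1)] that(3) by simp
  qed
  have ge: "t \<le> lam i" if "i \<in> L" "t \<in> E" "below t < i" for i t
  proof (rule ccontr)
    assume "\<not> t \<le> lam i"
    then have "upto (lam i) \<le> below t" using upto_below that(2) by simp
    then show False using lam(3)[OF that(1)] that(3) by simp
  qed
  have "initial_segment L" by (force simp: initial_segment_def L_def)
  moreover have "lam ` L \<subseteq> I" using lam(1) by (auto simp: E_def)
  moreover have "mono_on L lam"
  proof (rule mono_onI)
    fix i j assume ij: "i \<in> L" "j \<in> L" "i \<le> j"
    show "lam i \<le> lam j" by (rule le[OF ij(1) lam(1)[OF ij(2)]]) (use lam(3)[OF ij(2)] ij(3) in simp)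
  qed
  moreover have "finite {k \<in> L. lam k = t} \<and> card {k \<in> L. lam k = t} = m t" if t: "t \<in> I" for t
  proof (cases "t \<in> E")
    case True
    have "{k \<in> L. lam k = t} = {below t<..upto t}"
    proof (intro equalityI subsetI)
      fix k assume "k \<in> {k \<in> L. lam k = t}" then show "k \<in> {below t<..upto t}" using lam(2,3) by auto
    next
      fix k assume k: "k \<in> {below t<..upto t}"
      then have "k \<in> L" using True by (auto simp: L_def)
      then show "k \<in> {k \<in> L. lam k = t}" using le[of k t] ge[of k t] True k by auto
    qed
    then show ?thesis using upto[OF True] by simp
  next
    case False
    then have "{k \<in> L. lam k = t} = {}" using lam(1) by auto
    moreover have "m t = 0" using False t by (simp add: E_def)
    ultimately show ?thesis by (simp only: finite.emptyI card.empty simp_thms)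
  qed
  ultimately show ?thesis by blast
qed

context invertible_selfadjoint
begin

lemma cfinite_dim_eigenspace_if_discrete:
  assumes "z \<in> spectrum K D T \<Longrightarrow> z \<in> discrete_spectrum K D T"
  shows "cfinite_dim (eigenspace D T z)"
proof (cases "z \<in> spectrum K D T")
  case True
  then show ?thesis using assms by (simp add: discrete_spectrum_def)
next
  case False
  then have "eigenspace D T z = {0}" using eigenvalue_in_spectrum[of z] by argo
  moreover have "cfinite_dim {0 :: 'a}"
    unfolding cfinite_dim_def by (rule exI[of _ "{}"]) simp
  ultimately show ?thesis by simp
qed

lemma finite_eigenvalues_if_discrete:
  assumes "\<And>t. 0 < t \<Longrightarrow> t \<le> \<tau> \<Longrightarrow> complex_of_real t \<in> spectrum K D T
    \<Longrightarrow> complex_of_real t \<in> discrete_spectrum K D T"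
  shows "finite {t. 0 < t \<and> t \<le> \<tau> \<and> eig t \<noteq> {0}}"
  by (rule finite_subset[OF _ finite_spectrum_if_discrete[OF assms]]) (auto intro: eigenvalue_in_spectrum)

lemma cdim_Eig_eq_sum:
  assumes I: "I \<subseteq> {0<..\<tau>}"
    and disc: "\<And>t. 0 < t \<Longrightarrow> t \<le> \<tau> \<Longrightarrow> complex_of_real t \<in> spectrum K D T
    \<Longrightarrow> complex_of_real t \<in> discrete_spectrum K D T"
  defines "S \<equiv> {t \<in> I. eig t \<noteq> {0}}"
  shows "finite S" "cfinite_dim (Eig I)" "cdim (Eig I) = (\<Sum>t\<in>S. cdim (eig t))"
proof -
  show fin: "finite S"
    by (rule finite_subset[OF _ finite_eigenvalues_if_discrete[OF disc]]) (use I in \<open>auto simp: S_def\<close>)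
  have eq: "Eig I = Eig S" by (rule Eig_nontrivial) (auto simp: S_def)
  have fd: "cfinite_dim (eig t)" if "t \<in> S" for t
    by (rule cfinite_dim_eigenspace_if_discrete, rule disc) (use that I in \<open>auto simp: S_def\<close>)
  from cdim_Eig[OF fin fd]
  show "cfinite_dim (Eig I)" "cdim (Eig I) = (\<Sum>t\<in>S. cdim (eig t))"
    unfolding eq by blast+
qed

lemma cdim_trivial_eigenspace: "cdim {0 :: 'a} = 0"
proof -
  have "cdim (cspan {} :: 'a set) = 0"
    using complex_vector.dim_eq_card_independent[OF complex_vector.independent_empty]
    by (simp only: complex_vector.dim_span card.empty)
  then show ?thesis by simp
qed

text \<open>Counting members of an eigenvalue family turns into counting dimensions, which is what the form
estimates control.\<close>

lemma card_eigenvalue_family: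
  assumes I: "I' \<subseteq> I" "I' \<subseteq> {0<..\<tau>}"
    and disc: "\<And>t. 0 < t \<Longrightarrow> t \<le> \<tau> \<Longrightarrow> complex_of_real t \<in> spectrum K D T
      \<Longrightarrow> complex_of_real t \<in> discrete_spectrum K D T"
    and fam: "eigenvalue_family D T I L lam"
  shows "finite {l \<in> L. lam l \<in> I'}" "card {l \<in> L. lam l \<in> I'} = cdim (Eig I')"
proof -
  define S where "S = {t \<in> I'. eig t \<noteq> {0}}"
  note dim = cdim_Eig_eq_sum[OF I(2) disc, folded S_def]
  have fam': "finite {l \<in> L. lam l = t}" 
    "card {l \<in> L. lam l = t} = cdim (eig t)" if "t \<in> I'" for t
    using fam that I(1) unfolding eigenvalue_family_def Let_def by blast+
  have eq: "{l \<in> L. lam l \<in> I'} = (\<Union>t\<in>S. {l \<in> L. lam l = t})"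
  proof (intro equalityI subsetI)
    fix l assume l: "l \<in> {l \<in> L. lam l \<in> I'}"
    have "lam l \<in> S"
    proof (rule ccontr)
      assume "lam l \<notin> S"
      then have "eig (lam l) = {0}" using l by (simp add: S_def)
      then have "card {k \<in> L. lam k = lam l} = 0" using fam'(2)[of "lam l"] l cdim_trivial_eigenspace by simp
      then show False using fam'(1)[of "lam l"] l by auto
    qed
    then show "l \<in> (\<Union>t\<in>S. {l \<in> L. lam l = t})" using l by blast
  qed (auto simp: S_def)
  show "finite {l \<in> L. lam l \<in> I'}"
    unfolding eq using dim(1) fam'(1) by (intro finite_UN_I) (auto simp: S_def)
  have "card {l \<in> L. lam l \<in> I'} = (\<Sum>t\<in>S. card {l \<in> L. lam l = t})"
    unfolding eq using dim(1) fam'(1) by (intro card_UN_disjoint) (auto simp: S_def)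
  also have "\<dots> = (\<Sum>t\<in>S. cdim (eig t))"
    by (rule sum.cong[OF refl], rule fam'(2)) (simp add: S_def)
  also have "\<dots> = cdim (Eig I')" by (rule dim(3)[symmetric])
  finally show "card {l \<in> L. lam l \<in> I'} = cdim (Eig I')" .
qed

lemma eigenvalue_family_exists:
  fixes a :: ereal
  assumes disc: "\<And>t. 0 < t \<Longrightarrow> ereal t < a \<Longrightarrow> complex_of_real t \<in> spectrum K D T
    \<Longrightarrow> complex_of_real t \<in> discrete_spectrum K D T"
  shows "\<exists>L lam. initial_segment L \<and> eigenvalue_family D T {t. 0 < t \<and> ereal t < a} L lam"
proof -
  define I where "I = {t. 0 < t \<and> ereal t < a}"
  define m where "m = (\<lambda>t. cdim (eig t))"
  have fin: "finite {s \<in> I. s \<le> t \<and> m s \<noteq> 0}" if t: "t \<in> I" for t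
  proof (rule finite_subset[OF _ finite_eigenvalues_if_discrete])
    show "{s \<in> I. s \<le> t \<and> m s \<noteq> 0} \<subseteq> {s. 0 < s \<and> s \<le> t \<and> eig s \<noteq> {0}}"
    proof (intro subsetI CollectI conjI notI)
      fix s assume s: "s \<in> {s \<in> I. s \<le> t \<and> m s \<noteq> 0}"
      then show "0 < s" "s \<le> t" by (auto simp: I_def)
      assume "eig s = {0}"
      then have "m s = 0" by (simp only: m_def cdim_trivial_eigenspace)
      then show False using s by simp
    qed
    fix s assume "0 < s" "s \<le> t" "complex_of_real s \<in> spectrum K D T"
    then show "complex_of_real s \<in> discrete_spectrum K D T"
      using t le_less_trans[of "ereal s" "ereal t" a] by (intro disc) (simp_all add: I_def)
  qed
  obtain L lam where L: "initial_segment L" "lam ` L \<subseteq> I" "mono_on L lam"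
    "\<forall>t\<in>I. finite {k \<in> L. lam k = t} \<and> card {k \<in> L. lam k = t} = m t"
  proof -
    have "\<exists>L lam. initial_segment L \<and> lam ` L \<subseteq> I \<and> mono_on L lam \<and>
        (\<forall>t\<in>I. finite {k \<in> L. lam k = t} \<and> card {k \<in> L. lam k = t} = m t)"
      by (rule enumerate_with_multiplicity) (rule fin)
    then show ?thesis by (elim exE conjE) (rule that)
  qed
  have "cfinite_dim (eig t)" if "t \<in> I" for t
    using that by (intro cfinite_dim_eigenspace_if_discrete disc) (auto simp: I_def)
  then have "eigenvalue_family D T I L lam"
    using L(2-4) unfolding eigenvalue_family_def Let_def m_def by blast
  then show ?thesis using L(1) unfolding I_def by blast
qed

end

section \<open>Relatively bounded perturbations\<close>

locale relatively_bounded_pair =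
  orig: invertible_selfadjoint UNIV Dom H + pert: invertible_selfadjoint UNIV Dom H'
  for Dom :: "'a :: chilbert_space set" and H H' :: "'a \<Rightarrow> 'a" +
  fixes \<eta> :: real
  assumes \<eta>_nonneg: "0 \<le> \<eta>" and \<eta>_less: "\<eta> < 1"
    and rel_bound: "x \<in> Dom \<Longrightarrow> norm (H x - H' x) \<le> \<eta> * norm (H x)"
begin

text \<open>Let \<open>G = F\<^sup>\<bottom>\<close>, let \<open>u \<in> G\<close> be an approximate eigenvector of the compression of \<open>H'\<inverse>\<close> to \<open>G\<close>, and split
\<open>x = H'\<inverse> u\<close> as \<open>g + f\<close> with \<open>g \<in> G\<close> and \<open>f \<in> F\<close>.  As \<open>H\<close> respects the splitting, the relative bound
restricts to \<open>|H g - u| \<le> \<eta> |H g|\<close>.  Approximately \<open>g = \<alpha> u\<close>, so \<open>h = H g\<close> satisfies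
\<open>|\<alpha> h - H\<inverse> h| \<le> \<alpha> \<eta> |h|\<close> up to a small error, whereas the form bound gives
\<open>|\<alpha> h - H\<inverse> h| \<ge> (\<alpha> - s) |h|\<close>.  This is a contradiction if \<open>(1 - \<eta>) \<alpha> > s\<close>.\<close>

lemma perturbed_form_bound:
  assumes F: "closed_csubspace F" "F \<subseteq> Dom" "\<And>x. x \<in> F \<Longrightarrow> H x \<in> F" and s: "s > 0"
    and form: "\<And>y. y \<in> orthocomp F \<Longrightarrow> inner (orig.A y) y \<le> s * (norm y)\<^sup>2"
    and y: "y \<in> orthocomp F"
  shows "inner (pert.A y) y \<le> s / (1 - \<eta>) * (norm y)\<^sup>2"
proof -
  define G where "G = orthocomp F"
  have clG: "closed_csubspace G" unfolding G_def by (rule closed_csubspace_orthocomp)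
  have subG: "csubspace G" unfolding G_def by (rule csubspace_orthocomp)
  have subF: "csubspace F" using F(1) by (simp add: closed_csubspace_def)
  define B where "B = (\<lambda>y. orth_proj G (pert.A y))"
  obtain C where C: "C > 0" "\<And>y. norm (orig.A y) \<le> C * norm y" using orig.A_bounded by auto
  have PF: "x - orth_proj G x \<in> F" for x
    using orth_proj_orth[OF clG, of x] orthocomp_orthocomp[OF F(1)] by (simp add: G_def)
  show ?thesis
  proof (rule pert.compression_form_bound[OF clG subset_UNIV])
    show "y \<in> G" using y by (simp add: G_def)
    fix \<alpha> assume \<alpha>: "\<alpha> > s / (1 - \<eta>)"
    define \<kappa> where "\<kappa> = (1 - \<eta>) * \<alpha> - s"
    have \<kappa>: "\<kappa> > 0" using \<alpha> \<eta>_less by (simp add: \<kappa>_def pos_divide_less_eq mult.commute)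
    have \<alpha>0: "\<alpha> > 0" using \<alpha> s \<eta>_less by (smt (verit) divide_pos_pos)
    \<comment> \<open>with \<open>r\<close> the error, \<open>\<kappa> |h| \<le> |r|\<close> and \<open>\<alpha> |u| \<le> |g| + |r|\<close> with \<open>|g| \<le> C |h|\<close>\<close>
    define c where "c = \<alpha> / (C / \<kappa> + 1)"
    have c: "c > 0" using \<alpha>0 C(1) \<kappa> by (auto simp: c_def intro!: divide_pos_pos add_pos_pos)
    have "c * norm u \<le> norm (B u - \<alpha> *\<^sub>R u)" if u: "u \<in> G" for u
    proof -
      define r where "r = B u - \<alpha> *\<^sub>R u"
      define x where "x = pert.A u"
      define g where "g = B u"
      define h where "h = H g"
      have x: "x \<in> Dom" "H' x = u" by (auto simp: x_def pert.A_in_D pert.T_A)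
      have gG: "g \<in> G" unfolding g_def B_def by (rule orth_proj_in[OF clG])
      have fF: "x - g \<in> F" unfolding g_def B_def x_def by (rule PF)
      have gD: "g \<in> Dom"
        using csubspaceD(3)[OF orig.csubspace_D x(1) subsetD[OF F(2) fF]] by simp
      have hG: "h \<in> G"
        unfolding G_def
      proof (rule orthocompI)
        fix f assume f: "f \<in> F"
        have "cinner f h = cinner (H f) g" unfolding h_def using orig.T_sym[of f g] f F(2) gD by auto
        also have "\<dots> = 0" using orthocompD(1)[of g F] gG F(3)[OF f] by (simp add: G_def)
        finally show "cinner f h = 0" .
      qed
      have HfF: "H (x - g) \<in> F" by (rule F(3)[OF fF])
      have Hx: "H x = h + H (x - g)"
        using orig.T_add[OF gD subsetD[OF F(2) fF]] by (simp add: h_def)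
      \<comment> \<open>the \<open>F\<close>-component of \<open>H x\<close> occurs on both sides of the relative bound and cancels\<close>
      have "(norm (h - u + H (x - g)))\<^sup>2 \<le> (\<eta> * norm (h + H (x - g)))\<^sup>2"
        using rel_bound[OF x(1)] by (intro power_mono) (auto simp: Hx x(2) algebra_simps)
      moreover have "inner (h - u) (H (x - g)) = 0" "inner h (H (x - g)) = 0"
        using orthocompD(4)[of _ F, OF _ HfF] csubspaceD(3)[OF subG hG u] hG by (auto simp: G_def)
      ultimately have "(norm (h - u))\<^sup>2 + (norm (H (x - g)))\<^sup>2 \<le> \<eta>\<^sup>2 * ((norm h)\<^sup>2 + (norm (H (x - g)))\<^sup>2)"
        by (simp add: norm_add_sq power_mult_distrib)
      moreover have "\<eta>\<^sup>2 * (norm (H (x - g)))\<^sup>2 \<le> 1 * (norm (H (x - g)))\<^sup>2"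
        using \<eta>_nonneg \<eta>_less by (intro mult_right_mono power_le_one) auto
      ultimately have "(norm (h - u))\<^sup>2 \<le> (\<eta> * norm h)\<^sup>2" by (simp add: power_mult_distrib algebra_simps)
      then have hu: "norm (h - u) \<le> \<eta> * norm h" by (rule power2_le_imp_le) (use \<eta>_nonneg in simp)
      have Ah: "orig.A h = g" unfolding h_def by (rule orig.A_T[OF gD])
      have "\<alpha> *\<^sub>R h - g = \<alpha> *\<^sub>R (h - u) - r" by (simp add: r_def g_def algebra_simps)
      then have "norm (\<alpha> *\<^sub>R h - g) \<le> \<alpha> * norm (h - u) + norm r"
        using norm_triangle_ineq4[of "\<alpha> *\<^sub>R (h - u)" r] \<alpha>0 by simp
      also have "\<dots> \<le> \<alpha> * (\<eta> * norm h) + norm r" using hu \<alpha>0 by simp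
      finally have up: "norm (\<alpha> *\<^sub>R h - g) \<le> \<alpha> * (\<eta> * norm h) + norm r" .
      have "(\<alpha> - s) * (norm h)\<^sup>2 \<le> inner (\<alpha> *\<^sub>R h - g) h"
        using form[of h] hG by (simp add: Ah G_def inner_diff_left power2_norm_eq_inner algebra_simps)
      also have "\<dots> \<le> norm (\<alpha> *\<^sub>R h - g) * norm h" by (rule norm_cauchy_schwarz)
      finally have "(\<alpha> - s) * norm h \<le> norm (\<alpha> *\<^sub>R h - g)"
        by (cases "h = 0") (auto simp: power2_eq_square)
      with up have "\<kappa> * norm h \<le> norm r" by (simp add: \<kappa>_def algebra_simps)
      then have "norm h \<le> norm r / \<kappa>" using \<kappa> by (simp add: pos_le_divide_eq mult.commute)
      moreover have "norm g \<le> C * norm h" using C(2)[of h] by (simp add: Ah)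
      ultimately have "norm g \<le> C * (norm r / \<kappa>)"
        using mult_left_mono[of "norm h" "norm r / \<kappa>" C] C(1) by linarith
      moreover have "\<alpha> * norm u \<le> norm g + norm r"
      proof -
        have "\<alpha> *\<^sub>R u = g - r" by (simp add: r_def g_def)
        then have "norm (\<alpha> *\<^sub>R u) \<le> norm g + norm r" using norm_triangle_ineq4 by metis
        then show ?thesis using \<alpha>0 by simp
      qed
      ultimately have "\<alpha> * norm u \<le> (C / \<kappa> + 1) * norm r" by (simp add: algebra_simps)
      moreover have "C / \<kappa> + 1 > 0" using C(1) \<kappa> by (auto intro!: add_pos_pos divide_pos_pos)
      ultimately show ?thesis unfolding c_def r_def[symmetric]
        by (simp add: pos_divide_le_eq mult.commute)
    qed
    then show "\<exists>c>0. \<forall>u\<in>G. c * norm u \<le> norm (orth_proj G (pert.A u) - \<alpha> *\<^sub>R u)"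
      unfolding B_def using c by blast
  qed
qed

text \<open>Let \<open>G = F\<^sup>\<bottom>\<close> and let \<open>u \<in> G\<close> be an approximate eigenvector of the compression of \<open>H\<inverse>\<close> to \<open>G\<close>.  Since
\<open>H'\<inverse>\<close> commutes with the projection onto \<open>G\<close>, the projection \<open>v\<close> of \<open>H' H\<inverse> u\<close> satisfies
\<open>H'\<inverse> v = \<alpha> u\<close> up to a small error, and \<open>|u - v| \<le> \<eta> |u|\<close>.  Then \<open>\<langle>H'\<inverse> v, v\<rangle> \<le> s |v|\<^sup>2\<close> reads
\<open>\<alpha> \<langle>u, v\<rangle> \<le> s |v|\<^sup>2\<close>, which bounds \<open>\<alpha>\<close> by \<open>(1 + \<eta>) s\<close>, the extreme case being \<open>v = (1 + \<eta>) u\<close>.\<close>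

lemma original_form_bound:
  assumes F: "closed_csubspace F" "\<And>x. x \<in> F \<Longrightarrow> pert.A x \<in> F" and s: "s > 0"
    and form: "\<And>y. y \<in> orthocomp F \<Longrightarrow> inner (pert.A y) y \<le> s * (norm y)\<^sup>2"
    and y: "y \<in> orthocomp F"
  shows "inner (orig.A y) y \<le> (1 + \<eta>) * s * (norm y)\<^sup>2"
proof -
  define G where "G = orthocomp F"
  have clG: "closed_csubspace G" unfolding G_def by (rule closed_csubspace_orthocomp)
  have subG: "csubspace G" unfolding G_def by (rule csubspace_orthocomp)
  define B where "B = (\<lambda>y. orth_proj G (orig.A y))"
  have PF: "x - orth_proj G x \<in> F" for x
    using orth_proj_orth[OF clG, of x] orthocomp_orthocomp[OF F(1)] by (simp add: G_def)
  have AG: "pert.A x \<in> G" if x: "x \<in> G" for x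
    unfolding G_def
  proof (rule orthocompI)
    fix f assume f: "f \<in> F"
    have "cinner f (pert.A x) = cinner (pert.A f) x" using pert.A_sym by simp
    then show "cinner f (pert.A x) = 0" using orthocompD(1)[of x F] x F(2)[OF f] by (simp add: G_def)
  qed
  have A_proj: "pert.A (orth_proj G x) = orth_proj G (pert.A x)" for x
  proof (rule orth_proj_unique[OF clG, symmetric])
    show "pert.A (orth_proj G x) \<in> G" by (rule AG[OF orth_proj_in[OF clG]])
    have "pert.A x - pert.A (orth_proj G x) = pert.A (x - orth_proj G x)" by (simp add: pert.A_diff)
    also have "\<dots> \<in> F" by (rule F(2)[OF PF])
    finally show "pert.A x - pert.A (orth_proj G x) \<in> orthocomp G"
      using orthocomp_orthocomp[OF F(1)] by (simp add: G_def)
  qed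
  show ?thesis
  proof (rule orig.compression_form_bound[OF clG subset_UNIV])
    show "y \<in> G" using y by (simp add: G_def)
    fix \<alpha> assume \<alpha>: "\<alpha> > (1 + \<eta>) * s"
    define \<delta> where "\<delta> = \<alpha> - (1 + \<eta>) * s"
    have \<delta>: "\<delta> > 0" "\<alpha> = (1 + \<eta>) * s + \<delta>" using \<alpha> by (auto simp: \<delta>_def)
    have \<eta>2: "1 - \<eta>\<^sup>2 > 0" using \<eta>_nonneg \<eta>_less by (simp add: power_less_one_iff abs_square_less_1)
    define c where "c = \<delta> * (1 - \<eta>\<^sup>2) / 4"
    have c: "c > 0" using \<delta> \<eta>2 by (simp add: c_def)
    have "c * norm u \<le> norm (B u - \<alpha> *\<^sub>R u)" if u: "u \<in> G" for u
    proof (cases "u = 0")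
      case False
      define r where "r = B u - \<alpha> *\<^sub>R u"
      define x where "x = orig.A u"
      define v where "v = orth_proj G (H' x)"
      have x: "x \<in> Dom" "H x = u" by (auto simp: x_def orig.A_in_D orig.T_A)
      have vG: "v \<in> G" unfolding v_def by (rule orth_proj_in[OF clG])
      have Av: "pert.A v = \<alpha> *\<^sub>R u + r"
        unfolding v_def A_proj pert.A_T[OF x(1)] by (simp add: r_def B_def x_def)
      have "u - v = orth_proj G (H x - H' x)"
        by (simp add: orth_proj_diff[OF clG] x(2) orth_proj_fixed[OF clG u] v_def)
      then have uv: "norm (u - v) \<le> \<eta> * norm u"
        using order_trans[OF norm_orth_proj_le[OF clG] rel_bound[OF x(1)]] by (simp add: x(2))
      define N where "N = norm u"
      define V where "V = norm v"
      have N: "N > 0" using False by (simp add: N_def)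
      have V0: "V \<ge> 0" by (simp add: V_def)
      have VN: "V \<le> (1 + \<eta>) * N"
        using uv norm_triangle_ineq3[of u v] by (simp add: V_def N_def algebra_simps abs_le_iff)
      have "(norm (u - v))\<^sup>2 \<le> (\<eta> * N)\<^sup>2" using uv by (intro power_mono) (auto simp: N_def)
      then have iuv: "inner u v \<ge> ((1 - \<eta>\<^sup>2) * N\<^sup>2 + V\<^sup>2) / 2"
        by (simp add: norm_diff_sq V_def N_def power_mult_distrib algebra_simps)
      have "\<alpha> * inner u v + inner r v \<le> s * V\<^sup>2"
        using form[of v] vG by (simp add: Av G_def V_def inner_add_left)
      moreover have "- inner r v \<le> norm r * V"
        using norm_cauchy_schwarz[of "- r" v] by (simp add: V_def)
      ultimately have "\<alpha> * inner u v \<le> s * V\<^sup>2 + norm r * V" by linarith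
      moreover have "\<alpha> > 0" using \<alpha> s \<eta>_nonneg by (smt (verit) mult_pos_pos)
      ultimately have "\<alpha> * (((1 - \<eta>\<^sup>2) * N\<^sup>2 + V\<^sup>2) / 2) \<le> s * V\<^sup>2 + norm r * V"
        using mult_left_mono[OF iuv, of \<alpha>] by linarith
      \<comment> \<open>\<open>(1 + \<eta>) ((1 - \<eta>\<^sup>2) N\<^sup>2 + V\<^sup>2) \<ge> 2 V\<^sup>2\<close> is equivalent to \<open>V \<le> (1 + \<eta>) N\<close>\<close>
      moreover have "s * V\<^sup>2 \<le> (1 + \<eta>) * s * (((1 - \<eta>\<^sup>2) * N\<^sup>2 + V\<^sup>2) / 2)"
      proof -
        have "(1 - \<eta>) * V\<^sup>2 \<le> (1 - \<eta>) * ((1 + \<eta>) * N)\<^sup>2"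
          using VN V0 \<eta>_less by (intro mult_left_mono power_mono) auto
        then have "2 * V\<^sup>2 \<le> (1 + \<eta>) * ((1 - \<eta>\<^sup>2) * N\<^sup>2 + V\<^sup>2)"
          by (simp add: power2_eq_square algebra_simps)
        then have "s * (2 * V\<^sup>2) \<le> s * ((1 + \<eta>) * ((1 - \<eta>\<^sup>2) * N\<^sup>2 + V\<^sup>2))"
          using s by (intro mult_left_mono) auto
        then show ?thesis by (simp add: mult.commute mult.left_commute)
      qed
      ultimately have "\<delta> * (((1 - \<eta>\<^sup>2) * N\<^sup>2 + V\<^sup>2) / 2) \<le> norm r * V"
        by (simp only: \<delta>(2) distrib_right)
      moreover have "norm r * V \<le> norm r * (2 * N)"
        using order_trans[OF VN, of "2 * N"] N \<eta>_less by (intro mult_left_mono) auto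
      moreover have "\<delta> * ((1 - \<eta>\<^sup>2) * N\<^sup>2 / 2) \<le> \<delta> * (((1 - \<eta>\<^sup>2) * N\<^sup>2 + V\<^sup>2) / 2)"
        using \<delta>(1) by (intro mult_left_mono divide_right_mono) auto
      ultimately have "\<delta> * ((1 - \<eta>\<^sup>2) * N\<^sup>2 / 2) \<le> norm r * (2 * N)" by linarith
      moreover have "\<delta> * ((1 - \<eta>\<^sup>2) * N\<^sup>2 / 2) = (c * N) * (2 * N)"
        by (simp add: c_def power2_eq_square[of N])
      ultimately have "(c * N) * (2 * N) \<le> norm r * (2 * N)" by (simp only:)
      then have "c * N \<le> norm r" using N by (simp add: mult_le_cancel_right)
      then show ?thesis by (simp add: r_def N_def)
    qed simp
    then show "\<exists>c>0. \<forall>u\<in>G. c * norm u \<le> norm (orth_proj G (orig.A u) - \<alpha> *\<^sub>R u)"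
      unfolding B_def using c by blast
  qed
qed

end

section \<open>Comparison of eigenvalue counts\<close>

text \<open>By monotonicity the entries up to \<open>\<tau>\<close> occupy an initial segment of \<open>L\<close>, so their number decides
which indices belong to them.\<close>

lemma initial_segment_le:
  assumes L: "initial_segment L" and mono: "mono_on L lam" and fin: "finite {l \<in> L. lam l \<le> \<tau>}"
    and j: "1 \<le> j" "j \<le> card {l \<in> L. lam l \<le> \<tau>}"
  shows "j \<in> L \<and> lam j \<le> (\<tau> :: real)"
proof (rule ccontr)
  assume not: "\<not> (j \<in> L \<and> lam j \<le> \<tau>)"
  have "{l \<in> L. lam l \<le> \<tau>} \<subseteq> {1..<j}"
  proof
    fix l assume l: "l \<in> {l \<in> L. lam l \<le> \<tau>}"
    have "l \<noteq> 0" using l L unfolding initial_segment_def by (metis (no_types, lifting) mem_Collect_eq)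
    moreover have "\<not> j \<le> l"
    proof
      assume jl: "j \<le> l"
      then have "j \<in> {1..l}" using j(1) by simp
      then have jL: "j \<in> L" using L l unfolding initial_segment_def by blast
      have "lam j \<le> lam l" using mono_onD[OF mono jL _ jl] l by blast
      then show False using not jL l by auto
    qed
    ultimately show "l \<in> {1..<j}" by auto
  qed
  then have "card {l \<in> L. lam l \<le> \<tau>} \<le> card {1..<j}" by (intro card_mono) auto
  then show False using j by simp
qed

lemma ereal_scaled_less:
  assumes "(\<eta> :: real) < 1" "ereal t < ereal (1 - \<eta>) * d" "0 < t"
  shows "ereal (t / (1 - \<eta>)) < d"
proof (cases d)
  case (real r)
  then show ?thesis using assms by (simp add: pos_divide_less_eq mult.commute)
qed (use assms in auto)

context relatively_bounded_pair
begin

context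
  fixes d :: ereal
  assumes disc: "\<And>t. 0 < t \<Longrightarrow> ereal t < d \<Longrightarrow> complex_of_real t \<in> spectrum UNIV Dom H
    \<Longrightarrow> complex_of_real t \<in> discrete_spectrum UNIV Dom H"
begin

lemma disc_le: "ereal \<tau> < d \<Longrightarrow> 0 < t \<Longrightarrow> t \<le> \<tau> \<Longrightarrow> complex_of_real t \<in> spectrum UNIV Dom H
    \<Longrightarrow> complex_of_real t \<in> discrete_spectrum UNIV Dom H"
  using disc[of t] le_less_trans[of "ereal t" "ereal \<tau>" d] by simp

lemma cfinite_dim_orig: "ereal \<tau> < d \<Longrightarrow> I \<subseteq> {0<..\<tau>} \<Longrightarrow> cfinite_dim (orig.Eig I)"
  by (rule orig.cdim_Eig_eq_sum(2)[where \<tau> = \<tau>]) (auto intro: disc_le)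

lemma pert_form_bound_below:
  assumes t: "0 < t" "ereal t < ereal (1 - \<eta>) * d"
  shows "\<exists>s>0. t < 1 / s \<and>
    (\<forall>y\<in>orthocomp (orig.Eig {0<..t / (1 - \<eta>)}). inner (pert.A y) y \<le> s * (norm y)\<^sup>2)"
proof -
  define \<tau> where "\<tau> = t / (1 - \<eta>)"
  have \<tau>: "\<tau> > 0" "ereal \<tau> < d" using t ereal_scaled_less[OF \<eta>_less] \<eta>_less by (auto simp: \<tau>_def)
  obtain s0 where s0: "s0 < 1 / \<tau>"
    "\<And>y. y \<in> orthocomp (orig.Eig {0<..\<tau>}) \<Longrightarrow> inner (orig.A y) y \<le> s0 * (norm y)\<^sup>2"
    using orig.form_bound_orthocomp_Eig_closed[OF \<tau>(1) disc_le[OF \<tau>(2)]] by auto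
  \<comment> \<open>\<open>s0\<close> may be negative, but the transfer to \<open>H'\<close> requires a positive bound\<close>
  define s1 where "s1 = max s0 (1 / (2 * \<tau>))"
  have s1: "s1 > 0" "s1 < 1 / \<tau>" using s0(1) \<tau>(1) by (auto simp: s1_def field_simps less_max_iff_disj)
  have b: "inner (orig.A y) y \<le> s1 * (norm y)\<^sup>2" if "y \<in> orthocomp (orig.Eig {0<..\<tau>})" for y
    by (rule order_trans[OF s0(2)[OF that] mult_right_mono]) (auto simp: s1_def)
  have clF: "closed_csubspace (orig.Eig {0<..\<tau>})"
    by (intro closed_csubspace_cfinite_dim orig.csubspace_Eig cfinite_dim_orig[OF \<tau>(2)]) simp
  have "inner (pert.A y) y \<le> s1 / (1 - \<eta>) * (norm y)\<^sup>2" if "y \<in> orthocomp (orig.Eig {0<..\<tau>})" for y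
    by (rule perturbed_form_bound[OF clF _ _ s1(1) b that]) (auto intro: orig.Eig_in_D orig.T_Eig)
  moreover have "s1 / (1 - \<eta>) > 0" using s1(1) \<eta>_less by simp
  moreover have "t < 1 / (s1 / (1 - \<eta>))"
  proof -
    have "s1 * \<tau> < 1" using s1(2) \<tau>(1) by (simp add: pos_less_divide_eq)
    then have "t * s1 < 1 - \<eta>" using \<eta>_less by (simp add: \<tau>_def field_simps)
    then show ?thesis using s1(1) by (simp add: pos_less_divide_eq)
  qed
  ultimately show ?thesis unfolding \<tau>_def by blast
qed

lemma pert_discrete:
  assumes "0 < t" "ereal t < ereal (1 - \<eta>) * d" "complex_of_real t \<in> spectrum UNIV Dom H'"
  shows "complex_of_real t \<in> discrete_spectrum UNIV Dom H'"
proof -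
  obtain s where s: "s > 0" "t < 1 / s"
    "\<And>y. y \<in> orthocomp (orig.Eig {0<..t / (1 - \<eta>)}) \<Longrightarrow> inner (pert.A y) y \<le> s * (norm y)\<^sup>2"
    using pert_form_bound_below[OF assms(1,2)] by blast
  have fd: "cfinite_dim (orig.Eig {0<..t / (1 - \<eta>)})"
    by (rule cfinite_dim_orig[OF ereal_scaled_less[OF \<eta>_less assms(2,1)]]) simp
  show ?thesis
    by (rule pert.discrete_if_form_bound[OF orig.csubspace_Eig fd _ s(1) s(3) assms(1) s(2) assms(3)]) simp_all
qed

lemma pert_discrete_le:
  assumes "ereal \<tau> < ereal (1 - \<eta>) * d" "0 < t" "t \<le> \<tau>" "complex_of_real t \<in> spectrum UNIV Dom H'"
  shows "complex_of_real t \<in> discrete_spectrum UNIV Dom H'"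
  by (rule pert_discrete[OF assms(2) _ assms(4)]) (rule le_less_trans[OF _ assms(1)], use assms(3) in simp)

text \<open>The two counting inequalities for \<open>H\<close> and \<open>H'\<close>, in the form in which they bound the \<open>j\<close>-th
eigenvalue of \<open>H'\<close> from below and from above, are this lemma and the next one.\<close>

lemma cdim_pert_le_cdim_orig:
  assumes t: "0 < t" "ereal t < ereal (1 - \<eta>) * d"
  shows "cdim (pert.Eig {0<..t}) \<le> cdim (orig.Eig {0<..t / (1 - \<eta>)})"
proof -
  obtain s where s: "s > 0" "t < 1 / s"
    "\<And>y. y \<in> orthocomp (orig.Eig {0<..t / (1 - \<eta>)}) \<Longrightarrow> inner (pert.A y) y \<le> s * (norm y)\<^sup>2"
    using pert_form_bound_below[OF t] by blast
  have fd: "cfinite_dim (orig.Eig {0<..t / (1 - \<eta>)})"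
    by (rule cfinite_dim_orig[OF ereal_scaled_less[OF \<eta>_less t(2,1)]]) simp
  have "cdim (pert.Eig {0<..t}) \<le> cdim (pert.Eig {0<..<1 / s})"
    by (rule cdim_mono[OF pert.Eig_mono pert.cdim_Eig_le(1)[OF orig.csubspace_Eig fd _ s(1) s(3)]])
       (use s(2) in auto)
  also have "\<dots> \<le> cdim (orig.Eig {0<..t / (1 - \<eta>)})"
    by (rule pert.cdim_Eig_le(2)[OF orig.csubspace_Eig fd _ s(1) s(3)]) auto
  finally show ?thesis .
qed

lemma cdim_orig_le_cdim_pert:
  assumes t: "0 < t" "ereal t < ereal (1 - \<eta>) * d"
  shows "cdim (orig.Eig {0<..<t / (1 + \<eta>)}) \<le> cdim (pert.Eig {0<..<t})"
proof -
  have fd: "cfinite_dim (pert.Eig {0<..<t})"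
    by (rule pert.cdim_Eig_eq_sum(2)[where \<tau> = t]) (auto intro: pert_discrete_le[OF t(2)])
  have clF: "closed_csubspace (pert.Eig {0<..<t})"
    by (rule closed_csubspace_cfinite_dim[OF pert.csubspace_Eig fd])
  have form: "inner (pert.A y) y \<le> 1 / t * (norm y)\<^sup>2" if "y \<in> orthocomp (pert.Eig {0<..<t})" for y
    by (rule pert.form_bound_orthocomp_Eig_open[OF t(1) pert_discrete_le[OF t(2)]]) (use that in auto)
  have "x = 0" if x: "x \<in> orig.Eig {0<..<t / (1 + \<eta>)}" "x \<in> orthocomp (pert.Eig {0<..<t})" for x
  proof (rule ccontr)
    assume "x \<noteq> 0"
    then have "1 / (t / (1 + \<eta>)) * (norm x)\<^sup>2 < inner (orig.A x) x"
      by (intro orig.Eig_form[OF x(1)]) auto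
    moreover have "inner (orig.A x) x \<le> (1 + \<eta>) * (1 / t) * (norm x)\<^sup>2"
      by (rule original_form_bound[OF clF _ _ form x(2)]) (use t in \<open>auto intro: pert.A_Eig\<close>)
    ultimately show False by simp
  qed
  then show ?thesis by (rule cdim_le_if_disjoint_orthocomp(2)[OF orig.csubspace_Eig pert.csubspace_Eig fd])
qed

text \<open>The index of \<open>\<mu> k\<close> is chosen as its position among all eigenvalues of \<open>H'\<close>: the number of eigenvalues of
\<open>H'\<close> below \<open>\<mu> k\<close>, plus its position among the entries of the family \<open>\<mu>\<close> that are equal to it.  It exceeds
\<open>N\<^bsub>H'\<^esub> (0, \<mu> k)\<close> and is at most \<open>N\<^bsub>H'\<^esub> (0, \<mu> k]\<close>, because \<open>\<mu>\<close> repeats each value at most as often as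
\<open>H'\<close> does; the counting inequalities apply to exactly these two numbers.\<close>

lemma match_indices:
  fixes J :: "nat set"
  assumes J: "\<And>k. k \<in> J \<Longrightarrow> 0 < \<mu> k \<and> ereal (\<mu> k) < ereal (1 - \<eta>) * d" "mono_on J \<mu>"
      "\<And>k. k \<in> J \<Longrightarrow> finite {i \<in> J. \<mu> i = \<mu> k}"
      "\<And>k. k \<in> J \<Longrightarrow> card {i \<in> J. \<mu> i = \<mu> k} \<le> cdim (eigenspace Dom H' (complex_of_real (\<mu> k)))"
    and L: "initial_segment L" "eigenvalue_family Dom H {t. 0 < t \<and> ereal t < d} L lam"
  shows "\<exists>j. strict_mono_on J j \<and> (\<forall>k\<in>J. j k \<in> L \<and> \<bar>lam (j k) - \<mu> k\<bar> / lam (j k) \<le> \<eta>)"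
proof -
  define below where "below = (\<lambda>t. cdim (pert.Eig {0<..<t}))"
  define upto where "upto = (\<lambda>t. cdim (pert.Eig {0<..t}))"
  define j where "j = (\<lambda>k. below (\<mu> k) + card {i \<in> J. i \<le> k \<and> \<mu> i = \<mu> k})"
  have fin: "finite {i \<in> J. i \<le> k \<and> \<mu> i = \<mu> k}" for k :: nat
    by (rule finite_subset[of _ "{..k}"]) auto
  have j_gt: "below (\<mu> k) < j k" if "k \<in> J" for k
  proof -
    have "{i \<in> J. i \<le> k \<and> \<mu> i = \<mu> k} \<noteq> {}" using that by blast
    then have "card {i \<in> J. i \<le> k \<and> \<mu> i = \<mu> k} > 0" using fin by (simp add: card_gt_0_iff)
    then show ?thesis by (simp add: j_def)
  qed
  have j_le: "j k \<le> upto (\<mu> k)" if k: "k \<in> J" for k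
  proof -
    define t where "t = \<mu> k"
    have t: "0 < t" "ereal t < ereal (1 - \<eta>) * d" using J(1)[OF k] by (auto simp: t_def)
    have dp: "\<And>s. 0 < s \<Longrightarrow> s \<le> t \<Longrightarrow> complex_of_real s \<in> spectrum UNIV Dom H' 
        \<Longrightarrow> complex_of_real s \<in> discrete_spectrum UNIV Dom H'" by (rule pert_discrete_le[OF t(2)])
    let ?E = "\<lambda>s. eigenspace Dom H' (complex_of_real s)"
    define S where "S = {s \<in> {0<..<t}. ?E s \<noteq> {0}}"
    have finS: "finite S" unfolding S_def by (rule pert.cdim_Eig_eq_sum(1)[OF _ dp]) auto
    have b: "below t = (\<Sum>s\<in>S. cdim (?E s))"
      unfolding below_def S_def by (rule pert.cdim_Eig_eq_sum(3)[OF _ dp]) auto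
    have fd: "cfinite_dim (?E s)" if "s \<in> insert t S" for s
      by (rule pert.cfinite_dim_eigenspace_if_discrete[OF dp]) (use that t in \<open>auto simp: S_def\<close>)
    have "pert.Eig {0<..t} = pert.Eig (insert t S)"
      by (rule pert.Eig_nontrivial) (use t in \<open>auto simp: S_def\<close>)
    moreover have "cdim (pert.Eig (insert t S)) = (\<Sum>s\<in>insert t S. cdim (?E s))"
      using pert.cdim_Eig[of "insert t S", OF _ fd] finS by blast
    moreover have "t \<notin> S" by (simp add: S_def)
    ultimately have u: "upto t = cdim (?E t) + below t" using finS unfolding upto_def b by simp
    have "card {i \<in> J. i \<le> k \<and> \<mu> i = \<mu> k} \<le> card {i \<in> J. \<mu> i = \<mu> k}"
      by (rule card_mono[OF J(3)[OF k]]) auto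
    also have "\<dots> \<le> cdim (?E t)" using J(4)[OF k] by (simp only: t_def)
    finally show ?thesis using u by (simp add: j_def t_def)
  qed
  have "strict_mono_on J j"
  proof (rule strict_mono_onI)
    fix k l assume kl: "k \<in> J" "l \<in> J" "k < l"
    have "\<mu> k \<le> \<mu> l" using mono_onD[OF J(2) kl(1,2)] kl(3) by simp
    show "j k < j l"
    proof (cases "\<mu> k = \<mu> l")
      case True
      have "card {i \<in> J. i \<le> k \<and> \<mu> i = \<mu> k} < card {i \<in> J. i \<le> l \<and> \<mu> i = \<mu> l}"
      proof (rule psubset_card_mono[OF fin])
        have "l \<in> {i \<in> J. i \<le> l \<and> \<mu> i = \<mu> l}" "l \<notin> {i \<in> J. i \<le> k \<and> \<mu> i = \<mu> k}"
          using kl by auto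
        moreover have "{i \<in> J. i \<le> k \<and> \<mu> i = \<mu> k} \<subseteq> {i \<in> J. i \<le> l \<and> \<mu> i = \<mu> l}"
          using True kl by auto
        ultimately show "{i \<in> J. i \<le> k \<and> \<mu> i = \<mu> k} \<subset> {i \<in> J. i \<le> l \<and> \<mu> i = \<mu> l}"
          by blast
      qed
      then show ?thesis by (simp add: j_def True)
    next
      case False
      then have lt: "\<mu> k < \<mu> l" using \<open>\<mu> k \<le> \<mu> l\<close> by simp
      have t: "ereal (\<mu> l) < ereal (1 - \<eta>) * d" using J(1)[OF kl(2)] by blast
      have fd: "cfinite_dim (pert.Eig {0<..<\<mu> l})"
        by (rule pert.cdim_Eig_eq_sum(2)[where \<tau> = "\<mu> l"]) (auto intro: pert_discrete_le[OF t])
      have "upto (\<mu> k) \<le> below (\<mu> l)"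
        unfolding upto_def below_def by (rule cdim_mono[OF pert.Eig_mono fd]) (use lt in auto)
      then show ?thesis using j_le[OF kl(1)] j_gt[OF kl(2)] by linarith
    qed
  qed
  moreover have "j k \<in> L \<and> \<bar>lam (j k) - \<mu> k\<bar> / lam (j k) \<le> \<eta>" if k: "k \<in> J" for k
  proof -
    define t where "t = \<mu> k"
    have t: "0 < t" "ereal t < ereal (1 - \<eta>) * d" using J(1)[OF k] by (auto simp: t_def)
    define \<tau> where "\<tau> = t / (1 - \<eta>)"
    have \<tau>: "\<tau> > 0" "ereal \<tau> < d" using t ereal_scaled_less[OF \<eta>_less] \<eta>_less by (auto simp: \<tau>_def)
    have lamI: "0 < lam l" if "l \<in> L" for l using L(2) that by (auto simp: eigenvalue_family_def)
    have mono: "mono_on L lam" using L(2) by (simp add: eigenvalue_family_def)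
    have sub: "{0<..\<tau>} \<subseteq> {t. 0 < t \<and> ereal t < d}"
      using le_less_trans[OF _ \<tau>(2)] by auto
    have eq: "{l \<in> L. lam l \<in> {0<..\<tau>}} = {l \<in> L. lam l \<le> \<tau>}" using lamI by auto
    note cnt = orig.card_eigenvalue_family[OF sub order_refl disc_le[OF \<tau>(2)] L(2), unfolded eq]
    have "j k \<le> card {l \<in> L. lam l \<le> \<tau>}"
      using j_le[OF k] cdim_pert_le_cdim_orig[OF t] cnt(2) by (simp add: upto_def t_def \<tau>_def)
    moreover have "1 \<le> j k" using j_gt[OF k] by linarith
    ultimately have jL: "j k \<in> L" "lam (j k) \<le> \<tau>" using initial_segment_le[OF L(1) mono cnt(1)] by blast+
    have "t / (1 + \<eta>) \<le> lam (j k)"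
    proof (rule ccontr)
      assume "\<not> t / (1 + \<eta>) \<le> lam (j k)"
      then have lt: "lam (j k) < t / (1 + \<eta>)" by simp
      have "t / (1 + \<eta>) \<le> \<tau>" unfolding \<tau>_def using t \<eta>_nonneg \<eta>_less by (intro divide_left_mono) auto
      then have sub2: "{0<..<t / (1 + \<eta>)} \<subseteq> {0<..\<tau>}" by auto
      note cnt2 = orig.card_eigenvalue_family[OF subset_trans[OF sub2 sub] sub2 disc_le[OF \<tau>(2)] L(2)]
      have "{1..j k} \<subseteq> {l \<in> L. lam l \<in> {0<..<t / (1 + \<eta>)}}"
      proof
        fix l assume l: "l \<in> {1..j k}"
        then have lL: "l \<in> L" using L(1) jL(1) unfolding initial_segment_def by blast
        have "lam l \<le> lam (j k)" using mono_onD[OF mono lL jL(1)] l by simp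
        then show "l \<in> {l \<in> L. lam l \<in> {0<..<t / (1 + \<eta>)}}" using lt lamI[OF lL] lL by simp
      qed
      from card_mono[OF cnt2(1) this] have "j k \<le> cdim (orig.Eig {0<..<t / (1 + \<eta>)})"
        by (simp only: cnt2(2) card_atLeastAtMost) simp
      also have "\<dots> \<le> below t" unfolding below_def by (rule cdim_orig_le_cdim_pert[OF t])
      finally show False using j_gt[OF k] by (simp add: t_def)
    qed
    then have "t \<le> (1 + \<eta>) * lam (j k)" using \<eta>_nonneg by (simp add: pos_divide_le_eq mult.commute)
    moreover have "(1 - \<eta>) * lam (j k) \<le> t"
      using jL(2) \<eta>_less by (simp add: \<tau>_def pos_le_divide_eq mult.commute)
    ultimately have "\<bar>lam (j k) - \<mu> k\<bar> \<le> \<eta> * lam (j k)" by (simp add: t_def abs_le_iff algebra_simps)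
    then show ?thesis using jL(1) lamI[OF jL(1)] by (simp add: pos_divide_le_eq)
  qed
  ultimately show ?thesis by blast
qed

end

end

section \<open>Block-diagonal part and compression\<close>

text \<open>If \<open>y\<close> has the adjoint value \<open>T w\<close>, then \<open>y - w\<close> is orthogonal to the range, which is everything.\<close>

lemma symmetric_surjective_imp_selfadjoint:
  assumes lin: "linear_op K D T" and K: "csubspace K" and dense: "closure D = K"
    and sym: "\<And>x y. x \<in> D \<Longrightarrow> y \<in> D \<Longrightarrow> cinner (T x) y = cinner x (T y)"
    and surj: "K \<subseteq> T ` D" and c: "c > 0" "\<And>x. x \<in> D \<Longrightarrow> c * norm x \<le> norm (T x)"
  shows "selfadjoint K D T" "has_bounded_inverse K D T"
proof -
  have D: "csubspace D" and DK: "D \<subseteq> K" and TK: "T ` D \<subseteq> K"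
    and T_add: "\<And>x y. x \<in> D \<Longrightarrow> y \<in> D \<Longrightarrow> T (x + y) = T x + T y"
    and T_scale: "\<And>a x. x \<in> D \<Longrightarrow> T (a *\<^sub>C x) = a *\<^sub>C T x"
    using lin by (auto simp: linear_op_def)
  have T_diff: "T (x - y) = T x - T y" if "x \<in> D" "y \<in> D" for x y
  proof -
    have "T ((-1) *\<^sub>C y) = - T y" using T_scale[OF that(2), of "-1"] by (simp add: complex_vector.scale_minus_left scaleC_one)
    then show ?thesis
      using T_add[OF that(1) csubspaceD(4)[OF D that(2), of "-1"]] 
      by (simp add: complex_vector.scale_minus_left scaleC_one)
  qed
  have dom: "adjoint_dom K D T = D"
  proof
    show "D \<subseteq> adjoint_dom K D T"
    proof
      fix y assume y: "y \<in> D"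
      then have "y \<in> K" "T y \<in> K" using DK TK by auto
      then show "y \<in> adjoint_dom K D T"
        unfolding adjoint_dom_def using sym[OF _ y] by (intro CollectI conjI bexI[of _ "T y"]) auto
    qed
    show "adjoint_dom K D T \<subseteq> D"
    proof
      fix y assume "y \<in> adjoint_dom K D T"
      then obtain z where yz: "y \<in> K" "z \<in> K" "\<forall>x\<in>D. cinner (T x) y = cinner x z"
        unfolding adjoint_dom_def by blast
      obtain w where w: "w \<in> D" "z = T w" using yz(2) surj by blast
      have ywK: "y - w \<in> K" by (rule csubspaceD(3)[OF K yz(1) subsetD[OF DK w(1)]])
      obtain x where x: "x \<in> D" "y - w = T x" using ywK surj by blast
      have "cinner (T x) (y - w) = 0" using yz(3) x(1) w sym by (simp add: cinner_diff_right)
      then have "y - w = 0" using x(2) by (simp add: cinner_self_eq_0)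
      then show "y \<in> D" using w(1) by simp
    qed
  qed
  have "adjoint_op K D T y = T y" if y: "y \<in> D" for y
    unfolding adjoint_op_def
  proof (rule the_equality)
    show "T y \<in> K \<and> (\<forall>x\<in>D. cinner (T x) y = cinner x (T y))" using TK y sym[OF _ y] by auto
    fix z assume z: "z \<in> K \<and> (\<forall>x\<in>D. cinner (T x) y = cinner x z)"
    have "z - T y = 0"
      by (rule eq_0_if_orthogonal_to_dense[OF dense csubspaceD(3)[OF K]])
         (use z y sym TK in \<open>auto simp: cinner_diff_right\<close>)
    then show "z = T y" by simp
  qed
  then show "selfadjoint K D T" using lin dense dom by (simp add: selfadjoint_def densely_defined_def)
  have "inj_on T D"
  proof (rule inj_onI)
    fix x y assume xy: "x \<in> D" "y \<in> D" "T x = T y"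
    then have "c * norm (x - y) \<le> 0" using c(2)[OF csubspaceD(3)[OF D xy(1,2)]] T_diff by simp
    then show "x = y" using c(1) by (simp add: mult_le_0_iff)
  qed
  then have "bij_betw T D K" using surj TK by (auto simp: bij_betw_def)
  moreover have "norm (inv_into D T y) \<le> (1 / c) * norm y" if y: "y \<in> K" for y
  proof -
    have "inv_into D T y \<in> D" "T (inv_into D T y) = y"
      using y surj by (auto intro: inv_into_into f_inv_into_f)
    then have "c * norm (inv_into D T y) \<le> norm y" using c(2) by metis
    then show ?thesis using c(1) by (simp add: field_simps)
  qed
  ultimately show "has_bounded_inverse K D T" unfolding has_bounded_inverse_def by blast
qed

text \<open>The uniform boundedness principle for the functionals \<open>cinner _ w\<close>, \<open>w \<in> W\<close>: by Baire's theorem one of the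
closed sets on which all of them are bounded by \<open>n\<close> contains a ball.\<close>

lemma uniform_boundedness:
  fixes W :: "'a :: chilbert_space set"
  assumes "\<And>x. \<exists>c. \<forall>w\<in>W. cmod (cinner x w) \<le> c"
  shows "\<exists>C. \<forall>w\<in>W. norm w \<le> C"
proof -
  define S where "S = (\<lambda>n :: nat. {x :: 'a. \<forall>w\<in>W. cmod (cinner x w) \<le> n})"
  have cl: "closed (S n)" for n
  proof -
    have "cmod (cinner x w) = cmod (cinner w x)" for x w :: 'a
      by (metis cinner_commute complex_mod_cnj)
    then have "S n = (\<Inter>w\<in>W. {x. cmod (cinner w x) \<le> n})" unfolding S_def by auto
    moreover have "continuous_on UNIV (\<lambda>x. cmod (cinner w x))" for w :: 'a
      by (intro continuous_on_norm linear_continuous_on bounded_linear_cinner_right)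
    then have "closed {x. cmod (cinner w x) \<le> n}" for w :: 'a
      by (intro closed_Collect_le continuous_on_const)
    ultimately show ?thesis by auto
  qed
  have "(\<Union>n. S n) = UNIV"
  proof (intro equalityI subsetI UNIV_I)
    fix x :: 'a
    obtain c where c: "\<forall>w\<in>W. cmod (cinner x w) \<le> c" using assms by blast
    obtain n :: nat where n: "c \<le> n" using real_arch_simple by blast
    have "x \<in> S n" unfolding S_def using c n order_trans by blast
    then show "x \<in> (\<Union>n. S n)" by blast
  qed
  have "\<exists>n. interior (S n) \<noteq> {}"
  proof (rule ccontr)
    assume "\<not> (\<exists>n. interior (S n) \<noteq> {})"
    then have emp: "interior (S n) = {}" for n by blast
    have "Met_TC.mtopology interior_of \<Union> (range S) = ({} :: 'a set)"
    proof (rule Met_TC.metric_Baire_category_alt)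
      show "Met_TC.mcomplete TYPE('a)" by (simp add: mcomplete_iff_complete complete_UNIV)
    qed (use cl emp in auto)
    then show False using \<open>(\<Union>n. S n) = UNIV\<close> by simp
  qed
  then obtain n x0 where "x0 \<in> interior (S n)" by blast
  then obtain r where r: "r > 0" "ball x0 r \<subseteq> S n" using mem_interior by blast
  have "norm w \<le> 4 * real n / r" if w: "w \<in> W" for w
  proof (cases "w = 0")
    case False
    define h where "h = (r / (2 * norm w)) *\<^sub>R w"
    have "norm h = r / 2" using False r(1) by (simp add: h_def)
    then have "x0 + h \<in> S n" "x0 \<in> S n" using r by (auto simp: dist_norm intro!: subsetD[OF r(2)])
    then have "cmod (cinner (x0 + h) w) \<le> n" "cmod (cinner x0 w) \<le> n" using w by (auto simp: S_def)
    then have "cmod (cinner h w) \<le> 2 * n"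
      using norm_triangle_ineq4[of "cinner (x0 + h) w" "cinner x0 w"] by (simp add: cinner_add_left)
    moreover have "cmod (cinner h w) = r / 2 * norm w"
      using False r(1) 
      by (simp add: h_def scaleR_scaleC cinner_scaleC_left cinner_self norm_mult norm_power power2_eq_square)
    ultimately show ?thesis using r(1) by (simp add: field_simps)
  qed (use r in simp)
  then show ?thesis by blast
qed

text \<open>The bound on the commutator is the hypothesis \<open>\<parallel>Q - P\<parallel> \<le> \<eta>\<close>, written without the inverse of \<open>H\<close>.\<close>

locale almost_reducing_subspace = orig: invertible_selfadjoint UNIV Dom H
  for Dom :: "'a :: chilbert_space set" and H :: "'a \<Rightarrow> 'a" +
  fixes U :: "'a set" and \<eta> :: real
  assumes closed_U: "closed_csubspace U"
    and proj_Dom: "x \<in> Dom \<Longrightarrow> orth_proj U x \<in> Dom"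
    and \<eta>_nonneg: "0 \<le> \<eta>" and \<eta>_less: "\<eta> < 1"
    and commutator: "x \<in> Dom \<Longrightarrow> norm (orth_proj U (H x) - H (orth_proj U x)) \<le> \<eta> * norm (H x)"
begin

abbreviation Q :: "'a \<Rightarrow> 'a" where "Q \<equiv> orth_proj U"

definition M :: "'a \<Rightarrow> 'a" where "M = (\<lambda>u. Q (H u))"

definition H' :: "'a \<Rightarrow> 'a" where "H' x = Q (H (Q x)) + (H (x - Q x) - Q (H (x - Q x)))"

lemma compl_Dom: "x \<in> Dom \<Longrightarrow> x - Q x \<in> Dom"
  by (intro csubspaceD(3)[OF orig.csubspace_D] proj_Dom)

text \<open>With \<open>p = Q H (1 - Q) x\<close> and \<open>q = (1 - Q) H Q x\<close>, the difference \<open>H x - H' x\<close> is \<open>p + q\<close> and the commutator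
is \<open>p - q\<close>; as \<open>p\<close> and \<open>q\<close> are orthogonal, both have the same norm.\<close>

lemma norm_H_diff_H': 
  assumes x: "x \<in> Dom" shows "norm (H x - H' x) \<le> \<eta> * norm (H x)"
proof -
  define p where "p = Q (H (x - Q x))"
  define q where "q = H (Q x) - Q (H (Q x))"
  have Hx: "H x = H (Q x) + H (x - Q x)"
    using orig.T_add[OF proj_Dom[OF x] compl_Dom[OF x]] by simp
  have pq: "inner p q = 0" unfolding p_def q_def by (rule orth_proj_decomp(1)[OF closed_U])
  have 1: "H x - H' x = p + q" by (simp add: H'_def Hx p_def q_def algebra_simps)
  have 2: "Q (H x) - H (Q x) = p - q" by (simp add: Hx orth_proj_add[OF closed_U] p_def q_def)
  have "norm (p + q) = norm (p - q)"
    by (rule power2_eq_imp_eq) (simp_all add: norm_add_sq norm_diff_sq pq)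
  then show ?thesis using commutator[OF x] by (simp only: 1 2)
qed

lemma H'_add: "x \<in> Dom \<Longrightarrow> y \<in> Dom \<Longrightarrow> H' (x + y) = H' x + H' y"
  using proj_Dom compl_Dom orig.T_add[of "Q x" "Q y"] orig.T_add[of "x - Q x" "y - Q y"]
  by (simp add: H'_def orth_proj_add[OF closed_U] add_diff_add)

lemma H'_scaleC: "x \<in> Dom \<Longrightarrow> H' (a *\<^sub>C x) = a *\<^sub>C H' x"
  using proj_Dom compl_Dom orig.T_scaleC[of "Q x" a] orig.T_scaleC[of "x - Q x" a]
  by (simp add: H'_def orth_proj_scaleC[OF closed_U] complex_vector.scale_right_distrib
     complex_vector.scale_right_diff_distrib)

lemma H'_sym: "x \<in> Dom \<Longrightarrow> y \<in> Dom \<Longrightarrow> cinner (H' x) y = cinner x (H' y)"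
proof -
  have split: "cinner (H' x) y = cinner (H (Q x)) (Q y) + cinner (H (x - Q x)) (y - Q y)" for x y
    by (simp add: H'_def cinner_simps orth_proj_cinner[OF closed_U])
  assume x: "x \<in> Dom" and y: "y \<in> Dom"
  have "cinner x (H' y) = cnj (cinner (H' y) x)" by (rule cinner_commute)
  also have "\<dots> = cinner (Q x) (H (Q y)) + cinner (x - Q x) (H (y - Q y))"
    unfolding split by (simp add: cinner_commute[symmetric])
  also have "\<dots> = cinner (H' x) y"
    unfolding split by (simp only: orig.T_sym proj_Dom compl_Dom x y)
  finally show ?thesis by simp
qed

text \<open>With \<open>A\<close> the inverse of \<open>H\<close>, \<open>H' A = 1 - R\<close> for a contraction \<open>R\<close>, and \<open>y = (1 - R) w\<close> is solved by the
contraction mapping principle.\<close>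

lemma H'_surj: "\<exists>x\<in>Dom. H' x = y"
proof -
  define f where "f = (\<lambda>w. y + (w - H' (orig.A w)))"
  have "dist (f v) (f w) \<le> \<eta> * dist v w" for v w
  proof -
    define z where "z = orig.A (v - w)"
    have z: "z \<in> Dom" "H z = v - w" by (auto simp: z_def orig.A_in_D orig.T_A)
    have zw: "orig.A v = z + orig.A w" by (simp add: z_def orig.A_diff)
    have "H' (orig.A v) = H' z + H' (orig.A w)"
      unfolding zw by (intro H'_add z orig.A_in_D UNIV_I)
    then have "f v - f w = H z - H' z" by (simp add: f_def z(2))
    then show ?thesis using norm_H_diff_H'[OF z(1)] by (simp add: dist_norm z(2))
  qed
  then obtain w where "f w = w" using banach_fix_type[OF \<eta>_nonneg \<eta>_less, of f] by blast
  then have "H' (orig.A w) = y" by (simp add: f_def algebra_simps)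
  then show ?thesis using orig.A_in_D[of w] by blast
qed

lemma H'_bounded_below: "\<exists>c>0. \<forall>x\<in>Dom. c * norm x \<le> norm (H' x)"
proof -
  obtain C where C: "C > 0" "\<And>y. norm (orig.A y) \<le> C * norm y" using orig.A_bounded by auto
  have "(1 - \<eta>) / C * norm x \<le> norm (H' x)" if x: "x \<in> Dom" for x
  proof -
    have "norm x \<le> C * norm (H x)" using C(2)[of "H x"] by (simp add: orig.A_T[OF x])
    then have "(1 - \<eta>) / C * norm x \<le> (1 - \<eta>) / C * (C * norm (H x))"
      using C(1) \<eta>_less by (intro mult_left_mono) auto
    also have "\<dots> = (1 - \<eta>) * norm (H x)" using C(1) by simp
    also have "\<dots> = norm (H x) - \<eta> * norm (H x)" by (simp add: left_diff_distrib)
    also have "\<dots> \<le> norm (H' x)"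
      using norm_H_diff_H'[OF x] norm_triangle_ineq2[of "H x" "H x - H' x"] by simp
    finally show ?thesis .
  qed
  then show ?thesis using C(1) \<eta>_less by (intro exI[of _ "(1 - \<eta>) / C"]) auto
qed

lemma M_eq_H': "u \<in> Dom \<Longrightarrow> u \<in> U \<Longrightarrow> M u = H' u"
  using orig.T_scaleR[OF csubspaceD(1)[OF orig.csubspace_D], of 0]
  by (simp add: M_def H'_def orth_proj_fixed[OF closed_U] orth_proj_scaleR[OF closed_U, of 0 0, simplified])

lemma csubspace_U: "csubspace U" using closed_U by (simp add: closed_csubspace_def)

sublocale pair: relatively_bounded_pair Dom H H' \<eta>
proof (unfold_locales)
  have lin: "linear_op UNIV Dom H'"
    using orig.csubspace_D by (auto simp: linear_op_def H'_add H'_scaleC)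
  obtain c where c: "c > 0" "\<And>x. x \<in> Dom \<Longrightarrow> c * norm x \<le> norm (H' x)" using H'_bounded_below by blast
  have surj: "UNIV \<subseteq> H' ` Dom"
  proof
    fix y
    obtain x where "x \<in> Dom" "y = H' x" using H'_surj[of y] by blast
    then show "y \<in> H' ` Dom" by blast
  qed
  show "selfadjoint UNIV Dom H'" "has_bounded_inverse UNIV Dom H'"
    using symmetric_surjective_imp_selfadjoint[OF lin orig.csubspace_K orig.dense H'_sym surj c] by blast+
qed (use \<eta>_nonneg \<eta>_less norm_H_diff_H' orig.closed_K in auto)

sublocale comp: invertible_selfadjoint U "Dom \<inter> U" M
proof (unfold_locales)
  show "closed_csubspace U" by (rule closed_U)
  have sub: "csubspace (Dom \<inter> U)"
    by (rule csubspaceI) (auto intro: csubspaceD[OF orig.csubspace_D] csubspaceD[OF csubspace_U])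
  have MU: "M u \<in> U" for u unfolding M_def by (rule orth_proj_in[OF closed_U])
  have lin: "linear_op U (Dom \<inter> U) M"
    unfolding linear_op_def using sub MU
    by (auto simp: M_def orig.T_add orig.T_scaleC orth_proj_add[OF closed_U] orth_proj_scaleC[OF closed_U])
  have dense: "closure (Dom \<inter> U) = U"
  proof
    have "closed U" using closed_U by (simp add: closed_csubspace_def)
    then show "closure (Dom \<inter> U) \<subseteq> U" by (intro closure_minimal) auto
    show "U \<subseteq> closure (Dom \<inter> U)"
    proof
      fix u assume u: "u \<in> U"
      have "u \<in> closure Dom" by (simp add: orig.dense)
      then obtain f where f: "\<forall>n. f n \<in> Dom" "f \<longlonglongrightarrow> u" unfolding closure_sequential by blast
      have "(\<lambda>n. Q (f n)) \<longlonglongrightarrow> Q u"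
        by (rule bounded_linear.tendsto[OF bounded_linear_orth_proj[OF closed_U] f(2)])
      then have "(\<lambda>n. Q (f n)) \<longlonglongrightarrow> u" by (simp add: orth_proj_fixed[OF closed_U u])
      then show "u \<in> closure (Dom \<inter> U)" unfolding closure_sequential
        using f(1) proj_Dom orth_proj_in[OF closed_U] by (intro exI[of _ "\<lambda>n. Q (f n)"]) auto
    qed
  qed
  have sym: "cinner (M x) y = cinner x (M y)" if "x \<in> Dom \<inter> U" "y \<in> Dom \<inter> U" for x y
    using that H'_sym[of x y] by (simp add: M_eq_H')
  have surj: "U \<subseteq> M ` (Dom \<inter> U)"
  proof
    fix u assume u: "u \<in> U"
    obtain x where x: "x \<in> Dom" "H' x = u" using H'_surj by blast
    have "Q (H' x) = Q (H (Q x))"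
      by (simp add: H'_def orth_proj_add[OF closed_U] orth_proj_diff[OF closed_U]
          orth_proj_fixed[OF closed_U orth_proj_in[OF closed_U]])
    then have "u = M (Q x)" using x(2) orth_proj_fixed[OF closed_U u] by (simp add: M_def)
    then show "u \<in> M ` (Dom \<inter> U)" using proj_Dom[OF x(1)] orth_proj_in[OF closed_U] by blast
  qed
  obtain c where c: "c > 0" "\<And>x. x \<in> Dom \<Longrightarrow> c * norm x \<le> norm (H' x)" using H'_bounded_below by blast
  have c': "c * norm x \<le> norm (M x)" if "x \<in> Dom \<inter> U" for x using c(2)[of x] that by (simp add: M_eq_H')
  show "selfadjoint U (Dom \<inter> U) M" "has_bounded_inverse U (Dom \<inter> U) M"
    using symmetric_surjective_imp_selfadjoint[OF lin csubspace_U dense sym surj c(1) c'] by blast+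
qed

lemma comp_A_eq: "y \<in> U \<Longrightarrow> comp.A y = pair.pert.A y"
  using comp.A_in_D[of y] comp.T_A[of y] M_eq_H'[of "comp.A y"] pair.pert.A_T[of "comp.A y"] by simp

text \<open>The form bound for \<open>H'\<inverse>\<close> restricts to \<open>U\<close>.  The finite-dimensional space \<open>F\<close> need not lie in \<open>U\<close>, so
its projection onto \<open>U\<close> takes over: it has the same orthogonal complement within \<open>U\<close>.\<close>

lemma comp_discrete:
  assumes disc: "\<And>t. 0 < t \<Longrightarrow> ereal t < d \<Longrightarrow> complex_of_real t \<in> spectrum UNIV Dom H
    \<Longrightarrow> complex_of_real t \<in> discrete_spectrum UNIV Dom H"
    and t: "0 < t" "ereal t < ereal (1 - \<eta>) * d" and spec: "complex_of_real t \<in> spectrum U (Dom \<inter> U) M"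
  shows "complex_of_real t \<in> discrete_spectrum U (Dom \<inter> U) M"
proof -
  define F where "F = orig.Eig {0<..t / (1 - \<eta>)}"
  have "\<exists>s>0. t < 1 / s \<and> (\<forall>y\<in>orthocomp F. inner (pair.pert.A y) y \<le> s * (norm y)\<^sup>2)"
    unfolding F_def by (rule pair.pert_form_bound_below[OF disc t])
  then obtain s where s: "s > 0" "t < 1 / s"
    "\<And>y. y \<in> orthocomp F \<Longrightarrow> inner (pair.pert.A y) y \<le> s * (norm y)\<^sup>2"
    by blast
  have F1: "csubspace F" unfolding F_def by (rule orig.csubspace_Eig)
  have F2: "cfinite_dim F" unfolding F_def
    by (rule pair.cfinite_dim_orig[OF disc ereal_scaled_less[OF \<eta>_less t(2,1)]]) auto
  note F = F1 F2
  have form: "inner (comp.A y) y \<le> s * (norm y)\<^sup>2" if y: "y \<in> U" "y \<in> orthocomp (Q ` F)" for y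
  proof -
    have "y \<in> orthocomp F"
    proof (rule orthocompI)
      fix f assume f: "f \<in> F"
      have "cinner f y = cinner (Q f) y"
        using orth_proj_cinner[OF closed_U, of f y] orth_proj_fixed[OF closed_U y(1)] by simp
      then show "cinner f y = 0" using orthocompD(1)[OF y(2)] f by simp
    qed
    then show ?thesis using s(3) comp_A_eq[OF y(1)] by simp
  qed
  show ?thesis
    by (rule comp.discrete_if_form_bound[OF cfinite_dim_image_orth_proj[OF closed_U F] _ s(1) form t(1) s(2) spec])
       (use orth_proj_in[OF closed_U] in auto)
qed

end

text \<open>The operator \<open>R = T Q A\<close> is everywhere defined, and its formal adjoint \<open>A Q T\<close> is defined on the dense
set \<open>D\<close>.  The vectors \<open>A Q T w\<close> with \<open>w \<in> D\<close>, \<open>|w| \<le> 1\<close>, are pointwise bounded as functionals, since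
\<open>\<langle>x, A Q T w\<rangle> = \<langle>R x, w\<rangle>\<close>, hence uniformly bounded; this bounds \<open>R\<close>.\<close>

lemma (in invertible_selfadjoint) bounded_linear_conjugated_projection:
  assumes K: "K = UNIV" and U: "closed_csubspace U" and inv: "\<And>x. x \<in> D \<Longrightarrow> orth_proj U x \<in> D"
  shows "bounded_linear (\<lambda>x. T (orth_proj U (A x)))"
proof -
  define R where "R = (\<lambda>x. T (orth_proj U (A x)))"
  define W where "W = {A (orth_proj U (T w)) | w. w \<in> D \<and> norm w \<le> 1}"
  have adj: "cinner (R x) w = cinner x (A (orth_proj U (T w)))" if w: "w \<in> D" for x w
  proof -
    have "cinner (R x) w = cinner (orth_proj U (A x)) (T w)"
      unfolding R_def by (rule T_sym[OF inv[OF A_in_D] w]) (simp add: K)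
    also have "\<dots> = cinner x (A (orth_proj U (T w)))"
      using A_sym[of x "orth_proj U (T w)"] by (simp add: orth_proj_cinner[OF U] K)
    finally show ?thesis .
  qed
  have "\<exists>c. \<forall>w\<in>W. cmod (cinner x w) \<le> c" for x
  proof (intro exI ballI)
    fix v assume "v \<in> W"
    then obtain w where w: "w \<in> D" "norm w \<le> 1" "v = A (orth_proj U (T w))" by (auto simp: W_def)
    have "cmod (cinner x v) = cmod (cinner (R x) w)" using adj[OF w(1)] w(3) by simp
    also have "\<dots> \<le> norm (R x) * norm w" by (rule norm_cinner_le)
    also have "\<dots> \<le> norm (R x) * 1" by (intro mult_left_mono w) auto
    finally show "cmod (cinner x v) \<le> norm (R x)" by simp
  qed
  then obtain C where C: "\<And>w. w \<in> W \<Longrightarrow> norm w \<le> C" using uniform_boundedness[of W] by blast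
  have "0 \<in> W" unfolding W_def using csubspaceD(1)[OF csubspace_D] T_scaleR[of 0 0] A_scaleR[of 0 0]
      orth_proj_scaleR[OF U, of 0 0] by (auto simp: K intro!: exI[of _ 0])
  then have C0: "C \<ge> 0" using C by force
  have Cw: "cmod (cinner (R x) w) \<le> norm x * C * norm w" if w: "w \<in> D" for x w
  proof (cases "w = 0")
    case False
    define v where "v = (1 / norm w) *\<^sub>R w"
    have v: "v \<in> D" "norm v = 1" using False csubspaceD(5)[OF csubspace_D w] by (auto simp: v_def)
    have "cmod (cinner (R x) v) \<le> norm x * norm (A (orth_proj U (T v)))"
      unfolding adj[OF v(1)] by (rule norm_cinner_le)
    also have "\<dots> \<le> norm x * C" using v by (intro mult_left_mono C) (auto simp: W_def)
    finally have *: "cmod (cinner (R x) v) \<le> norm x * C" .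
    have "w = norm w *\<^sub>R v" using False by (simp add: v_def)
    then have "cinner (R x) w = complex_of_real (norm w) * cinner (R x) v"
      by (metis scaleR_scaleC cinner_scaleC_right)
    then have "cmod (cinner (R x) w) = norm w * cmod (cinner (R x) v)" by (simp add: norm_mult)
    then show ?thesis using mult_left_mono[OF *, of "norm w"] by (simp add: mult.commute)
  qed simp
  have b: "norm (R x) \<le> norm x * C" for x
  proof -
    have "R x \<in> closure D" by (simp add: dense K)
    then obtain f where f: "\<forall>n. f n \<in> D" "f \<longlonglongrightarrow> R x" unfolding closure_sequential by blast
    have "cmod (cinner (R x) (R x)) \<le> norm x * C * norm (R x)"
    proof (rule LIMSEQ_le)
      show "(\<lambda>n. cmod (cinner (R x) (f n))) \<longlonglongrightarrow> cmod (cinner (R x) (R x))"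
        by (intro tendsto_norm tendsto_cinner f)
      show "(\<lambda>n. norm x * C * norm (f n)) \<longlonglongrightarrow> norm x * C * norm (R x)"
        by (intro tendsto_mult_left tendsto_norm f)
    qed (use f(1) Cw in blast)
    then have "norm (R x) * norm (R x) \<le> (norm x * C) * norm (R x)"
      by (simp only: cinner_self norm_of_real) (simp add: power2_eq_square)
    then show ?thesis
      by (cases "R x = 0") (use C0 in \<open>auto dest: mult_right_le_imp_le\<close>)
  qed
  have "bounded_linear R"
  proof (rule bounded_linear_intro[OF _ _ b])
    show "R (x + y) = R x + R y" for x y
      unfolding R_def using inv[OF A_in_D] by (simp add: A_add orth_proj_add[OF U] T_add K)
    show "R (r *\<^sub>R x) = r *\<^sub>R R x" for r x
      unfolding R_def using inv[OF A_in_D] by (simp add: A_scaleR orth_proj_scaleR[OF U] T_scaleR K)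
  qed
  then show ?thesis by (simp add: R_def)
qed

section \<open>Eigenvalues of the compression\<close>

theorem theorem3p6:
  fixes Dom :: "'a :: chilbert_space set"
    and H M P :: "'a \<Rightarrow> 'a"
    and U :: "'a set"
    and \<eta> :: real
    and d :: ereal
  assumes "selfadjoint UNIV Dom H"
    and "has_bounded_inverse UNIV Dom H"
    and "closed_csubspace U"
    and "orth_proj U ` Dom \<subseteq> Dom"
    and "M = (\<lambda>u. orth_proj U (H u))"
    and "P = (\<lambda>x. H (orth_proj U (inv_into Dom H x)))"
    and "\<eta> = onorm (\<lambda>x. orth_proj U x - P x)"
    and "\<eta> < 1"
    and "d = inf_pos_ess UNIV Dom H"
  shows "(selfadjoint U (Dom \<inter> U) M \<and> has_bounded_inverse U (Dom \<inter> U) M) \<and>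
         (0 < d \<and> inf_pos_ess U (Dom \<inter> U) M \<ge> ereal (1 - \<eta>) * d) \<and>
         (\<exists>L lam. initial_segment L \<and> eigenvalue_family Dom H {t. 0 < t \<and> ereal t < d} L lam) \<and>
         (\<exists>J \<mu>. eigenvalue_family (Dom \<inter> U) M {t. 0 < t \<and> ereal t < ereal (1 - \<eta>) * d} J \<mu>) \<and>
         (\<forall>L lam J \<mu>.
            initial_segment L \<longrightarrow>
            eigenvalue_family Dom H {t. 0 < t \<and> ereal t < d} L lam \<longrightarrow>
            eigenvalue_family (Dom \<inter> U) M {t. 0 < t \<and> ereal t < ereal (1 - \<eta>) * d} J \<mu> \<longrightarrow>
            (\<exists>j. strict_mono_on J j \<and>
                 (\<forall>k\<in>J. j k \<in> L \<and> \<bar>lam (j k) - \<mu> k\<bar> / lam (j k) \<le> \<eta>)))"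
proof -
  have "csubspace (UNIV :: 'a set)" by (rule csubspaceI) auto
  then have cU: "closed_csubspace (UNIV :: 'a set)" by (simp add: closed_csubspace_def)
  interpret H: invertible_selfadjoint UNIV Dom H
    by (rule invertible_selfadjoint.intro[OF cU assms(1,2)])
  have inv: "orth_proj U x \<in> Dom" if "x \<in> Dom" for x using assms(4) that by blast
  have P: "P = (\<lambda>x. H (orth_proj U (H.A x)))" by (simp add: assms(6) H.A_def)
  have "bounded_linear (\<lambda>x. orth_proj U x - P x)"
    unfolding P by (intro bounded_linear_sub bounded_linear_orth_proj assms(3) inv
        H.bounded_linear_conjugated_projection[OF refl assms(3)])
  note onorm = onorm[OF this, folded assms(7)] onorm_pos_le[OF this, folded assms(7)]
  interpret R: almost_reducing_subspace Dom H U \<eta>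
  proof unfold_locales
    fix x assume x: "x \<in> Dom"
    show "norm (orth_proj U (H x) - H (orth_proj U x)) \<le> \<eta> * norm (H x)"
      using onorm(1)[of "H x"] by (simp add: P H.A_T[OF x])
  qed (use assms(3,8) inv onorm(2) in auto)
  have M: "M = R.M" by (simp add: assms(5) R.M_def)
  have disc: "complex_of_real t \<in> discrete_spectrum UNIV Dom H"
    if "0 < t" "ereal t < d" "complex_of_real t \<in> spectrum UNIV Dom H" for t
  proof (rule ccontr)
    assume "complex_of_real t \<notin> discrete_spectrum UNIV Dom H"
    then have "ereal t \<in> ereal ` {r. 0 < r \<and> complex_of_real r \<in> essential_spectrum UNIV Dom H}"
      using that by (simp add: essential_spectrum_def)
    then have "d \<le> ereal t" unfolding assms(9) inf_pos_ess_def by (rule Inf_lower)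
    then show False using that(2) by simp
  qed
  have discM: "complex_of_real t \<in> discrete_spectrum U (Dom \<inter> U) M"
    if "0 < t" "ereal t < ereal (1 - \<eta>) * d" "complex_of_real t \<in> spectrum U (Dom \<inter> U) M" for t
    using R.comp_discrete[OF disc] that unfolding M by blast
  have a: "selfadjoint U (Dom \<inter> U) M \<and> has_bounded_inverse U (Dom \<inter> U) M"
    unfolding M using R.comp.selfadjoint R.comp.bounded_inverse by blast
  have d: "0 < d"
  proof -
    obtain \<epsilon> where \<epsilon>: "\<epsilon> > 0" "\<And>t :: real. \<bar>t\<bar> < \<epsilon> \<Longrightarrow> complex_of_real t \<notin> spectrum UNIV Dom H"
      using H.spectrum_gap by blast
    have "ereal \<epsilon> \<le> d" unfolding assms(9) inf_pos_ess_def
    proof (rule Inf_greatest)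
      fix z assume "z \<in> ereal ` {r. 0 < r \<and> complex_of_real r \<in> essential_spectrum UNIV Dom H}"
      then obtain r where "z = ereal r" "0 < r" "complex_of_real r \<in> spectrum UNIV Dom H"
        by (auto simp: essential_spectrum_def)
      then show "ereal \<epsilon> \<le> z" using \<epsilon>(2)[of r] by force
    qed
    then show ?thesis using \<epsilon>(1) less_le_trans[of 0 "ereal \<epsilon>" d] by simp
  qed
  have b: "ereal (1 - \<eta>) * d \<le> inf_pos_ess U (Dom \<inter> U) M"
    unfolding inf_pos_ess_def
  proof (rule Inf_greatest, rule ccontr)
    fix z assume "z \<in> ereal ` {r. 0 < r \<and> complex_of_real r \<in> essential_spectrum U (Dom \<inter> U) M}"
      and nle: "\<not> ereal (1 - \<eta>) * d \<le> z"
    then obtain r where r: "z = ereal r" "0 < r" "complex_of_real r \<in> spectrum U (Dom \<inter> U) M"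
      "complex_of_real r \<notin> discrete_spectrum U (Dom \<inter> U) M"
      by (auto simp: essential_spectrum_def)
    then show False using discM[of r] nle by simp
  qed
  have famH: "\<exists>L lam. initial_segment L \<and> eigenvalue_family Dom H {t. 0 < t \<and> ereal t < d} L lam"
    by (rule H.eigenvalue_family_exists[OF disc])
  have famM: "\<exists>J \<mu>. eigenvalue_family (Dom \<inter> U) M {t. 0 < t \<and> ereal t < ereal (1 - \<eta>) * d} J \<mu>"
    using R.comp.eigenvalue_family_exists[OF discM[unfolded M]] unfolding M by blast
  have c: "\<exists>j. strict_mono_on J j \<and> (\<forall>k\<in>J. j k \<in> L \<and> \<bar>lam (j k) - \<mu> k\<bar> / lam (j k) \<le> \<eta>)"
    if L: "initial_segment L" "eigenvalue_family Dom H {t. 0 < t \<and> ereal t < d} L lam"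
      and fam: "eigenvalue_family (Dom \<inter> U) M {t. 0 < t \<and> ereal t < ereal (1 - \<eta>) * d} J \<mu>" for L lam J \<mu>
  proof (rule R.pair.match_indices[OF disc _ _ _ _ L])
    have \<mu>: "0 < \<mu> k \<and> ereal (\<mu> k) < ereal (1 - \<eta>) * d" if "k \<in> J" for k
      using fam that by (auto simp: eigenvalue_family_def)
    then show "0 < \<mu> k \<and> ereal (\<mu> k) < ereal (1 - \<eta>) * d" if "k \<in> J" for k using that .
    show "mono_on J \<mu>" using fam by (simp add: eigenvalue_family_def)
    fix k assume k: "k \<in> J"
    let ?t = "complex_of_real (\<mu> k)"
    have *: "finite {i \<in> J. \<mu> i = \<mu> k} \<and> card {i \<in> J. \<mu> i = \<mu> k} = cdim (eigenspace (Dom \<inter> U) M ?t)"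
      using fam \<mu>[OF k] unfolding eigenvalue_family_def Let_def by blast
    then show "finite {i \<in> J. \<mu> i = \<mu> k}" by blast
    have "eigenspace (Dom \<inter> U) M ?t \<subseteq> eigenspace Dom R.H' ?t"
      using R.M_eq_H' by (auto simp: eigenspace_def M)
    moreover have "cfinite_dim (eigenspace Dom R.H' ?t)"
      using \<mu>[OF k] R.pair.pert_discrete[OF disc] by (intro R.pair.pert.cfinite_dim_eigenspace_if_discrete) auto
    ultimately show "card {i \<in> J. \<mu> i = \<mu> k} \<le> cdim (eigenspace Dom R.H' ?t)"
      using * cdim_mono by metis
  qed
  show ?thesis using a d b famH famM c by blast
qed

end
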